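(* Let $G=N\rtimes J$ be a profinite semidirect product, where $N$ is pronilpotent and either $G$ is prosupersolvable or $J$ is pronilpotent. Suppose $G$ acts transitively on a nonempty set $\Omega$ such that the point stabilizer $G_\alpha$ is closed in $G$ for every $\alpha\in\Omega$. If $N_\alpha$ is normal in $N$ for some $\alpha\in\Omega$, and for each prime $p$ a Sylow $p$-subgroup of $J$ fixes an element of $\Omega$, then $J$ fixes an element of $\Omega$.
   Context: A profinite semidirect product $G=N\rtimes J$ is a profinite group $G$ with a closed normal subgroup $N$ and a closed subgroup $J$ such that $G=NJ$ and $N\cap J=1$. A profinite group is pronilpotent (resp. prosupersolvable) if it is an inverse limit of finite nilpotent (resp. finite supersolvable) groups. $G_\alpha$ is the stabilizer of $\alpha$ in $G$ and $N_\alpha=N\cap G_\alpha$ is the stabilizer of $\alpha$ in $N$. A subgroup fixes $\omega\in\Omega$ if each of its elements does. Sylow $p$-subgroups are in the profinite sense (maximal pro-$p$ subgroups); the fixed element may depend on $p$. *)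

theory Defs
  imports
    "HOL-Analysis.Analysis"
    "HOL-Algebra.Group_Action"
    "HOL-Algebra.Product_Groups"
    "HOL-Computational_Algebra.Primes"
begin

section \<open>Classes of finite groups\<close>

text \<open>Nilpotency via a central series: the commutator condition says that
  each factor \<open>K (Suc i) / K i\<close> is contained in the centre of \<open>H / K i\<close>.\<close>

definition nilpotent_group :: "('a, 'm) monoid_scheme \<Rightarrow> bool" where
  "nilpotent_group H \<longleftrightarrow> group H \<and>
     (\<exists>(n::nat) K. K 0 = {\<one>\<^bsub>H\<^esub>} \<and> K n = carrier H \<and>
        (\<forall>i\<le>n. K i \<lhd> H) \<and>
        (\<forall>i<n. K i \<subseteq> K (Suc i) \<and>
          (\<forall>x\<in>K (Suc i). \<forall>g\<in>carrier H.
             x \<otimes>\<^bsub>H\<^esub> g \<otimes>\<^bsub>H\<^esub> inv\<^bsub>H\<^esub> x \<otimes>\<^bsub>H\<^esub> inv\<^bsub>H\<^esub> g \<in> K i)))"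

definition supersolvable_group :: "('a, 'm) monoid_scheme \<Rightarrow> bool" where
  "supersolvable_group H \<longleftrightarrow> group H \<and>
     (\<exists>(n::nat) K. K 0 = {\<one>\<^bsub>H\<^esub>} \<and> K n = carrier H \<and>
        (\<forall>i\<le>n. K i \<lhd> H) \<and>
        (\<forall>i<n. K i \<subseteq> K (Suc i) \<and>
          cyclic_group ((H\<lparr>carrier := K (Suc i)\<rparr>) Mod (K i))))"

definition finite_p_group :: "nat \<Rightarrow> ('a, 'm) monoid_scheme \<Rightarrow> bool" where
  "finite_p_group p H \<longleftrightarrow> group H \<and> (\<exists>k::nat. order H = p ^ k)"


section \<open>Inverse limits\<close>

text \<open>Inverse systems over a directed poset; \<open>(i, j) \<in> r\<close> is read as \<open>i \<le> j\<close>,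
  and \<open>f i j\<close> is then the transition map from \<open>H j\<close> to \<open>H i\<close>.\<close>

definition inverse_system ::
  "'i set \<Rightarrow> ('i \<times> 'i) set \<Rightarrow> ('i \<Rightarrow> ('b, 'm) monoid_scheme) \<Rightarrow> ('i \<Rightarrow> 'i \<Rightarrow> 'b \<Rightarrow> 'b) \<Rightarrow> bool"
where
  "inverse_system I r H f \<longleftrightarrow>
     I \<noteq> {} \<and> partial_order_on I r \<and>
     (\<forall>i\<in>I. \<forall>j\<in>I. \<exists>k\<in>I. (i, k) \<in> r \<and> (j, k) \<in> r) \<and>
     (\<forall>i\<in>I. group (H i)) \<and>
     (\<forall>i j. (i, j) \<in> r \<longrightarrow> f i j \<in> hom (H j) (H i)) \<and>
     (\<forall>i\<in>I. \<forall>x\<in>carrier (H i). f i i x = x) \<and>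
     (\<forall>i j k. (i, j) \<in> r \<and> (j, k) \<in> r \<longrightarrow>
        (\<forall>x\<in>carrier (H k). f i j (f j k x) = f i k x))"

definition inverse_limit_group ::
  "'i set \<Rightarrow> ('i \<times> 'i) set \<Rightarrow> ('i \<Rightarrow> ('b, 'm) monoid_scheme) \<Rightarrow> ('i \<Rightarrow> 'i \<Rightarrow> 'b \<Rightarrow> 'b)
     \<Rightarrow> ('i \<Rightarrow> 'b) monoid"
where
  "inverse_limit_group I r H f =
     (product_group I H)
       \<lparr>carrier := {x \<in> carrier (product_group I H). \<forall>i j. (i, j) \<in> r \<longrightarrow> f i j (x j) = x i}\<rparr>"

definition inverse_limit_topology ::
  "'i set \<Rightarrow> ('i \<times> 'i) set \<Rightarrow> ('i \<Rightarrow> ('b, 'm) monoid_scheme) \<Rightarrow> ('i \<Rightarrow> 'i \<Rightarrow> 'b \<Rightarrow> 'b)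
     \<Rightarrow> ('i \<Rightarrow> 'b) topology"
where
  "inverse_limit_topology I r H f =
     subtopology (product_topology (\<lambda>i. discrete_topology (carrier (H i))) I)
       (carrier (inverse_limit_group I r H f))"

text \<open>A group \<open>G\<close> with topology \<open>T\<close> is pro-\<open>C\<close> if it is topologically isomorphic
  to an inverse limit of finite (discrete) groups belonging to \<open>C\<close>.  HOL cannot quantify
  over types inside a definition, so the index set and the groups are taken in the type
  \<open>'a set\<close>.  For classes \<open>C\<close> closed under isomorphism and subgroups (such as all those used
  below) this is no restriction: if \<open>G\<close> is any such inverse limit, then it is also the inverse
  limit of the coset groups \<open>G Mod U\<close>, with \<open>U\<close> ranging over the kernels of the
  projections, ordered by reverse inclusion.\<close>

definition pro_class ::
  "('a set monoid \<Rightarrow> bool) \<Rightarrow> ('a, 'm) monoid_scheme \<Rightarrow> 'a topology \<Rightarrow> bool"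
where
  "pro_class C G T \<longleftrightarrow> group G \<and> topspace T = carrier G \<and>
     (\<exists>(I :: 'a set set) r (H :: 'a set \<Rightarrow> 'a set monoid) f h.
        inverse_system I r H f \<and>
        (\<forall>i\<in>I. finite (carrier (H i)) \<and> C (H i)) \<and>
        h \<in> iso G (inverse_limit_group I r H f) \<and>
        homeomorphic_map T (inverse_limit_topology I r H f) h)"

definition profinite :: "('a, 'm) monoid_scheme \<Rightarrow> 'a topology \<Rightarrow> bool" where
  "profinite = pro_class (\<lambda>_. True)"

definition pronilpotent :: "('a, 'm) monoid_scheme \<Rightarrow> 'a topology \<Rightarrow> bool" where
  "pronilpotent = pro_class nilpotent_group"

definition prosupersolvable :: "('a, 'm) monoid_scheme \<Rightarrow> 'a topology \<Rightarrow> bool" where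
  "prosupersolvable = pro_class supersolvable_group"

definition pro_p :: "nat \<Rightarrow> ('a, 'm) monoid_scheme \<Rightarrow> 'a topology \<Rightarrow> bool" where
  "pro_p p = pro_class (finite_p_group p)"


section \<open>Subgroups of profinite groups\<close>

definition pro_p_subgroup ::
  "nat \<Rightarrow> 'a set \<Rightarrow> ('a, 'm) monoid_scheme \<Rightarrow> 'a topology \<Rightarrow> bool"
where
  "pro_p_subgroup p P G T \<longleftrightarrow>
     subgroup P G \<and> closedin T P \<and> pro_p p (G\<lparr>carrier := P\<rparr>) (subtopology T P)"

definition sylow_pro_p_subgroup ::
  "nat \<Rightarrow> 'a set \<Rightarrow> ('a, 'm) monoid_scheme \<Rightarrow> 'a topology \<Rightarrow> bool"
where
  "sylow_pro_p_subgroup p P G T \<longleftrightarrow>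
     pro_p_subgroup p P G T \<and>
     (\<forall>Q. pro_p_subgroup p Q G T \<and> P \<subseteq> Q \<longrightarrow> Q = P)"

definition profinite_semidirect_product ::
  "('a, 'm) monoid_scheme \<Rightarrow> 'a topology \<Rightarrow> 'a set \<Rightarrow> 'a set \<Rightarrow> bool"
where
  "profinite_semidirect_product G T N J \<longleftrightarrow>
     profinite G T \<and>
     N \<lhd> G \<and> closedin T N \<and>
     subgroup J G \<and> closedin T J \<and>
     carrier G = N <#>\<^bsub>G\<^esub> J \<and> N \<inter> J = {\<one>\<^bsub>G\<^esub>}"

definition fixes_point :: "('a \<Rightarrow> 'b \<Rightarrow> 'b) \<Rightarrow> 'a set \<Rightarrow> 'b \<Rightarrow> bool" where
  "fixes_point \<phi> S \<omega> \<longleftrightarrow> (\<forall>g\<in>S. \<phi> g \<omega> = \<omega>)"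

end

theory Submission
  imports Defs "HOL-Algebra.Sylow" "HOL-Algebra.Multiplicative_Group" "HOL-Algebra.SndIsomorphismGrp"
begin

text \<open>
  Let \<open>H\<close> be the stabilizer of a point \<open>\<alpha>\<close> for which \<open>N \<inter> H\<close> is normal in \<open>N\<close>.  A subgroup fixes
  \<open>g \<alpha>\<close> exactly if it lies in the conjugate \<open>g H g\<^sup>-\<^sup>1\<close>, which is written \<open>coset_stabilizer G H g\<close>
  below.  So some conjugate of \<open>H\<close> has to contain \<open>J\<close>, given that for every prime \<open>p\<close> some conjugate
  contains a Sylow \<open>p\<close>-subgroup of \<open>J\<close>.

  \<^emph>\<open>Finite groups\<close> (\<open>finite_fixed_coset\<close>).  Assume \<open>G = N H\<close>, so that \<open>N \<inter> H\<close> is normal in \<open>G\<close>.  The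
  nilpotent group \<open>N\<close> is the product of its Sylow \<open>p\<close>-subgroup \<open>A\<close> and a normal \<open>p\<close>-complement \<open>B\<close>.
  If neither of them lies in \<open>H\<close>, then induction on the index of \<open>H\<close> puts \<open>J\<close> into conjugates of
  \<open>A H\<close> and of \<open>B H\<close>.  As \<open>A H \<inter> B H = H\<close> and \<open>A\<close> and \<open>B\<close> commute, the two conjugating elements can be
  combined.  This leaves the case that \<open>N \<inter> H\<close> has index a power of \<open>p\<close> in \<open>N\<close>
  (\<open>fixed_coset_prime_power_case\<close>).  Let \<open>J1\<close> be of maximal order among the subgroups \<open>J \<inter> g H g\<^sup>-\<^sup>1\<close>
  that contain a given Sylow \<open>p\<close>-subgroup of \<open>J\<close>, and let \<open>J2\<close> be the normalizer of \<open>J1\<close> in \<open>J\<close>.  By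
  maximality \<open>J2 / J1\<close> acts freely on the set of cosets of \<open>H\<close> that \<open>J1\<close> fixes.  The elements of \<open>N\<close>
  that centralize \<open>J1\<close> modulo \<open>N \<inter> H\<close> permute this set transitively, so its size is a power of
  \<open>p\<close>.  But \<open>|J2 : J1|\<close> is prime to \<open>p\<close>; hence \<open>J2 = J1\<close>, and what remains is that a proper subgroup
  \<open>J1\<close> of this kind is not self-normalizing in \<open>J\<close>.  If \<open>J\<close> is nilpotent, normalizers grow.  If \<open>G\<close> is
  supersolvable, commutators act trivially on the cyclic factors of a normal series, because
  cyclic groups have abelian automorphism groups.  Therefore the commutators lie in a normal subgroup
  all of whose elements act on the cosets of \<open>H\<close> with order a power of \<open>p\<close>; its intersection with \<open>J\<close>
  lies in \<open>J1\<close>, whose index in \<open>J\<close> is prime to \<open>p\<close>, and so \<open>J1\<close> is normal in \<open>J\<close>.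

  \<^emph>\<open>Profinite groups\<close> (\<open>fixed_coset\<close>).  The image of a Sylow \<open>p\<close>-subgroup of \<open>J\<close> in a finite quotient
  has index prime to \<open>p\<close> in the image of \<open>J\<close> (\<open>sylow_image_index\<close>).  Since \<open>G = N J\<close> and conjugates of
  these subgroups lie in \<open>N H\<close>, the index of \<open>N H\<close> in every finite quotient is prime to every \<open>p\<close>;
  thus \<open>G = N H\<close>.  The finite theorem does not apply to the images of \<open>H\<close> themselves, because the
  images of \<open>N\<close> and \<open>H\<close> may meet in more than the image of \<open>N \<inter> H\<close>.  Instead let \<open>V\<close> be the intersection of
  \<open>N\<close> with the kernel of a finite quotient.  Then \<open>V H\<close> has finite index and contains the
  kernel of some finite quotient of \<open>G\<close>, in which the intersection causes no trouble because \<open>N \<inter> V H = V (N \<inter> H)\<close>.  So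
  \<open>J\<close> lies in a conjugate of \<open>V H\<close>.  The sets of conjugating elements are closed and directed as \<open>V\<close>
  shrinks, and by compactness one element serves for all \<open>V\<close>, hence for \<open>H\<close>.
\<close>

section \<open>Double cosets and powers\<close>

lemma card_eq_fibre_times_image:
  assumes "finite X" and "\<And>z. z \<in> f ` X \<Longrightarrow> card {x \<in> X. f x = z} = k"
  shows "card X = k * card (f ` X)"
proof -
  have "card X = (\<Sum>z\<in>f ` X. card {x \<in> X. f x = z})"
    using sum.group[of X "f ` X" f "\<lambda>_. 1::nat"] assms(1) by simp
  also have "\<dots> = k * card (f ` X)" using assms(2) by simp
  finally show ?thesis .
qed

text \<open>The conjugate \<open>g H g\<^sup>-\<^sup>1\<close>: the stabilizer of the left coset \<open>g H\<close>. It is defined through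
  membership so that \<open>P \<subseteq> coset_stabilizer G H g\<close> says that \<open>P\<close> fixes \<open>g H\<close>.\<close>

definition coset_stabilizer :: "('a, 'm) monoid_scheme \<Rightarrow> 'a set \<Rightarrow> 'a \<Rightarrow> 'a set" where
  "coset_stabilizer G H g = {x \<in> carrier G. inv\<^bsub>G\<^esub> g \<otimes>\<^bsub>G\<^esub> x \<otimes>\<^bsub>G\<^esub> g \<in> H}"

context group
begin

lemma inv_cancel_left:
  "\<lbrakk>x \<in> carrier G; y \<in> carrier G\<rbrakk> \<Longrightarrow> inv x \<otimes> (x \<otimes> y) = y"
  "\<lbrakk>x \<in> carrier G; y \<in> carrier G\<rbrakk> \<Longrightarrow> x \<otimes> (inv x \<otimes> y) = y"
  by (simp_all flip: m_assoc)

text \<open>Together these rules rewrite a word in a free group to its reduced form, which decides every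
  identity that holds in all groups.\<close>

lemmas group_word = m_assoc inv_mult_group inv_cancel_left

lemma coset_stabilizer_mult_right:
  assumes "subgroup H G" "g \<in> carrier G" "h \<in> H"
  shows "coset_stabilizer G H (g \<otimes> h) = coset_stabilizer G H g"
proof -
  have h: "h \<in> carrier G" using assms subgroup.mem_carrier by metis
  { fix x assume x: "x \<in> carrier G"
    have e: "inv (g \<otimes> h) \<otimes> x \<otimes> (g \<otimes> h) = inv h \<otimes> (inv g \<otimes> x \<otimes> g) \<otimes> h"
      using assms h x by (simp add: group_word)
    have "inv g \<otimes> x \<otimes> g = h \<otimes> (inv (g \<otimes> h) \<otimes> x \<otimes> (g \<otimes> h)) \<otimes> inv h"
      using assms h x by (simp add: group_word)
    then have "inv (g \<otimes> h) \<otimes> x \<otimes> (g \<otimes> h) \<in> H \<longleftrightarrow> inv g \<otimes> x \<otimes> g \<in> H"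
      using e assms by (metis subgroup.m_closed subgroup.m_inv_closed)
  }
  then show ?thesis unfolding coset_stabilizer_def by auto
qed

lemma subgroup_coset_stabilizer:
  assumes "subgroup H G" "g \<in> carrier G"
  shows "subgroup (coset_stabilizer G H g) G"
proof (rule subgroupI)
  interpret H: subgroup H G by fact
  show "coset_stabilizer G H g \<subseteq> carrier G" by (auto simp: coset_stabilizer_def)
  have "\<one> \<in> coset_stabilizer G H g" using assms by (simp add: coset_stabilizer_def)
  then show "coset_stabilizer G H g \<noteq> {}" by blast
  show "inv a \<in> coset_stabilizer G H g" if "a \<in> coset_stabilizer G H g" for a
  proof -
    have a: "a \<in> carrier G" "inv g \<otimes> a \<otimes> g \<in> H" using that by (auto simp: coset_stabilizer_def)
    have "inv g \<otimes> inv a \<otimes> g = inv (inv g \<otimes> a \<otimes> g)" using assms a by (simp add: group_word)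
    then show ?thesis using a by (simp add: coset_stabilizer_def)
  qed
  show "a \<otimes> b \<in> coset_stabilizer G H g"
    if "a \<in> coset_stabilizer G H g" "b \<in> coset_stabilizer G H g" for a b
  proof -
    have a: "a \<in> carrier G" "inv g \<otimes> a \<otimes> g \<in> H" and b: "b \<in> carrier G" "inv g \<otimes> b \<otimes> g \<in> H"
      using that by (auto simp: coset_stabilizer_def)
    have "inv g \<otimes> (a \<otimes> b) \<otimes> g = (inv g \<otimes> a \<otimes> g) \<otimes> (inv g \<otimes> b \<otimes> g)"
      using assms a b by (simp add: group_word)
    then show ?thesis using a b by (simp add: coset_stabilizer_def)
  qed
qed

lemma card_subgroup_dvd:
  assumes "subgroup H G" "subgroup K G" "H \<subseteq> K" "finite K"
  shows "card H dvd card K"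
proof -
  have "subgroup H (G\<lparr>carrier := K\<rparr>)" using assms by (simp add: subgroup_incl)
  then show ?thesis
    using group.lagrange[OF subgroup.subgroup_is_group[OF assms(2) is_group], of H]
      by (simp add: order_def) (metis dvd_triv_right)
qed

text \<open>The fibres of \<open>(a, h) \<mapsto> a y h\<close> are in bijection with \<open>A \<inter> y H y\<^sup>-\<^sup>1\<close>: two pairs with the
  same value differ by an element \<open>s\<close> of it, acting as \<open>(a s, y\<^sup>-\<^sup>1 s\<^sup>-\<^sup>1 y h)\<close>.\<close>

lemma card_double_coset:
  assumes A: "subgroup A G" "finite A" and H: "subgroup H G" "finite H" and y: "y \<in> carrier G"
  shows "card {a \<otimes> y \<otimes> h |a h. a \<in> A \<and> h \<in> H} * card (A \<inter> coset_stabilizer G H y)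
           = card A * card H"
proof -
  note Am = subgroup.m_closed[OF A(1)] subgroup.m_inv_closed[OF A(1)]
  note Hm = subgroup.m_closed[OF H(1)] subgroup.m_inv_closed[OF H(1)]
  note car = subgroup.mem_carrier[OF A(1)] subgroup.mem_carrier[OF H(1)]
  let ?f = "\<lambda>(a, h). a \<otimes> y \<otimes> h"
  have "card (A \<times> H) = card (A \<inter> coset_stabilizer G H y) * card (?f ` (A \<times> H))"
  proof (rule card_eq_fibre_times_image)
    show "finite (A \<times> H)" using assms by blast
    fix z assume "z \<in> ?f ` (A \<times> H)"
    then obtain a0 h0 where z: "z = a0 \<otimes> y \<otimes> h0" "a0 \<in> A" "h0 \<in> H" by auto
    note zG = car(1)[OF z(2)] car(2)[OF z(3)]
    let ?g = "\<lambda>s. (a0 \<otimes> s, inv y \<otimes> inv s \<otimes> y \<otimes> h0)"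
    have pt: "inv a0 \<otimes> a \<in> A \<inter> coset_stabilizer G H y"
      "h = inv y \<otimes> inv (inv a0 \<otimes> a) \<otimes> y \<otimes> h0" "a0 \<otimes> (inv a0 \<otimes> a) = a"
      if ah: "a \<in> A" "h \<in> H" "a \<otimes> y \<otimes> h = a0 \<otimes> y \<otimes> h0" for a h
    proof -
      note ahG = car(1)[OF ah(1)] car(2)[OF ah(2)]
      have "inv y \<otimes> (inv a0 \<otimes> a) \<otimes> y = inv y \<otimes> (inv a0 \<otimes> (a \<otimes> y \<otimes> h) \<otimes> inv h)"
        using ahG y zG by (simp add: group_word)
      also have "\<dots> = h0 \<otimes> inv h" unfolding ah(3) using ahG y zG by (simp add: group_word)
      finally show "inv a0 \<otimes> a \<in> A \<inter> coset_stabilizer G H y"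
        using ah(1,2) z(2,3) ahG zG Am Hm by (simp add: coset_stabilizer_def)
      have "h = inv y \<otimes> (inv a \<otimes> (a \<otimes> y \<otimes> h))" using ahG y by (simp add: group_word)
      also have "\<dots> = inv y \<otimes> inv (inv a0 \<otimes> a) \<otimes> y \<otimes> h0"
        unfolding ah(3) using ahG y zG by (simp add: group_word)
      finally show "h = inv y \<otimes> inv (inv a0 \<otimes> a) \<otimes> y \<otimes> h0" .
      show "a0 \<otimes> (inv a0 \<otimes> a) = a" using ahG zG by (simp add: group_word)
    qed
    have "bij_betw ?g (A \<inter> coset_stabilizer G H y) {x \<in> A \<times> H. ?f x = z}"
    proof (rule bij_betw_byWitness[where f' = "\<lambda>(a, h). inv a0 \<otimes> a"])
      show "\<forall>s\<in>A \<inter> coset_stabilizer G H y. (case ?g s of (a, h) \<Rightarrow> inv a0 \<otimes> a) = s"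
        using zG by (auto simp: coset_stabilizer_def group_word)
      show "\<forall>x\<in>{x \<in> A \<times> H. ?f x = z}. ?g (case x of (c, k) \<Rightarrow> inv a0 \<otimes> c) = x"
      proof
        fix x assume "x \<in> {x \<in> A \<times> H. ?f x = z}"
        then obtain a h where x: "x = (a, h)" and ah: "a \<in> A" "h \<in> H" "a \<otimes> y \<otimes> h = a0 \<otimes> y \<otimes> h0"
          unfolding z(1) by auto
        show "?g (case x of (c, k) \<Rightarrow> inv a0 \<otimes> c) = x"
          unfolding x prod.case by (simp only: pt(3)[OF ah] pt(2)[OF ah, symmetric])
      qed
      show "?g ` (A \<inter> coset_stabilizer G H y) \<subseteq> {x \<in> A \<times> H. ?f x = z}"
      proof
        fix x assume "x \<in> ?g ` (A \<inter> coset_stabilizer G H y)"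
        then obtain s where s: "s \<in> A" "s \<in> carrier G" "inv y \<otimes> s \<otimes> y \<in> H" and x: "x = ?g s"
          by (auto simp: coset_stabilizer_def)
        have "inv y \<otimes> inv s \<otimes> y = inv (inv y \<otimes> s \<otimes> y)" using s y by (simp add: group_word)
        then have "inv y \<otimes> inv s \<otimes> y \<in> H" using s Hm by simp
        moreover have "a0 \<otimes> s \<otimes> y \<otimes> (inv y \<otimes> inv s \<otimes> y \<otimes> h0) = a0 \<otimes> y \<otimes> h0"
          using s(2) zG y by (simp add: group_word)
        ultimately show "x \<in> {x \<in> A \<times> H. ?f x = z}"
          unfolding x z(1) using s(1) z(2,3) Am Hm by simp
      qed
      show "(\<lambda>(a, h). inv a0 \<otimes> a) ` {x \<in> A \<times> H. ?f x = z} \<subseteq> A \<inter> coset_stabilizer G H y"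
        unfolding z(1) using pt(1) by auto
    qed
    then show "card {x \<in> A \<times> H. ?f x = z} = card (A \<inter> coset_stabilizer G H y)"
      by (simp add: bij_betw_same_card)
  qed
  moreover have "?f ` (A \<times> H) = {a \<otimes> y \<otimes> h |a h. a \<in> A \<and> h \<in> H}" by auto
  ultimately show ?thesis by (simp add: card_cartesian_product)
qed

text \<open>\<open>Y\<close> is a disjoint union of double cosets \<open>A y H\<close>, and the hypothesis on \<open>d\<close> makes the size
  of each of them divisible by \<open>d |H|\<close>. With \<open>d = p\<close> this is the fixed point theorem for
  \<open>p\<close>-groups; with \<open>d = |A : S|\<close> it counts the orbits of a group \<open>A\<close> that acts on cosets with all
  stabilizers equal to \<open>S\<close>.\<close>

lemma double_coset_dvd:
  assumes A: "subgroup A G" and H: "subgroup H G" and fin: "finite (carrier G)"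
  shows "\<lbrakk>Y \<subseteq> carrier G; \<And>a y h. \<lbrakk>a \<in> A; y \<in> Y; h \<in> H\<rbrakk> \<Longrightarrow> a \<otimes> y \<otimes> h \<in> Y;
      \<And>y. y \<in> Y \<Longrightarrow> d * card (A \<inter> coset_stabilizer G H y) dvd card A\<rbrakk> \<Longrightarrow> d * card H dvd card Y"
proof (induction "card Y" arbitrary: Y rule: less_induct)
  case less
  interpret A: subgroup A G by fact
  interpret H: subgroup H G by fact
  have fA: "finite A" "finite H" "finite Y" using fin A.subset H.subset less.prems(1) finite_subset by blast+
  show ?case
  proof (cases "Y = {}")
    case False
    then obtain y where y: "y \<in> Y" by blast
    then have yG: "y \<in> carrier G" using less.prems by blast
    define D where "D = {a \<otimes> y \<otimes> h |a h. a \<in> A \<and> h \<in> H}"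
    have DY: "D \<subseteq> Y" unfolding D_def using less.prems(2) y by blast
    have "y = \<one> \<otimes> y \<otimes> \<one>" using yG by simp
    then have yD: "y \<in> D" unfolding D_def using A.one_closed H.one_closed by blast
    have cD: "card D * card (A \<inter> coset_stabilizer G H y) = card A * card H"
      unfolding D_def by (rule card_double_coset) (use A H fA yG in auto)
    have pos: "card (A \<inter> coset_stabilizer G H y) > 0"
    proof -
      have "\<one> \<in> A \<inter> coset_stabilizer G H y" using yG by (simp add: coset_stabilizer_def)
      then show ?thesis using fA(1) by (metis card_gt_0_iff empty_iff finite_Int)
    qed
    have "d * card (A \<inter> coset_stabilizer G H y) * card H dvd card A * card H"
      using less.prems(3)[OF y] by (rule mult_dvd_mono) simp
    then have "(d * card H) * card (A \<inter> coset_stabilizer G H y) dvd card D * card (A \<inter> coset_stabilizer G H y)"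
      using cD by (simp add: algebra_simps)
    then have dD: "d * card H dvd card D" using pos by simp
    have "d * card H dvd card (Y - D)"
    proof (rule less.hyps)
      show "card (Y - D) < card Y" using y yD fA(3) by (intro psubset_card_mono) auto
      show "Y - D \<subseteq> carrier G" using less.prems by blast
      show "a \<otimes> z \<otimes> h \<in> Y - D" if "a \<in> A" "z \<in> Y - D" "h \<in> H" for a z h
      proof -
        have z: "z \<in> carrier G" using that less.prems by blast
        have "z \<in> D" if "a \<otimes> z \<otimes> h \<in> D"
        proof -
          have "\<exists>a' h'. a \<otimes> z \<otimes> h = a' \<otimes> y \<otimes> h' \<and> a' \<in> A \<and> h' \<in> H"
            using that unfolding D_def by simp
          then obtain a' h' where a': "a' \<in> A" "h' \<in> H" "a \<otimes> z \<otimes> h = a' \<otimes> y \<otimes> h'"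
            by blast
          have "z = inv a \<otimes> (a \<otimes> z \<otimes> h) \<otimes> inv h"
            using z \<open>a \<in> A\<close> \<open>h \<in> H\<close> by (simp add: group_word)
          also have "\<dots> = (inv a \<otimes> a') \<otimes> y \<otimes> (h' \<otimes> inv h)"
            unfolding a'(3) using a'(1,2) yG \<open>a \<in> A\<close> \<open>h \<in> H\<close> by (simp add: group_word)
          finally show ?thesis unfolding D_def using a' \<open>a \<in> A\<close> \<open>h \<in> H\<close>
            by blast
        qed
        then show ?thesis using that less.prems(2) by blast
      qed
      show "d * card (A \<inter> coset_stabilizer G H z) dvd card A" if "z \<in> Y - D" for z
        using less.prems(3) that by blast
    qed
    moreover have "card Y = card D + card (Y - D)"
      using DY fA(3) by (metis card_Diff_subset card_mono finite_subset le_add_diff_inverse)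
    ultimately show ?thesis using dD by simp
  qed simp
qed

lemma card_set_mult:
  assumes "subgroup A G" "finite A" "subgroup H G" "finite H"
  shows "card (A <#> H) * card (A \<inter> H) = card A * card H"
proof -
  have "A \<inter> coset_stabilizer G H \<one> = A \<inter> H"
    using subgroup.subset[OF assms(1)] by (auto simp: coset_stabilizer_def)
  moreover have "{a \<otimes> \<one> \<otimes> h |a h. a \<in> A \<and> h \<in> H} = A <#> H"
    using subgroup.mem_carrier[OF assms(1)] by (force simp: set_mult_def)
  ultimately show ?thesis using card_double_coset[OF assms one_closed] by simp
qed

lemma pow_index_mem:
  assumes N: "subgroup N G" "finite N" and K: "K \<lhd> G\<lparr>carrier := N\<rparr>" and x: "x \<in> N"
  shows "x [^] (card N div card K) \<in> K"
proof -
  interpret N: subgroup N G by fact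
  interpret NG: group "G\<lparr>carrier := N\<rparr>" using N.subgroup_is_group is_group by blast
  interpret K: normal K "G\<lparr>carrier := N\<rparr>" by fact
  interpret Q: group "G\<lparr>carrier := N\<rparr> Mod K" by (rule K.factorgroup_is_group)
  let ?Q = "G\<lparr>carrier := N\<rparr> Mod K"
  have Kx: "K #>\<^bsub>G\<lparr>carrier := N\<rparr>\<^esub> x \<in> carrier ?Q" using x by (auto simp: FactGroup_def RCOSETS_def)
  have KN: "K \<subseteq> N" using K.subset by simp
  have ord: "order ?Q = card N div card K"
  proof -
    have "card (rcosets\<^bsub>G\<lparr>carrier := N\<rparr>\<^esub> K) * card K = card N"
      using NG.lagrange[OF K.subgroup_axioms] by (simp add: order_def)
    moreover have "card K > 0" using K.one_closed KN N(2) by (metis card_gt_0_iff empty_iff finite_subset)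
    ultimately show ?thesis by (metis FactGroup_def div_mult_self_is_m order_def partial_object.select_convs(1))
  qed
  have "(K #>\<^bsub>G\<lparr>carrier := N\<rparr>\<^esub> x) [^]\<^bsub>?Q\<^esub> order ?Q = \<one>\<^bsub>?Q\<^esub>"
    using Kx by (rule Q.pow_order_eq_1)
  then have "K #>\<^bsub>G\<lparr>carrier := N\<rparr>\<^esub> (x [^]\<^bsub>G\<lparr>carrier := N\<rparr>\<^esub> order ?Q) = K"
    using K.FactGroup_pow[of x "order ?Q"] x by simp
  then have "x [^]\<^bsub>G\<lparr>carrier := N\<rparr>\<^esub> order ?Q \<in> K"
    using NG.coset_join1[of K "x [^]\<^bsub>G\<lparr>carrier := N\<rparr>\<^esub> order ?Q"] K.subgroup_axioms K.subset x NG.nat_pow_closed by fastforce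
  then show ?thesis using ord nat_pow_consistent[of x _ N] by simp
qed

text \<open>A Bezout identity writes \<open>x\<close> as a product of powers of \<open>x\<^sup>m\<close> and \<open>x\<^sup>n\<close>.\<close>

lemma pow_mem_coprime:
  assumes H: "subgroup H G" and x: "x \<in> carrier G" and m: "x [^] (m::nat) \<in> H" "x [^] (n::nat) \<in> H"
    and c: "coprime m n"
  shows "x \<in> H"
proof (cases "m = 0")
  case True
  then show ?thesis using c m x by (simp add: coprime_0_left_iff)
next
  case False
  interpret H: subgroup H G by fact
  obtain a b where ab: "m * a = n * b + 1" using bezout_nat[OF False, of n] c by (auto simp: coprime_iff_gcd_eq_1)
  have 1: "(x [^] m) [^] a \<in> H" "(x [^] n) [^] b \<in> H"
    using m subgroup_int_pow_closed[OF H] by (metis int_pow_int)+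
  have "(x [^] m) [^] a = (x [^] n) [^] b \<otimes> x"
    using x ab by (simp add: nat_pow_pow nat_pow_mult[symmetric])
  then have "x = inv ((x [^] n) [^] b) \<otimes> ((x [^] m) [^] a)"
    using x 1 by (simp add: inv_cancel_left)
  then show ?thesis using 1 H.m_inv_closed H.m_closed by metis
qed

lemma pow_card_subgroup:
  assumes "subgroup H G" "finite H" "x \<in> H"
  shows "x [^] card H = \<one>"
proof -
  interpret H: group "G\<lparr>carrier := H\<rparr>" using assms(1) subgroup.subgroup_is_group is_group by blast
  have "x [^]\<^bsub>G\<lparr>carrier := H\<rparr>\<^esub> order (G\<lparr>carrier := H\<rparr>) = \<one>\<^bsub>G\<lparr>carrier := H\<rparr>\<^esub>"
    by (rule H.pow_order_eq_1) (use assms in auto)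
  then show ?thesis using nat_pow_consistent[of x _ H] by (simp add: order_def)
qed

end

section \<open>Series with centralized factors and finite nilpotent groups\<close>

text \<open>With \<open>C = carrier G\<close> this is nilpotency; with \<open>C\<close> the set of commutators it is what the
  argument uses of supersolvability. Treating both at once means that passing to finite quotients
  has to be checked only once.\<close>

definition centralizes_series :: "('a, 'm) monoid_scheme \<Rightarrow> 'a set \<Rightarrow> bool" where
  "centralizes_series G C \<longleftrightarrow>
     (\<exists>(n::nat) K. K 0 = {\<one>\<^bsub>G\<^esub>} \<and> K n = carrier G \<and> (\<forall>i\<le>n. K i \<lhd> G) \<and>
        (\<forall>i<n. K i \<subseteq> K (Suc i) \<and>
          (\<forall>u\<in>K (Suc i). \<forall>c\<in>C. c \<otimes>\<^bsub>G\<^esub> u \<otimes>\<^bsub>G\<^esub> inv\<^bsub>G\<^esub> c \<otimes>\<^bsub>G\<^esub> inv\<^bsub>G\<^esub> u \<in> K i)))"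

lemma centralizes_seriesE:
  assumes "centralizes_series G C"
  obtains n K where "K 0 = {\<one>\<^bsub>G\<^esub>}" "K n = carrier G" "\<And>i. i \<le> n \<Longrightarrow> K i \<lhd> G"
    "\<And>i. i < n \<Longrightarrow> K i \<subseteq> K (Suc i)"
    "\<And>i u c. \<lbrakk>i < n; u \<in> K (Suc i); c \<in> C\<rbrakk>
       \<Longrightarrow> c \<otimes>\<^bsub>G\<^esub> u \<otimes>\<^bsub>G\<^esub> inv\<^bsub>G\<^esub> c \<otimes>\<^bsub>G\<^esub> inv\<^bsub>G\<^esub> u \<in> K i"
  using assms unfolding centralizes_series_def
proof (elim exE conjE)
  fix n :: nat and K
  assume K: "K 0 = {\<one>\<^bsub>G\<^esub>}" "K n = carrier G" "\<forall>i\<le>n. K i \<lhd> G"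
    "\<forall>i<n. K i \<subseteq> K (Suc i) \<and>
      (\<forall>u\<in>K (Suc i). \<forall>c\<in>C. c \<otimes>\<^bsub>G\<^esub> u \<otimes>\<^bsub>G\<^esub> inv\<^bsub>G\<^esub> c \<otimes>\<^bsub>G\<^esub> inv\<^bsub>G\<^esub> u \<in> K i)"
  show thesis by (rule that[of K n]) (use K in simp_all)
qed

context group
begin

lemma normal_conj:
  assumes "N \<lhd> G" "g \<in> carrier G" "x \<in> N"
  shows "g \<otimes> x \<otimes> inv g \<in> N" and "inv g \<otimes> x \<otimes> g \<in> N"
  using assms normal.inv_op_closed1 normal.inv_op_closed2 by metis+

lemma subgroup_normalizer:
  assumes A: "subgroup A G" and S: "subgroup S G" "finite S"
  shows "subgroup {x \<in> A. \<forall>s\<in>S. x \<otimes> s \<otimes> inv x \<in> S} G"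
proof (rule subgroupI)
  note [dest] = subgroup.mem_carrier[OF A] subgroup.mem_carrier[OF S(1)]
  note Am = subgroup.m_closed[OF A] subgroup.m_inv_closed[OF A] subgroup.one_closed[OF A]
  let ?M = "{x \<in> A. \<forall>s\<in>S. x \<otimes> s \<otimes> inv x \<in> S}"
  show "?M \<subseteq> carrier G" by auto
  have "\<one> \<in> ?M" using Am(3) subgroup.mem_carrier[OF S(1)] by simp
  then show "?M \<noteq> {}" by blast
  show "inv x \<in> ?M" if "x \<in> ?M" for x
  proof -
    let ?c = "\<lambda>s. x \<otimes> s \<otimes> inv x"
    have xG: "x \<in> carrier G" using that by auto
    then have "inj_on ?c S" using subgroup.mem_carrier[OF S(1)] by (simp add: inj_on_def)
    then have "?c ` S = S" using that S(2) by (intro endo_inj_surj) auto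
    then have "\<exists>t\<in>S. s = ?c t" if "s \<in> S" for s using that by blast
    moreover have "inv x \<otimes> (x \<otimes> t \<otimes> inv x) \<otimes> inv (inv x) = t" if "t \<in> carrier G" for t
      using that xG by (simp add: group_word)
    ultimately have "inv x \<otimes> s \<otimes> inv (inv x) \<in> S" if "s \<in> S" for s
      using that subgroup.mem_carrier[OF S(1)] by metis
    then show ?thesis using that Am(2) by blast
  qed
  show "x \<otimes> y \<in> ?M" if "x \<in> ?M" "y \<in> ?M" for x y
  proof -
    have "x \<otimes> y \<otimes> s \<otimes> inv (x \<otimes> y) \<in> S" if "s \<in> S" for s
    proof -
      have "x \<in> carrier G" "y \<in> carrier G" "s \<in> carrier G"
        using that \<open>x \<in> ?M\<close> \<open>y \<in> ?M\<close> by auto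
      then have "x \<otimes> y \<otimes> s \<otimes> inv (x \<otimes> y) = x \<otimes> (y \<otimes> s \<otimes> inv y) \<otimes> inv x"
        by (simp add: group_word)
      then show ?thesis using that \<open>x \<in> ?M\<close> \<open>y \<in> ?M\<close> by simp
    qed
    then show ?thesis using that Am(1) by simp
  qed
qed

text \<open>Take the first term of the series that is not contained in \<open>S\<close>. Its elements normalize \<open>S\<close>,
  since their commutators with \<open>S\<close> lie in the preceding term, hence in \<open>S\<close>.\<close>

lemma normalizers_grow:
  assumes "centralizes_series G (carrier G)" and S: "subgroup S G" "S \<noteq> carrier G"
  shows "\<exists>x \<in> carrier G - S. \<forall>s\<in>S. x \<otimes> s \<otimes> inv x \<in> S"
proof -
  from assms(1) obtain n K where K: "K 0 = {\<one>}" "K n = carrier G" "\<And>i. i \<le> n \<Longrightarrow> K i \<lhd> G"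
    and mono: "\<And>i. i < n \<Longrightarrow> K i \<subseteq> K (Suc i)"
    and c: "\<And>i u c. \<lbrakk>i < n; u \<in> K (Suc i); c \<in> carrier G\<rbrakk> \<Longrightarrow> c \<otimes> u \<otimes> inv c \<otimes> inv u \<in> K i"
    by (rule centralizes_seriesE) blast
  have ex: "\<not> K n \<subseteq> S" using S K(2) subgroup.subset[OF S(1)] by blast
  define i where "i = (LEAST i. \<not> K i \<subseteq> S)"
  have i: "\<not> K i \<subseteq> S" "i \<le> n" unfolding i_def using LeastI[of "\<lambda>i. \<not> K i \<subseteq> S", OF ex] Least_le[of "\<lambda>i. \<not> K i \<subseteq> S", OF ex]
    by auto
  then obtain j where j: "i = Suc j" using K(1) subgroup.one_closed[OF S(1)] by (cases i) auto
  have jS: "K j \<subseteq> S" using not_less_Least[of j "\<lambda>i. \<not> K i \<subseteq> S"] j i_def by auto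
  obtain x where x: "x \<in> K (Suc j)" "x \<notin> S" using i j by blast
  have xG: "x \<in> carrier G" using x K(3)[OF i(2)] j by (metis normal_imp_subgroup subgroup.mem_carrier)
  have "x \<otimes> s \<otimes> inv x \<in> S" if s: "s \<in> S" for s
  proof -
    have sG: "s \<in> carrier G" using s subgroup.mem_carrier[OF S(1)] by blast
    have "s \<otimes> x \<otimes> inv s \<otimes> inv x \<in> S" using c[OF _ x(1) sG] jS i j by auto
    then have "inv (s \<otimes> x \<otimes> inv s \<otimes> inv x) \<otimes> s \<in> S"
      using s subgroup.m_inv_closed[OF S(1)] subgroup.m_closed[OF S(1)] by blast
    moreover have "inv (s \<otimes> x \<otimes> inv s \<otimes> inv x) \<otimes> s = x \<otimes> s \<otimes> inv x"
      using sG xG by (simp add: group_word)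
    ultimately show ?thesis by simp
  qed
  then show ?thesis using x xG by blast
qed

text \<open>An element with \<open>x\<^bsup>|B|\<^esup> = 1\<close> lies in \<open>B\<close> because its power with the coprime exponent
  \<open>|G : B|\<close> does. Since such a subgroup is described by exponents, it is invariant under every
  automorphism; in particular it stays normal in any larger group in which \<open>G\<close> is normal.\<close>

lemma hall_normal_eq:
  assumes fin: "finite (carrier G)" and B: "B \<lhd> G" and c: "coprime (card B) (order G div card B)"
  shows "B = {x \<in> carrier G. x [^] card B = \<one>}"
proof -
  interpret B: normal B G by fact
  have "x \<in> B" if "x \<in> carrier G" "x [^] card B = \<one>" for x
  proof (rule pow_mem_coprime[OF B.subgroup_axioms that(1) _ _ c])
    show "x [^] card B \<in> B" using that by simp
    show "x [^] (order G div card B) \<in> B"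
      using pow_index_mem[of "carrier G" B x] fin B that subgroup_self by (simp add: order_def)
  qed
  moreover have "x [^] card B = \<one>" if "x \<in> B" for x
    using pow_card_subgroup[OF B.subgroup_axioms _ that] fin B.subset finite_subset by blast
  ultimately show ?thesis using B.subset by blast
qed

text \<open>If the normalizer \<open>M\<close> of \<open>S\<close> were proper, some \<open>g\<close> outside \<open>M\<close> would normalize \<open>M\<close>. But \<open>S\<close>
  consists of all elements of \<open>M\<close> with order dividing \<open>|S|\<close>, so \<open>g\<close> would normalize \<open>S\<close> as well.\<close>

lemma nilpotent_sylow_normal:
  assumes fin: "finite (carrier G)" and nil: "centralizes_series G (carrier G)"
    and S: "subgroup S G" and c: "coprime (card S) (order G div card S)"
  shows "S \<lhd> G"
proof -
  define M where "M = {x \<in> carrier G. \<forall>s\<in>S. x \<otimes> s \<otimes> inv x \<in> S}"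
  have fS: "finite S" using fin subgroup.subset[OF S] finite_subset by blast
  have M: "subgroup M G" unfolding M_def by (rule subgroup_normalizer[OF subgroup_self S fS])
  have fM: "finite M" using fin subgroup.subset[OF M] finite_subset by blast
  have SM: "S \<subseteq> M" unfolding M_def
    using subgroup.subset[OF S] subgroup.m_closed[OF S] subgroup.m_inv_closed[OF S] by auto
  have nSM: "S \<lhd> G\<lparr>carrier := M\<rparr>"
  proof -
    interpret MG: group "G\<lparr>carrier := M\<rparr>" by (rule subgroup.subgroup_is_group[OF M]) (rule is_group)
    show ?thesis unfolding MG.normal_inv_iff
      using subgroup_incl[OF S M SM] m_inv_consistent[OF M] by (auto simp: M_def)
  qed
  have "M = carrier G"
  proof (rule ccontr)
    assume "M \<noteq> carrier G"
    then obtain g where g: "g \<in> carrier G" "g \<notin> M" "\<And>s. s \<in> M \<Longrightarrow> g \<otimes> s \<otimes> inv g \<in> M"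
      using normalizers_grow[OF nil M] by blast
    have "g \<otimes> s \<otimes> inv g \<in> S" if s: "s \<in> S" for s
    proof (rule pow_mem_coprime[OF S])
      have t: "g \<otimes> s \<otimes> inv g \<in> M" using g s SM by blast
      show "(g \<otimes> s \<otimes> inv g) [^] (card M div card S) \<in> S"
        by (rule pow_index_mem[OF M fM nSM t])
      have sG: "s \<in> carrier G" using s subgroup.mem_carrier[OF S] by blast
      have "(g \<otimes> s \<otimes> inv g) [^] (k::nat) = g \<otimes> (s [^] k) \<otimes> inv g" for k
        by (induction k) (use g(1) sG in \<open>simp_all add: group_word\<close>)
      then show "(g \<otimes> s \<otimes> inv g) [^] card S \<in> S"
        using pow_card_subgroup[OF S fS s] g(1) subgroup.one_closed[OF S] by simp
      have "card S dvd card M" "card M dvd order G" 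
        using card_subgroup_dvd[OF S M SM fM] card_subgroup_dvd[OF M subgroup_self subgroup.subset[OF M] fin]
        by (auto simp: order_def)
      then have "card M div card S dvd order G div card S" by (meson div_dvd_div dvd_trans)
      then show "coprime (card M div card S) (card S)"
        using c by (metis coprime_commute coprime_divisors dvd_refl)
      show "g \<otimes> s \<otimes> inv g \<in> carrier G" using t subgroup.mem_carrier[OF M] by blast
    qed
    then show False using g M_def by blast
  qed
  then show ?thesis using nSM by simp
qed

lemma subgroup_normal_mult:
  assumes "N \<lhd> G" "subgroup H G"
  shows "subgroup (N <#> H) G"
  using second_isomorphism_grp.normal_set_mult_subgroup[of N G H] assms
  by (simp add: second_isomorphism_grp_def second_isomorphism_grp_axioms_def)

lemma normal_mult_normal:
  assumes "N \<lhd> G" "M \<lhd> G"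
  shows "N <#> M \<lhd> G"
proof -
  have "x \<otimes> h \<otimes> inv x \<in> N <#> M" if x: "x \<in> carrier G" and h: "h \<in> N <#> M" for x h
  proof -
    obtain a b where ab: "a \<in> N" "b \<in> M" "h = a \<otimes> b" using h by (auto simp: set_mult_def)
    then have "a \<in> carrier G" "b \<in> carrier G"
      using assms normal_imp_subgroup subgroup.mem_carrier by metis+
    then have "x \<otimes> h \<otimes> inv x = (x \<otimes> a \<otimes> inv x) \<otimes> (x \<otimes> b \<otimes> inv x)"
      using x ab by (simp add: group_word)
    then show ?thesis using normal_conj(1)[OF assms(1) x ab(1)] normal_conj(1)[OF assms(2) x ab(2)]
      by (auto simp: set_mult_def)
  qed
  then show ?thesis
    using subgroup_normal_mult[OF assms(1) normal_imp_subgroup[OF assms(2)]] normal_inv_iff by blast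
qed

lemma nilpotent_sylow:
  assumes fin: "finite (carrier G)" and nil: "centralizes_series G (carrier G)" and p: "prime p"
  shows "\<exists>S. S \<lhd> G \<and> card S = p ^ multiplicity p (order G)"
proof -
  have o: "order G > 0" using fin order_gt_0_iff_finite by blast
  then obtain m where m: "order G = p ^ multiplicity p (order G) * m" "\<not> p dvd m"
    using multiplicity_decompose'[of "order G" p] p by (auto simp: prime_nat_iff)
  obtain S where S: "subgroup S G" "card S = p ^ multiplicity p (order G)"
    using sylow_thm[OF p is_group m(1) fin] by blast
  have "order G div card S = m" unfolding S(2) using m(1) p
    by (metis nonzero_mult_div_cancel_left not_prime_0 power_not_zero)
  then have "coprime (card S) (order G div card S)"
    using m(2) p S(2) by (simp add: prime_imp_coprime coprime_power_left_iff)
  then show ?thesis using nilpotent_sylow_normal[OF fin nil S(1)] S by blast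
qed

text \<open>Adding one prime at a time: normal subgroups of coprime orders meet trivially, so their
  product is a normal subgroup whose order is the product of the orders.\<close>

lemma nilpotent_hall_subgroup:
  assumes fin: "finite (carrier G)" and nil: "centralizes_series G (carrier G)"
    and "finite F" "\<And>q. q \<in> F \<Longrightarrow> prime q"
  shows "\<exists>B. B \<lhd> G \<and> card B = (\<Prod>q\<in>F. q ^ multiplicity q (order G))"
  using assms(3,4)
proof (induction F)
  case empty
  then show ?case using one_is_normal by (intro exI[of _ "{\<one>}"]) simp
next
  case (insert q F)
  then obtain B where B: "B \<lhd> G" "card B = (\<Prod>q\<in>F. q ^ multiplicity q (order G))" by blast
  obtain S where S: "S \<lhd> G" "card S = q ^ multiplicity q (order G)"
    using nilpotent_sylow[OF fin nil, of q] insert by blast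
  have sub: "subgroup S G" "subgroup B G" using S B normal_imp_subgroup by blast+
  then have f: "finite S" "finite B" using fin finite_subset subgroup.subset by metis+
  have "coprime q p" if "p \<in> F" for p using insert that by (metis insertCI primes_coprime)
  then have co: "coprime (card S) (card B)" unfolding S(2) B(2)
    by (intro prod_coprime_right) simp
  have "card (S \<inter> B) dvd card S" "card (S \<inter> B) dvd card B"
    using sub f by (auto intro!: card_subgroup_dvd subgroups_Inter_pair)
  then have "card (S \<inter> B) = 1" using co by (metis coprime_common_divisor_nat)
  then have "card (S <#> B) = card S * card B" using card_set_mult[OF sub(1) f(1) sub(2) f(2)] by simp
  then show ?case using normal_mult_normal[OF S(1) B(1)] S(2) B(2) insert by auto
qed

lemma nilpotent_split:
  assumes fin: "finite (carrier G)" and nil: "centralizes_series G (carrier G)" and p: "prime p"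
  shows "\<exists>A B. A \<lhd> G \<and> B \<lhd> G \<and> card A = p ^ multiplicity p (order G) \<and> \<not> p dvd card B \<and>
    card A * card B = order G"
proof -
  obtain A where A: "A \<lhd> G" "card A = p ^ multiplicity p (order G)"
    using nilpotent_sylow[OF assms] by blast
  let ?F = "prime_factors (order G) - {p}"
  obtain B where B: "B \<lhd> G" "card B = (\<Prod>q\<in>?F. q ^ multiplicity q (order G))"
    using nilpotent_hall_subgroup[OF fin nil, of ?F] by auto
  have o: "order G > 0" using fin order_gt_0_iff_finite by blast
  have "order G = (\<Prod>q\<in>prime_factors (order G). q ^ multiplicity q (order G))"
    using prime_factorization_nat[OF o] .
  also have "\<dots> = card A * card B"
  proof (cases "p \<in> prime_factors (order G)")
    case True
    then show ?thesis unfolding A B by (simp add: prod.remove)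
  next
    case False
    then have "\<not> p dvd order G" using p o by (auto simp: prime_factors_dvd)
    then show ?thesis using False unfolding A B by (simp add: not_dvd_imp_multiplicity_0)
  qed
  finally have AB: "card A * card B = order G" by simp
  have "\<not> p dvd card B"
  proof
    assume "p dvd card B"
    then obtain q where "q \<in> ?F" "p dvd q ^ multiplicity q (order G)"
      unfolding B using p by (auto simp: prime_dvd_prod_iff)
    then show False using p by (metis DiffE in_prime_factors_imp_prime insertI1 prime_dvd_power primes_dvd_imp_eq)
  qed
  then show ?thesis using A B AB by blast
qed

end

section \<open>Fixed cosets: the case of prime power index\<close>

context group
begin

lemma factor_through:
  assumes "N \<lhd> G" "subgroup H G" "carrier G = N <#> H" "x \<in> carrier G" "y \<in> carrier G"
  shows "\<exists>n\<in>N. \<exists>h\<in>H. x = n \<otimes> y \<otimes> h"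
proof -
  obtain n h n' h' where x: "n \<in> N" "h \<in> H" "x = n \<otimes> h" and y: "n' \<in> N" "h' \<in> H" "y = n' \<otimes> h'"
    using assms(3,4,5) unfolding set_mult_def by auto
  have N: "subgroup N G" using assms(1) normal_imp_subgroup by blast
  have c: "n \<in> carrier G" "h \<in> carrier G" "n' \<in> carrier G" "h' \<in> carrier G"
    using x y subgroup.mem_carrier[OF N] subgroup.mem_carrier[OF assms(2)] by auto
  have "x = (n \<otimes> inv n') \<otimes> y \<otimes> (inv h' \<otimes> h)" unfolding x y using c by (simp add: group_word)
  moreover have "n \<otimes> inv n' \<in> N" "inv h' \<otimes> h \<in> H"
    using x y subgroup.m_closed[OF N] subgroup.m_inv_closed[OF N] subgroup.m_closed[OF assms(2)]
      subgroup.m_inv_closed[OF assms(2)] by auto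
  ultimately show ?thesis by blast
qed

lemma subgroup_Int: "subgroup A G \<Longrightarrow> subgroup B G \<Longrightarrow> subgroup (A \<inter> B) G"
  by (rule subgroups_Inter_pair)

text \<open>\<open>N \<inter> H\<close> is normalized by \<open>H\<close> because \<open>N\<close> is normal, and by \<open>N\<close> by assumption.\<close>

lemma normal_in_product:
  assumes N: "N \<lhd> G" and H: "subgroup H G" and G: "carrier G = N <#> H"
    and K: "N \<inter> H \<lhd> G\<lparr>carrier := N\<rparr>"
  shows "N \<inter> H \<lhd> G"
proof -
  have Ns: "subgroup N G" using N normal_imp_subgroup by blast
  have "x \<otimes> k \<otimes> inv x \<in> N \<inter> H" if x: "x \<in> carrier G" and k: "k \<in> N \<inter> H" for x k
  proof -
    obtain n h where nh: "n \<in> N" "h \<in> H" "x = n \<otimes> h" using x G unfolding set_mult_def by auto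
    have c: "n \<in> carrier G" "h \<in> carrier G" "k \<in> carrier G"
      using nh k subgroup.mem_carrier[OF Ns] subgroup.mem_carrier[OF H] by auto
    have "h \<otimes> k \<otimes> inv h \<in> N \<inter> H"
      using normal_conj(1)[OF N c(2)] k nh(2) subgroup.m_closed[OF H] subgroup.m_inv_closed[OF H] by blast
    then have "n \<otimes> (h \<otimes> k \<otimes> inv h) \<otimes> inv n \<in> N \<inter> H"
      using normal.inv_op_closed2[OF K, of n "h \<otimes> k \<otimes> inv h"] nh(1) m_inv_consistent[OF Ns nh(1)] by simp
    moreover have "x \<otimes> k \<otimes> inv x = n \<otimes> (h \<otimes> k \<otimes> inv h) \<otimes> inv n"
      unfolding nh(3) using c by (simp add: group_word)
    ultimately show ?thesis by simp
  qed
  then show ?thesis using normal_inv_iff subgroup_Int[OF Ns H] by blast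
qed

text \<open>The hypothesis \<open>grow\<close> is the only place where the structure of \<open>J\<close> or of \<open>G\<close> enters: a
  proper subgroup \<open>J \<inter> y H y\<^sup>-\<^sup>1\<close> of \<open>J\<close> that contains \<open>P\<close> is normalized by some element of \<open>J\<close>
  outside it. Let \<open>J1\<close> be such a subgroup of maximal order and \<open>A\<close> its normalizer in \<open>J\<close>. Every
  coset of \<open>H\<close> that is fixed by \<open>J1\<close> has stabilizer \<open>J1\<close> in \<open>J\<close>; so \<open>|A : J1|\<close> divides the number
  of these cosets, which is a power of \<open>p\<close>.\<close>

lemma fixed_coset_prime_power_case:
  assumes fin: "finite (carrier G)" and N: "N \<lhd> G" and H: "subgroup H G" and J: "subgroup J G"
    and G: "carrier G = N <#> H" and K: "N \<inter> H \<lhd> G\<lparr>carrier := N\<rparr>"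
    and p: "prime p" and cN: "card N = p ^ e * card (N \<inter> H)"
    and P: "subgroup P G" "P \<subseteq> J" "\<not> p dvd card J div card P"
    and g0: "g0 \<in> carrier G" "P \<subseteq> coset_stabilizer G H g0"
    and grow: "\<And>y. \<lbrakk>y \<in> carrier G; P \<subseteq> coset_stabilizer G H y; \<not> J \<subseteq> coset_stabilizer G H y\<rbrakk> \<Longrightarrow>
      \<exists>x \<in> J - coset_stabilizer G H y. \<forall>s \<in> J \<inter> coset_stabilizer G H y. x \<otimes> s \<otimes> inv x \<in> coset_stabilizer G H y"
  shows "\<exists>g\<in>carrier G. J \<subseteq> coset_stabilizer G H g"
proof -
  let ?S = "coset_stabilizer G H"
  have Ns: "subgroup N G" using N normal_imp_subgroup by blast
  have KG: "N \<inter> H \<lhd> G" using normal_in_product[OF N H G K] .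
  have finsub: "finite A" if "subgroup A G" for A using that fin finite_subset subgroup.subset by metis
  have sS: "subgroup (?S y) G" if "y \<in> carrier G" for y using subgroup_coset_stabilizer[OF H that] .
  have "\<exists>y. (y \<in> carrier G \<and> P \<subseteq> ?S y) \<and>
      (\<forall>z. z \<in> carrier G \<and> P \<subseteq> ?S z \<longrightarrow> card (J \<inter> ?S z) \<le> card (J \<inter> ?S y))"
    using g0 finsub[OF J] by (intro ex_has_greatest_nat[of _ g0 _ "Suc (card J)"]) (auto simp: less_Suc_eq_le intro: card_mono)
  then obtain y where y: "y \<in> carrier G" "P \<subseteq> ?S y"
    and max: "\<And>z. \<lbrakk>z \<in> carrier G; P \<subseteq> ?S z\<rbrakk> \<Longrightarrow> card (J \<inter> ?S z) \<le> card (J \<inter> ?S y)" by blast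
  define J1 where "J1 = J \<inter> ?S y"
  have J1: "subgroup J1 G" unfolding J1_def using subgroup_Int[OF J sS[OF y(1)]] .
  have fJ1: "finite J1" using finsub[OF J1] .
  have PJ1: "P \<subseteq> J1" using P(2) y(2) J1_def by blast
  have stab_eq: "J \<inter> ?S z = J1" if z: "z \<in> carrier G" "J1 \<subseteq> ?S z" for z
  proof -
    have "J1 \<subseteq> J \<inter> ?S z" using z J1_def by blast
    moreover have "card (J \<inter> ?S z) \<le> card J1" using max[OF z(1)] PJ1 z(2) J1_def by blast
    ultimately show ?thesis using finsub[OF J] by (metis card_seteq finite_Int)
  qed
  have "J \<subseteq> ?S y"
  proof (rule ccontr)
    assume nJ: "\<not> J \<subseteq> ?S y"
    then obtain x where x: "x \<in> J" "x \<notin> ?S y" "\<And>s. s \<in> J1 \<Longrightarrow> x \<otimes> s \<otimes> inv x \<in> ?S y"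
      using grow[OF y] J1_def by blast
    define A where "A = {x \<in> J. \<forall>s\<in>J1. x \<otimes> s \<otimes> inv x \<in> J1}"
    have A: "subgroup A G" unfolding A_def by (rule subgroup_normalizer[OF J J1 fJ1])
    have J1A: "J1 \<subseteq> A" unfolding A_def
      using subgroup.m_closed[OF J1] subgroup.m_inv_closed[OF J1] J1_def by auto
    have xA: "x \<in> A" "x \<notin> J1" unfolding A_def J1_def
      using x subgroup.m_closed[OF J] subgroup.m_inv_closed[OF J] by (auto simp: J1_def)
    \<comment> \<open>the union of the cosets of \<open>H\<close> that \<open>J1\<close> fixes\<close>
    define Y where "Y = {z \<in> carrier G. J1 \<subseteq> ?S z}"
    define d where "d = card A div card J1"
    have d: "card A = d * card J1" unfolding d_def
      using card_subgroup_dvd[OF J1 A J1A finsub[OF A]] by simp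
    have one: "card B > 0" if "subgroup B G" for B
      using finsub[OF that] subgroup.one_closed[OF that] by (metis card_gt_0_iff empty_iff)
    have dY: "d * card H dvd card Y"
    proof (rule double_coset_dvd[OF A H fin])
      show "Y \<subseteq> carrier G" unfolding Y_def by blast
      show "a \<otimes> z \<otimes> h \<in> Y" if a: "a \<in> A" and z: "z \<in> Y" and h: "h \<in> H" for a z h
      proof -
        have c: "a \<in> carrier G" "z \<in> carrier G" "h \<in> carrier G"
          using a z h subgroup.mem_carrier[OF A] subgroup.mem_carrier[OF H] Y_def by auto
        have "j \<in> ?S (a \<otimes> z)" if j: "j \<in> J1" for j
        proof -
          have jG: "j \<in> carrier G" using j subgroup.mem_carrier[OF J1] by blast
          have "inv a \<in> A" using a subgroup.m_inv_closed[OF A] by blast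
          then have "inv a \<otimes> j \<otimes> inv (inv a) \<in> J1" using j unfolding A_def by blast
          then have "inv a \<otimes> j \<otimes> a \<in> ?S z" using z c unfolding Y_def by auto
          then have "inv z \<otimes> (inv a \<otimes> j \<otimes> a) \<otimes> z \<in> H" by (simp add: coset_stabilizer_def)
          moreover have "inv z \<otimes> (inv a \<otimes> j \<otimes> a) \<otimes> z = inv (a \<otimes> z) \<otimes> j \<otimes> (a \<otimes> z)"
            using c jG by (simp add: group_word)
          ultimately show ?thesis using jG by (simp add: coset_stabilizer_def)
        qed
        then show ?thesis unfolding Y_def using coset_stabilizer_mult_right[OF H _ h, of "a \<otimes> z"] c by auto
      qed
      show "d * card (A \<inter> ?S z) dvd card A" if z: "z \<in> Y" for z
      proof -
        have "J \<inter> ?S z = J1" using stab_eq z Y_def by blast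
        then have "A \<inter> ?S z = J1" using J1A A_def by blast
        then show ?thesis using d by simp
      qed
    qed
    \<comment> \<open>the elements of \<open>N\<close> that centralize \<open>J1\<close> modulo \<open>N \<inter> H\<close>; they permute the cosets in \<open>Y\<close> transitively\<close>
    define M where "M = {m \<in> N. \<forall>j\<in>J1. inv m \<otimes> j \<otimes> m \<otimes> inv j \<in> N \<inter> H}"
    have M: "subgroup M G"
    proof (rule subgroupI)
      show "M \<subseteq> carrier G" unfolding M_def using subgroup.mem_carrier[OF Ns] by blast
      have "\<one> \<in> M" unfolding M_def
        using subgroup.one_closed[OF Ns] subgroup.one_closed[OF H] subgroup.mem_carrier[OF J1] by auto
      then show "M \<noteq> {}" by blast
      fix a assume a: "a \<in> M"
      have aG: "a \<in> carrier G" "a \<in> N" using a M_def subgroup.mem_carrier[OF Ns] by auto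
      have "inv (inv a) \<otimes> j \<otimes> inv a \<otimes> inv j \<in> N \<inter> H" if j: "j \<in> J1" for j
      proof -
        have jG: "j \<in> carrier G" using j subgroup.mem_carrier[OF J1] by blast
        have k: "inv a \<otimes> j \<otimes> a \<otimes> inv j \<in> N \<inter> H" using a j M_def by blast
        have "a \<otimes> inv (inv a \<otimes> j \<otimes> a \<otimes> inv j) \<otimes> inv a \<in> N \<inter> H"
          using normal_conj(1)[OF KG aG(1)] subgroup.m_inv_closed[OF normal_imp_subgroup[OF KG] k] by blast
        moreover have "a \<otimes> inv (inv a \<otimes> j \<otimes> a \<otimes> inv j) \<otimes> inv a = inv (inv a) \<otimes> j \<otimes> inv a \<otimes> inv j"
          using aG jG by (simp add: group_word)
        ultimately show ?thesis by simp
      qed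
      then show "inv a \<in> M" unfolding M_def using subgroup.m_inv_closed[OF Ns aG(2)] by blast
      fix b assume b: "b \<in> M"
      have bG: "b \<in> carrier G" "b \<in> N" using b M_def subgroup.mem_carrier[OF Ns] by auto
      have "inv (a \<otimes> b) \<otimes> j \<otimes> (a \<otimes> b) \<otimes> inv j \<in> N \<inter> H" if j: "j \<in> J1" for j
      proof -
        have jG: "j \<in> carrier G" using j subgroup.mem_carrier[OF J1] by blast
        have k: "inv a \<otimes> j \<otimes> a \<otimes> inv j \<in> N \<inter> H" "inv b \<otimes> j \<otimes> b \<otimes> inv j \<in> N \<inter> H"
          using a b j M_def by blast+
        have "(inv b \<otimes> (inv a \<otimes> j \<otimes> a \<otimes> inv j) \<otimes> b) \<otimes> (inv b \<otimes> j \<otimes> b \<otimes> inv j) \<in> N \<inter> H"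
          using normal_conj(2)[OF KG bG(1) k(1)] subgroup.m_closed[OF normal_imp_subgroup[OF KG] _ k(2)] by blast
        moreover have "(inv b \<otimes> (inv a \<otimes> j \<otimes> a \<otimes> inv j) \<otimes> b) \<otimes> (inv b \<otimes> j \<otimes> b \<otimes> inv j) =
            inv (a \<otimes> b) \<otimes> j \<otimes> (a \<otimes> b) \<otimes> inv j"
          using aG bG jG by (simp add: group_word)
        ultimately show ?thesis by simp
      qed
      then show "a \<otimes> b \<in> M" unfolding M_def using subgroup.m_closed[OF Ns aG(2) bG(2)] by blast
    qed
    have MN: "M \<subseteq> N" unfolding M_def by blast
    have conjK: "inv y \<otimes> m \<otimes> y \<in> N \<inter> H \<longleftrightarrow> m \<in> N \<inter> H" if "m \<in> carrier G" for m
    proof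
      assume "inv y \<otimes> m \<otimes> y \<in> N \<inter> H"
      then have "y \<otimes> (inv y \<otimes> m \<otimes> y) \<otimes> inv y \<in> N \<inter> H" using normal_conj(1)[OF KG y(1)] by blast
      moreover have "y \<otimes> (inv y \<otimes> m \<otimes> y) \<otimes> inv y = m" using y that by (simp add: group_word)
      ultimately show "m \<in> N \<inter> H" by simp
    qed (use normal_conj(2)[OF KG y(1)] in blast)
    have NS: "N \<inter> ?S y = N \<inter> H"
    proof -
      have "m \<in> ?S y \<longleftrightarrow> m \<in> N \<inter> H" if m: "m \<in> N" for m
      proof -
        have "m \<in> carrier G" using m subgroup.mem_carrier[OF Ns] by blast
        then show ?thesis using conjK[of m] normal_conj(2)[OF N y(1) m] m
          by (simp add: coset_stabilizer_def)
      qed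
      then show ?thesis by blast
    qed
    have KM: "N \<inter> H \<subseteq> M"
    proof
      fix k assume k: "k \<in> N \<inter> H"
      have "inv k \<otimes> j \<otimes> k \<otimes> inv j \<in> N \<inter> H" if "j \<in> J1" for j
      proof -
        have c: "j \<in> carrier G" "k \<in> carrier G"
          using that k subgroup.mem_carrier[OF J1] subgroup.mem_carrier[OF Ns] by auto
        have "inv k \<otimes> (j \<otimes> k \<otimes> inv j) \<in> N \<inter> H"
          using normal_conj(1)[OF KG c(1) k] normal_imp_subgroup[OF KG] k
            subgroup.m_closed subgroup.m_inv_closed by metis
        then show ?thesis using c by (simp add: m_assoc)
      qed
      then show "k \<in> M" unfolding M_def using k by blast
    qed
    have Y_eq: "Y = {m \<otimes> y \<otimes> h |m h. m \<in> M \<and> h \<in> H}"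
    proof -
      have YM: "m \<otimes> y \<in> Y \<longleftrightarrow> m \<in> M" if m: "m \<in> N" for m
      proof -
        have mG: "m \<in> carrier G" using m subgroup.mem_carrier[OF Ns] by blast
        have "j \<in> ?S (m \<otimes> y) \<longleftrightarrow> inv m \<otimes> j \<otimes> m \<otimes> inv j \<in> N \<inter> H" if j: "j \<in> J1" for j
        proof -
          have jG: "j \<in> carrier G" using j subgroup.mem_carrier[OF J1] by blast
          have h: "inv y \<otimes> j \<otimes> y \<in> H" using j J1_def by (simp add: coset_stabilizer_def)
          have e: "inv (m \<otimes> y) \<otimes> j \<otimes> (m \<otimes> y) =
              (inv y \<otimes> (inv m \<otimes> j \<otimes> m \<otimes> inv j) \<otimes> y) \<otimes> (inv y \<otimes> j \<otimes> y)"
            using mG jG y by (simp add: group_word)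
          have e': "inv y \<otimes> (inv m \<otimes> j \<otimes> m \<otimes> inv j) \<otimes> y =
              (inv (m \<otimes> y) \<otimes> j \<otimes> (m \<otimes> y)) \<otimes> inv (inv y \<otimes> j \<otimes> y)"
            using mG jG y by (simp add: group_word)
          have "inv m \<otimes> (j \<otimes> m \<otimes> inv j) \<in> N"
            using normal_conj(1)[OF N jG m] subgroup.m_closed[OF Ns] subgroup.m_inv_closed[OF Ns m] by blast
          then have n: "inv m \<otimes> j \<otimes> m \<otimes> inv j \<in> N" using mG jG by (simp add: m_assoc)
          have "j \<in> ?S (m \<otimes> y) \<longleftrightarrow> inv y \<otimes> (inv m \<otimes> j \<otimes> m \<otimes> inv j) \<otimes> y \<in> H"
            using e e' h jG subgroup.m_closed[OF H] subgroup.m_inv_closed[OF H]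
            unfolding coset_stabilizer_def by (metis (no_types, lifting) mem_Collect_eq)
          also have "\<dots> \<longleftrightarrow> inv y \<otimes> (inv m \<otimes> j \<otimes> m \<otimes> inv j) \<otimes> y \<in> N \<inter> H"
            using normal_conj(2)[OF N y(1) n] by blast
          also have "\<dots> \<longleftrightarrow> inv m \<otimes> j \<otimes> m \<otimes> inv j \<in> N \<inter> H"
            using conjK mG jG by simp
          finally show ?thesis .
        qed
        then show ?thesis unfolding Y_def M_def using m mG y(1) by auto
      qed
      have YH: "z \<otimes> h \<in> Y \<longleftrightarrow> z \<in> Y" if "z \<in> carrier G" "h \<in> H" for z h
        using coset_stabilizer_mult_right[OF H that] that subgroup.mem_carrier[OF H] unfolding Y_def by auto
      have Mc: "m \<otimes> y \<in> carrier G" if "m \<in> N" for m using that y subgroup.mem_carrier[OF Ns] by auto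
      show ?thesis
      proof (intro equalityI subsetI)
        fix z assume z: "z \<in> Y"
        then obtain n h where nh: "n \<in> N" "h \<in> H" "z = n \<otimes> y \<otimes> h"
          using factor_through[OF N H G _ y(1), of z] Y_def by blast
        then have "n \<otimes> y \<in> Y" using z YH[OF Mc] by blast
        then show "z \<in> {m \<otimes> y \<otimes> h |m h. m \<in> M \<and> h \<in> H}" using nh YM by blast
      qed (use YM YH Mc MN in blast)
    qed
    have "M \<inter> ?S y = N \<inter> H" using NS MN KM by blast
    then have cY: "card Y * card (N \<inter> H) = card M * card H"
      unfolding Y_eq using card_double_coset[OF M finsub[OF M] H finsub[OF H] y(1)] by simp
    have "d * card H * card (N \<inter> H) dvd card M * card H"
      unfolding cY[symmetric] using dY by (rule mult_dvd_mono) simp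
    then have "d * card (N \<inter> H) * card H dvd card M * card H" by (simp add: mult.commute mult.left_commute)
    then have "d * card (N \<inter> H) dvd card M" using one[OF H] by simp
    also have "card M dvd p ^ e * card (N \<inter> H)"
      using card_subgroup_dvd[OF M Ns MN finsub[OF Ns]] cN by simp
    finally have dp: "d dvd p ^ e" using one[OF subgroup_Int[OF Ns H]] by simp
    have "card J1 dvd card A" "card A dvd card J" "card P dvd card J1"
      using card_subgroup_dvd J1 A J P J1A PJ1 finsub A_def by auto
    then obtain b c where bc: "card J1 = card P * b" "card J = card A * c" by (meson dvdE)
    then have "card J = card P * (b * d * c)" using d by simp
    then have "card J div card P = b * d * c" using one[OF P(1)] by simp
    then have "\<not> p dvd d" using P(3) by (metis dvd_mult dvd_mult2)
    then have "d = 1" using dp p by (metis divides_primepow_nat dvd_power gr0I power_0)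
    then have "A = J1" using d J1A finsub[OF A] by (metis card_subset_eq mult_1)
    then show False using xA by blast
  qed
  then show ?thesis using y(1) by blast
qed

end

section \<open>Groups whose commutators centralize a series\<close>

context group
begin

text \<open>If \<open>d\<close> moves \<open>u\<close> by a factor \<open>z\<close> that it centralizes, then \<open>d\<^sup>r\<close> moves \<open>u\<close> by \<open>z\<^sup>r\<close>. So
  \<open>d\<^sup>r\<close> centralizes \<open>u\<close> as soon as \<open>z\<^sup>r = 1\<close>.\<close>

lemma pow_of_skew_commuting:
  assumes "d \<in> carrier G" "z \<in> carrier G" "u \<in> carrier G"
    and "d \<otimes> z = z \<otimes> d" and du: "d \<otimes> u = z \<otimes> u \<otimes> d"
  shows "d [^] (r::nat) \<otimes> u = z [^] r \<otimes> u \<otimes> d [^] r"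
proof (induction r)
  case (Suc r)
  have dz: "d [^] r \<otimes> z = z \<otimes> d [^] r"
    using assms(1,2,4) by (induction r) (simp_all add: m_assoc, metis m_assoc nat_pow_closed)
  have "d [^] Suc r \<otimes> u = d [^] r \<otimes> z \<otimes> u \<otimes> d" using assms by (simp add: m_assoc)
  also have "\<dots> = z \<otimes> (d [^] r \<otimes> u) \<otimes> d" unfolding dz using assms by (simp add: m_assoc)
  also have "\<dots> = z [^] Suc r \<otimes> u \<otimes> d [^] Suc r"
    unfolding Suc.IH nat_pow_Suc2[OF assms(2)] using assms(1-3) by (simp add: m_assoc)
  finally show ?case .
qed (use assms in simp)

lemma pow_conj:
  assumes "g \<in> carrier G" "x \<in> carrier G"
  shows "(inv g \<otimes> x \<otimes> g) [^] (k::nat) = inv g \<otimes> x [^] k \<otimes> g"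
  by (induction k) (use assms in \<open>simp_all add: group_word\<close>)

lemma conj_mult:
  assumes "x \<in> carrier G" "a \<in> carrier G" "b \<in> carrier G"
  shows "x \<otimes> (a \<otimes> b) \<otimes> inv x = (x \<otimes> a \<otimes> inv x) \<otimes> (x \<otimes> b \<otimes> inv x)"
  using assms by (simp add: group_word)

lemma conj_inv:
  assumes "x \<in> carrier G" "a \<in> carrier G"
  shows "x \<otimes> inv a \<otimes> inv x = inv (x \<otimes> a \<otimes> inv x)"
  using assms by (simp add: group_word)

text \<open>The elements that act trivially on all groups \<open>L i\<close> modulo \<open>K i\<close> form the kernel of the
  action of \<open>G\<close> by conjugation on these quotients.\<close>

lemma centralizer_of_series_normal:
  assumes K: "\<And>i. i \<le> n \<Longrightarrow> K i \<lhd> G" and L: "\<And>i. i \<le> n \<Longrightarrow> L i \<lhd> G"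
  shows "{c \<in> carrier G. \<forall>i\<le>n. \<forall>u\<in>L i. c \<otimes> u \<otimes> inv c \<otimes> inv u \<in> K i} \<lhd> G" (is "?A \<lhd> G")
proof -
  note Ks = normal_imp_subgroup[OF K]
  have LG: "u \<in> carrier G" if "i \<le> n" "u \<in> L i" for i u
    using that L normal_imp_subgroup subgroup.mem_carrier by metis
  have sub: "subgroup ?A G"
  proof (rule subgroupI)
    have "\<one> \<in> ?A" using subgroup.one_closed[OF Ks] LG by auto
    then show "?A \<noteq> {}" by blast
    fix a assume a: "a \<in> ?A"
    then have aG: "a \<in> carrier G" by blast
    have "inv a \<otimes> u \<otimes> inv (inv a) \<otimes> inv u \<in> K i" if "i \<le> n" "u \<in> L i" for i u
    proof -
      have "inv (a \<otimes> u \<otimes> inv a \<otimes> inv u) \<in> K i"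
        using a that subgroup.m_inv_closed[OF Ks[OF that(1)]] by blast
      then have "inv a \<otimes> inv (a \<otimes> u \<otimes> inv a \<otimes> inv u) \<otimes> a \<in> K i"
        using normal_conj(2)[OF K[OF that(1)] aG] by blast
      then show ?thesis using aG LG[OF that] by (simp add: group_word)
    qed
    moreover have "inv a \<in> carrier G" using aG by simp
    ultimately show "inv a \<in> ?A" by blast
    fix b assume b: "b \<in> ?A"
    then have bG: "b \<in> carrier G" by blast
    have "a \<otimes> b \<otimes> u \<otimes> inv (a \<otimes> b) \<otimes> inv u \<in> K i" if "i \<le> n" "u \<in> L i" for i u
    proof -
      have "b \<otimes> u \<otimes> inv b \<otimes> inv u \<in> K i" "a \<otimes> u \<otimes> inv a \<otimes> inv u \<in> K i" using a b that by blast+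
      then have "(a \<otimes> (b \<otimes> u \<otimes> inv b \<otimes> inv u) \<otimes> inv a) \<otimes> (a \<otimes> u \<otimes> inv a \<otimes> inv u) \<in> K i"
        using normal_conj(1)[OF K[OF that(1)] aG] subgroup.m_closed[OF Ks[OF that(1)]] by blast
      then show ?thesis using aG bG LG[OF that] by (simp add: group_word)
    qed
    moreover have "a \<otimes> b \<in> carrier G" using aG bG by simp
    ultimately show "a \<otimes> b \<in> ?A" by blast
  qed blast
  have cj: "x \<otimes> a \<otimes> inv x \<in> ?A" if x: "x \<in> carrier G" and a: "a \<in> ?A" for x a
  proof -
    have aG: "a \<in> carrier G" using a by blast
    have "x \<otimes> a \<otimes> inv x \<otimes> u \<otimes> inv (x \<otimes> a \<otimes> inv x) \<otimes> inv u \<in> K i" if "i \<le> n" "u \<in> L i" for i u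
    proof -
      define v where "v = inv x \<otimes> u \<otimes> x"
      have vG: "v \<in> carrier G" unfolding v_def using x LG[OF that] by simp
      have u: "x \<otimes> v \<otimes> inv x = u" unfolding v_def using x LG[OF that] by (simp add: group_word)
      have "v \<in> L i" unfolding v_def using normal_conj(2)[OF L[OF that(1)] x that(2)] .
      then have "x \<otimes> (a \<otimes> v \<otimes> inv a \<otimes> inv v) \<otimes> inv x \<in> K i"
        using a that normal_conj(1)[OF K[OF that(1)] x] by blast
      moreover have "x \<otimes> (a \<otimes> v \<otimes> inv a \<otimes> inv v) \<otimes> inv x =
          x \<otimes> a \<otimes> inv x \<otimes> u \<otimes> inv (x \<otimes> a \<otimes> inv x) \<otimes> inv u"
        by (simp only: conj_mult conj_inv u m_closed inv_closed aG vG x)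
      ultimately show ?thesis by simp
    qed
    moreover have "x \<otimes> a \<otimes> inv x \<in> carrier G" using aG x by simp
    ultimately show ?thesis by blast
  qed
  show ?thesis by (rule normal_inv_iff[THEN iffD2]) (intro conjI sub ballI cj)
qed

text \<open>Let \<open>A\<close> be the subgroup of all elements that act trivially on the factors of the series cut
  down to \<open>N\<close>. Each factor costs one more \<open>p\<^sup>e\<close>-th power, so for \<open>c\<close> in \<open>A\<close> and a series of length
  \<open>n\<close>, the power \<open>d = c\<^bsup>p^(e n)\<^esup>\<close> centralizes \<open>N\<close> modulo \<open>L = N \<inter> H\<close>. Write \<open>d = m h\<close> with \<open>m\<close> in
  \<open>N\<close> and \<open>h\<close> in \<open>H\<close>; modulo \<open>L\<close> these factors commute and the \<open>p\<^sup>e\<close>-th power of \<open>m\<close> is trivial,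
  so the \<open>p\<^sup>e\<close>-th power of \<open>d\<close> lies in \<open>H\<close>.\<close>

lemma commutators_have_prime_power_torsion_mod_stabilizer:
  assumes fin: "finite (carrier G)" and N: "N \<lhd> G" and H: "subgroup H G"
    and G: "carrier G = N <#> H" and K: "N \<inter> H \<lhd> G\<lparr>carrier := N\<rparr>"
    and cN: "card N = p ^ e * card (N \<inter> H)"
    and ser: "centralizes_series G (derived_set G (carrier G))"
  shows "\<exists>A E. A \<lhd> G \<and> derived_set G (carrier G) \<subseteq> A \<and> (\<forall>c\<in>A. c [^] (p ^ E) \<in> H)"
proof -
  from ser obtain n S where S: "S 0 = {\<one>}" "S n = carrier G" "\<And>i. i \<le> n \<Longrightarrow> S i \<lhd> G"
    and mono: "\<And>i. i < n \<Longrightarrow> S i \<subseteq> S (Suc i)"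
    and c: "\<And>i u c. \<lbrakk>i < n; u \<in> S (Suc i); c \<in> derived_set G (carrier G)\<rbrakk> \<Longrightarrow> c \<otimes> u \<otimes> inv c \<otimes> inv u \<in> S i"
    by (rule centralizes_seriesE) blast
  define L where "L = N \<inter> H"
  have L: "L \<lhd> G" unfolding L_def using normal_in_product[OF N H G K] .
  have Ns: "subgroup N G" using N normal_imp_subgroup by blast
  interpret L: normal L G by (rule L)
  define Q where "Q = G Mod L"
  define q where "q = (\<lambda>x. L #> x)"
  interpret Q: group Q unfolding Q_def by (rule L.factorgroup_is_group)
  interpret q: group_hom G Q q
    unfolding q_def Q_def group_hom_def group_hom_axioms_def
    using L.r_coset_hom_Mod L.factorgroup_is_group is_group by blast
  have q1: "q x = \<one>\<^bsub>Q\<^esub> \<longleftrightarrow> x \<in> L" if "x \<in> carrier G" for x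
    unfolding q_def Q_def one_FactGroup
    using coset_join1[OF _ that L.subgroup_axioms] coset_join2[OF that L.subgroup_axioms] L.subset by blast
  have qpow: "q (x [^] (k::nat)) = q x [^]\<^bsub>Q\<^esub> k" if "x \<in> carrier G" for x k
    using q.hom_nat_pow[OF that] .
  have pe: "q z [^]\<^bsub>Q\<^esub> (p ^ e) = \<one>\<^bsub>Q\<^esub>" if z: "z \<in> N" for z
  proof -
    have zG: "z \<in> carrier G" using z subgroup.mem_carrier[OF Ns] by blast
    have "card N div card (N \<inter> H) = p ^ e" 
    proof -
      have "card (N \<inter> H) > 0"
        using subgroup.one_closed[OF Ns] subgroup.one_closed[OF H] fin subgroup.subset[OF Ns]
        by (metis Int_iff card_gt_0_iff empty_iff finite_Int finite_subset)
      then show ?thesis using cN by simp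
    qed
    then have "z [^] (p ^ e) \<in> L"
      using pow_index_mem[OF Ns finite_subset[OF subgroup.subset[OF Ns] fin] K z] L_def by simp
    then show ?thesis using q1 qpow zG by (metis nat_pow_closed)
  qed
  \<comment> \<open>The factors are indexed by their upper terms; for \<open>i = 0\<close> both terms are \<open>S 0\<close>.\<close>
  define A where "A = {c \<in> carrier G. \<forall>i\<le>n. \<forall>u\<in>S i \<inter> N. c \<otimes> u \<otimes> inv c \<otimes> inv u \<in> S (i - 1)}"
  have A: "A \<lhd> G" unfolding A_def
  proof (rule centralizer_of_series_normal)
    show "S (i - 1) \<lhd> G" if "i \<le> n" for i using S(3) that by simp
    show "S i \<inter> N \<lhd> G" if "i \<le> n" for i using normal_subgroup_intersect[OF S(3)[OF that] N] .
  qed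
  have As: "subgroup A G" using A normal_imp_subgroup by blast
  have AG: "c \<in> carrier G" if "c \<in> A" for c using that A_def by blast
  have "derived_set G (carrier G) \<subseteq> A"
  proof
    fix x assume x: "x \<in> derived_set G (carrier G)"
    then have xG: "x \<in> carrier G" by auto
    have "x \<otimes> u \<otimes> inv x \<otimes> inv u \<in> S (i - 1)" if i: "i \<le> n" and u: "u \<in> S i" for i u
    proof (cases i)
      case 0
      then show ?thesis using u S(1) xG by simp
    next
      case (Suc j)
      then show ?thesis using c[of j u x] i u x by simp
    qed
    then show "x \<in> A" unfolding A_def using xG by blast
  qed
  have step: "q (c [^] (p ^ (e * i))) \<otimes>\<^bsub>Q\<^esub> q u = q u \<otimes>\<^bsub>Q\<^esub> q (c [^] (p ^ (e * i)))"
    if "i \<le> n" "c \<in> A" "u \<in> S i \<inter> N" for i c u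
    using that
  proof (induction i arbitrary: u)
    case 0
    then show ?case using S(1) AG by simp
  next
    case (Suc i)
    define d where "d = c [^] (p ^ (e * i))"
    have dA: "d \<in> A" unfolding d_def using subgroup_int_pow_closed[OF As Suc.prems(2)] by (metis int_pow_int)
    have dG: "d \<in> carrier G" using dA AG by blast
    have uG: "u \<in> carrier G" using Suc.prems(3) subgroup.mem_carrier[OF Ns] by blast
    define z where "z = d \<otimes> u \<otimes> inv d \<otimes> inv u"
    have zS: "z \<in> S i" using dA Suc.prems unfolding A_def z_def by fastforce
    have zN: "z \<in> N" unfolding z_def
      using normal_conj(1)[OF N dG, of u] Suc.prems(3) subgroup.m_closed[OF Ns] subgroup.m_inv_closed[OF Ns] by blast
    have zG: "z \<in> carrier G" using zN subgroup.mem_carrier[OF Ns] by blast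
    have 1: "q d \<otimes>\<^bsub>Q\<^esub> q z = q z \<otimes>\<^bsub>Q\<^esub> q d"
      unfolding d_def using Suc.IH[of z] Suc.prems zS zN by simp
    have "d \<otimes> u = z \<otimes> u \<otimes> d" unfolding z_def using dG uG by (simp add: group_word)
    then have 2: "q d \<otimes>\<^bsub>Q\<^esub> q u = q z \<otimes>\<^bsub>Q\<^esub> q u \<otimes>\<^bsub>Q\<^esub> q d"
      using dG uG zG by (metis m_closed q.hom_mult)
    have "q d [^]\<^bsub>Q\<^esub> (p ^ e) \<otimes>\<^bsub>Q\<^esub> q u = q u \<otimes>\<^bsub>Q\<^esub> q d [^]\<^bsub>Q\<^esub> (p ^ e)"
      using Q.pow_of_skew_commuting[OF _ _ _ 1 2, of "p ^ e"] pe[OF zN] dG uG zG by simp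
    moreover have "c [^] (p ^ (e * Suc i)) = d [^] (p ^ e)"
      unfolding d_def using AG[OF Suc.prems(2)] by (simp add: nat_pow_pow power_add mult.commute)
    ultimately show ?case using qpow dG by simp
  qed
  have "c [^] (p ^ (e * n + e)) \<in> H" if cA: "c \<in> A" for c
  proof -
    define d where "d = c [^] (p ^ (e * n))"
    have dG: "d \<in> carrier G" unfolding d_def using cA AG by simp
    obtain m h where mh: "m \<in> N" "h \<in> H" "d = m \<otimes> h" using dG G unfolding set_mult_def by auto
    have mG: "m \<in> carrier G" and hG: "h \<in> carrier G"
      using mh subgroup.mem_carrier[OF Ns] subgroup.mem_carrier[OF H] by auto
    have com: "q d \<otimes>\<^bsub>Q\<^esub> q m = q m \<otimes>\<^bsub>Q\<^esub> q d"
      unfolding d_def using step[of n c m] cA S(2) mG mh(1) by simp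
    have qd: "q d = q m \<otimes>\<^bsub>Q\<^esub> q h" using mh(3) mG hG by simp
    then have qh: "q h = inv\<^bsub>Q\<^esub> q m \<otimes>\<^bsub>Q\<^esub> q d" using mG hG by (simp add: Q.inv_cancel_left)
    have mhc: "q m \<otimes>\<^bsub>Q\<^esub> q h = q h \<otimes>\<^bsub>Q\<^esub> q m"
      using com mG hG unfolding qd by (simp add: Q.m_assoc) 
    have "q d [^]\<^bsub>Q\<^esub> (p ^ e) = q m [^]\<^bsub>Q\<^esub> (p ^ e) \<otimes>\<^bsub>Q\<^esub> q h [^]\<^bsub>Q\<^esub> (p ^ e)"
      unfolding qd using Q.pow_mult_distrib[OF mhc] mG hG by simp
    then have "q (d [^] (p ^ e)) = q (h [^] (p ^ e))" using pe[OF mh(1)] qpow dG hG by simp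
    then have "q (d [^] (p ^ e) \<otimes> inv (h [^] (p ^ e))) = \<one>\<^bsub>Q\<^esub>" using dG hG by simp
    then have "d [^] (p ^ e) \<otimes> inv (h [^] (p ^ e)) \<in> H"
      using q1[of "d [^] (p ^ e) \<otimes> inv (h [^] (p ^ e))"] dG hG L_def by auto
    moreover have "h [^] (p ^ e) \<in> H" using subgroup_int_pow_closed[OF H mh(2)] by (metis int_pow_int)
    ultimately have "d [^] (p ^ e) \<otimes> inv (h [^] (p ^ e)) \<otimes> h [^] (p ^ e) \<in> H" using subgroup.m_closed[OF H] by blast
    then have "d [^] (p ^ e) \<in> H" using dG hG by (simp add: m_assoc)
    then show ?thesis unfolding d_def using AG[OF cA] by (simp add: nat_pow_pow power_add)
  qed
  then show ?thesis using A \<open>derived_set G (carrier G) \<subseteq> A\<close> by blast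
qed

lemma finite_subgroup: "finite (carrier G) \<Longrightarrow> subgroup A G \<Longrightarrow> finite A"
  using finite_subset subgroup.subset by metis

lemma card_subgroup_pos: "finite (carrier G) \<Longrightarrow> subgroup A G \<Longrightarrow> card A > 0"
  using finite_subgroup subgroup.one_closed by (metis card_gt_0_iff empty_iff)

text \<open>Let \<open>t = |A : A \<inter> S|\<close>. It divides the index of \<open>S\<close>, because \<open>t = |A S : S|\<close>, and so is prime
  to \<open>p\<close>. A prime \<open>q \<noteq> p\<close> does not divide \<open>t\<close> either: an element of a Sylow \<open>q\<close>-subgroup of \<open>A\<close> is
  a power of its own \<open>p\<^sup>E\<close>-th power, which lies in \<open>S\<close>.\<close>

lemma normal_prime_power_torsion_subset:
  assumes fin: "finite (carrier G)" and p: "prime p" and A: "A \<lhd> G" and S: "subgroup S G"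
    and pw: "\<And>c. c \<in> A \<Longrightarrow> c [^] (p ^ E) \<in> S" and ind: "\<not> p dvd order G div card S"
  shows "A \<subseteq> S"
proof -
  have As: "subgroup A G" using A normal_imp_subgroup by blast
  have B: "subgroup (A \<inter> S) G" using subgroup_Int[OF As S] .
  note fins = finite_subgroup[OF fin]
  note pos = card_subgroup_pos[OF fin]
  obtain t where t: "card A = card (A \<inter> S) * t"
    using card_subgroup_dvd[OF B As _ fins[OF As]] by auto
  have "t = 1"
  proof (rule ccontr)
    assume "t \<noteq> 1"
    then obtain q where q: "prime q" "q dvd t" using prime_factor_nat by blast
    show False
    proof (cases "q = p")
      case True
      have AS: "subgroup (A <#> S) G" using subgroup_normal_mult[OF A S] .
      have "card (A <#> S) * card (A \<inter> S) = card A * card S"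
        using card_set_mult[OF As fins[OF As] S fins[OF S]] .
      then have "card (A <#> S) = t * card S" using t pos[OF B] by simp
      moreover have "card (A <#> S) dvd order G"
        using card_subgroup_dvd[OF AS subgroup_self subgroup.subset[OF AS] fin] by (simp add: order_def)
      ultimately have "t * card S dvd order G" by simp
      then have "t dvd order G div card S" by (rule dvd_mult_imp_div)
      then show False using ind q True by (meson dvd_trans)
    next
      case False
      interpret AG: group "G\<lparr>carrier := A\<rparr>" using subgroup.subgroup_is_group[OF As is_group] .
      have "card A \<noteq> 0" using pos[OF As] by simp
      then obtain m where m: "card A = q ^ multiplicity q (card A) * m"
        using multiplicity_decompose'[of "card A" q] q by (auto simp: prime_nat_iff)
      obtain Q where Q: "subgroup Q (G\<lparr>carrier := A\<rparr>)" "card Q = q ^ multiplicity q (card A)"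
        using sylow_thm[OF q(1) AG.is_group, of "multiplicity q (card A)" m] m fins[OF As]
        by (auto simp: order_def)
      have QG: "subgroup Q G" using incl_subgroup[OF As Q(1)] .
      have QA: "Q \<subseteq> A" using subgroup.subset[OF Q(1)] by simp
      have "Q \<subseteq> S"
      proof
        fix x assume x: "x \<in> Q"
        show "x \<in> S"
        proof (rule pow_mem_coprime[OF S])
          show "x \<in> carrier G" using x subgroup.mem_carrier[OF QG] by blast
          show "x [^] card Q \<in> S" using pow_card_subgroup[OF QG fins[OF QG] x] subgroup.one_closed[OF S] by simp
          show "x [^] (p ^ E) \<in> S" using pw x QA by blast
          show "coprime (card Q) (p ^ E)" unfolding Q(2) using q(1) p False by (simp add: primes_coprime)
        qed
      qed
      then have "card Q dvd card (A \<inter> S)" using QA by (intro card_subgroup_dvd[OF QG B] fins[OF B]) blast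
      then have "card Q * q dvd card A" unfolding t using q(2) by (rule mult_dvd_mono)
      then have "q ^ Suc (multiplicity q (card A)) dvd card A" unfolding Q(2) by (simp add: mult.commute)
      then show False using \<open>card A \<noteq> 0\<close> q(1)
        by (metis Suc_n_not_le_n multiplicity_geI not_prime_unit)
    qed
  qed
  then have "A \<inter> S = A" using t fins[OF As] by (metis card_subset_eq inf_le1 mult.right_neutral)
  then show ?thesis by blast
qed

text \<open>The commutators lie in a normal subgroup \<open>A\<close> of \<open>G\<close> whose elements have a \<open>p\<close>-power in every
  conjugate of \<open>H\<close>. As \<open>J \<inter> y H y\<^sup>-\<^sup>1\<close> contains a Sylow \<open>p\<close>-subgroup of \<open>J\<close>, it contains \<open>A \<inter> J\<close>,
  hence all commutators of \<open>J\<close>, and is normal in \<open>J\<close>.\<close>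

lemma coset_stabilizer_normal_if_commutators_centralize:
  assumes fin: "finite (carrier G)" and N: "N \<lhd> G" and H: "subgroup H G" and J: "subgroup J G"
    and G: "carrier G = N <#> H" and K: "N \<inter> H \<lhd> G\<lparr>carrier := N\<rparr>"
    and p: "prime p" and cN: "card N = p ^ e * card (N \<inter> H)"
    and ser: "centralizes_series G (derived_set G (carrier G))"
    and P: "subgroup P G" "P \<subseteq> J" "\<not> p dvd card J div card P"
    and y: "y \<in> carrier G" "P \<subseteq> coset_stabilizer G H y" and s: "s \<in> J \<inter> coset_stabilizer G H y" and x: "x \<in> J"
  shows "x \<otimes> s \<otimes> inv x \<in> coset_stabilizer G H y"
proof -
  let ?S = "coset_stabilizer G H y"
  obtain A E where A: "A \<lhd> G" "derived_set G (carrier G) \<subseteq> A" "\<forall>c\<in>A. c [^] (p ^ E) \<in> H"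
    using commutators_have_prime_power_torsion_mod_stabilizer[OF fin N H G K cN ser] by (elim exE conjE) (rule that)
  have S: "subgroup ?S G" using subgroup_coset_stabilizer[OF H y(1)] .
  note fins = finite_subgroup[OF fin]
  have JS: "subgroup (J \<inter> ?S) G" using subgroup_Int[OF J S] .
  interpret JG: group "G\<lparr>carrier := J\<rparr>" using subgroup.subgroup_is_group[OF J is_group] .
  have "A \<inter> J \<subseteq> J \<inter> ?S"
  proof (rule JG.normal_prime_power_torsion_subset[OF _ p])
    show "finite (carrier (G\<lparr>carrier := J\<rparr>))" using fins[OF J] by simp
    show "A \<inter> J \<lhd> G\<lparr>carrier := J\<rparr>" using normal_Int_subgroup[OF J A(1)] .
    show "subgroup (J \<inter> ?S) (G\<lparr>carrier := J\<rparr>)" using subgroup_incl[OF JS J] by simp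
    show "c [^]\<^bsub>G\<lparr>carrier := J\<rparr>\<^esub> (p ^ E) \<in> J \<inter> ?S" if c: "c \<in> A \<inter> J" for c
    proof -
      have cG: "c \<in> carrier G" using c subgroup.mem_carrier[OF J] by blast
      have "inv y \<otimes> c \<otimes> y \<in> A" using normal_conj(2)[OF A(1) y(1)] c by blast
      then have "inv y \<otimes> c [^] (p ^ E) \<otimes> y \<in> H" using A(3) pow_conj[OF y(1) cG] by metis
      then have "c [^] (p ^ E) \<in> ?S" using cG by (simp add: coset_stabilizer_def)
      moreover have "c [^] (p ^ E) \<in> J" using c subgroup_int_pow_closed[OF J] by (metis Int_iff int_pow_int)
      ultimately show ?thesis using nat_pow_consistent[of c _ J] by simp
    qed
    have "card P dvd card (J \<inter> ?S)" "card (J \<inter> ?S) dvd card J"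
      using card_subgroup_dvd[OF P(1) JS _ fins[OF JS]] card_subgroup_dvd[OF JS J _ fins[OF J]] P(2) y(2) by auto
    then obtain a b where ab: "card (J \<inter> ?S) = card P * a" "card J = card (J \<inter> ?S) * b" by (meson dvdE)
    have "card J div card P = a * b" using ab card_subgroup_pos[OF fin P(1)] by simp
    moreover have "card J div card (J \<inter> ?S) = b" using ab(2) card_subgroup_pos[OF fin JS]
      by (metis nonzero_mult_div_cancel_left not_less_zero)
    ultimately show "\<not> p dvd order (G\<lparr>carrier := J\<rparr>) div card (J \<inter> ?S)"
      using P(3) by (simp add: order_def) (metis dvd_mult)
  qed
  moreover have xs: "x \<in> carrier G" "s \<in> carrier G" "s \<in> J" using x s subgroup.mem_carrier[OF J] by auto
  then have "x \<otimes> s \<otimes> inv x \<otimes> inv s \<in> A" using A(2) by blast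
  moreover have "x \<otimes> s \<otimes> inv x \<otimes> inv s \<in> J"
    using x xs(3) subgroup.m_closed[OF J] subgroup.m_inv_closed[OF J] by blast
  ultimately have "x \<otimes> s \<otimes> inv x \<otimes> inv s \<in> ?S" by blast
  then have "x \<otimes> s \<otimes> inv x \<otimes> inv s \<otimes> s \<in> ?S" using s subgroup.m_closed[OF S] by blast
  then show ?thesis using xs by (simp add: m_assoc)
qed

lemma normal_product_properties:
  assumes A: "A \<lhd> G" and H: "subgroup H G" and S: "S = A <#> H"
  shows "subgroup S G" "H \<subseteq> S" "A \<subseteq> S"
proof -
  show "subgroup S G" unfolding S by (rule subgroup_normal_mult[OF A H])
  have "\<one> \<in> A" "\<one> \<in> H" using subgroup.one_closed[OF normal_imp_subgroup[OF A]] subgroup.one_closed[OF H] .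
  moreover have "\<one> \<otimes> x = x" if "x \<in> H" for x using that subgroup.mem_carrier[OF H] by simp
  moreover have "x \<otimes> \<one> = x" if "x \<in> A" for x using that subgroup.mem_carrier[OF normal_imp_subgroup[OF A]] by simp
  ultimately show "H \<subseteq> S" "A \<subseteq> S" unfolding S set_mult_def by force+
qed

section \<open>Fixed cosets in finite groups\<close>

lemma normal_mult_normal_subgroup:
  assumes N: "subgroup N G" and A: "A \<lhd> G\<lparr>carrier := N\<rparr>" and B: "B \<lhd> G\<lparr>carrier := N\<rparr>"
  shows "A <#> B \<lhd> G\<lparr>carrier := N\<rparr>"
  using group.normal_mult_normal[OF subgroup.subgroup_is_group[OF N is_group] A B] by simp

lemma hall_normal_in_group:
  assumes fin: "finite (carrier G)" and N: "N \<lhd> G" and A: "A \<lhd> G\<lparr>carrier := N\<rparr>"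
    and c: "coprime (card A) (card N div card A)"
  shows "A \<lhd> G" "A = {x \<in> N. x [^] card A = \<one>}"
proof -
  have Ns: "subgroup N G" using N normal_imp_subgroup by blast
  interpret NG: group "G\<lparr>carrier := N\<rparr>" using subgroup.subgroup_is_group[OF Ns is_group] .
  have "A = {x \<in> carrier (G\<lparr>carrier := N\<rparr>). x [^]\<^bsub>G\<lparr>carrier := N\<rparr>\<^esub> card A = \<one>\<^bsub>G\<lparr>carrier := N\<rparr>\<^esub>}"
    by (rule NG.hall_normal_eq) (use A c finite_subgroup[OF fin Ns] in \<open>simp_all add: order_def\<close>)
  then show eq: "A = {x \<in> N. x [^] card A = \<one>}"
    using nat_pow_consistent[of _ "card A" N] by simp
  have sub: "subgroup A G" using incl_subgroup[OF Ns normal_imp_subgroup[OF A]] .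
  have "g \<otimes> x \<otimes> inv g \<in> A" if g: "g \<in> carrier G" and x: "x \<in> A" for g x
  proof -
    have xN: "x \<in> N" "x [^] card A = \<one>" using x eq by blast+
    have "(inv (inv g) \<otimes> x \<otimes> inv g) [^] card A = inv (inv g) \<otimes> x [^] card A \<otimes> inv g"
      using g xN(1) subgroup.mem_carrier[OF Ns] by (intro pow_conj) auto
    then have "(g \<otimes> x \<otimes> inv g) [^] card A = \<one>" using g xN by simp
    then show ?thesis using eq normal_conj(1)[OF N g xN(1)] by blast
  qed
  then show "A \<lhd> G" using sub normal_inv_iff by blast
qed

lemma coset_stabilizer_mono: "H \<subseteq> S \<Longrightarrow> coset_stabilizer G H g \<subseteq> coset_stabilizer G S g"
  unfolding coset_stabilizer_def by blast

text \<open>Enlarging \<open>H\<close> to \<open>A H\<close> for some \<open>A\<close> inside \<open>N\<close> keeps all hypotheses on \<open>H\<close>. This serves both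
  the induction in the finite case and the approximation of a closed \<open>H\<close> by open subgroups.\<close>

lemma enlarge_by_normal:
  assumes N: "N \<lhd> G" and H: "subgroup H G" and G: "carrier G = N <#> H"
    and K: "N \<inter> H \<lhd> G\<lparr>carrier := N\<rparr>" and A: "A \<lhd> G" "A \<subseteq> N"
  shows "subgroup (A <#> H) G" "carrier G = N <#> (A <#> H)" "N \<inter> (A <#> H) = A <#> (N \<inter> H)"
    "N \<inter> (A <#> H) \<lhd> G\<lparr>carrier := N\<rparr>"
proof -
  have Ns: "subgroup N G" using N normal_imp_subgroup by blast
  note S = normal_product_properties[OF A(1) H refl]
  show "subgroup (A <#> H) G" by (rule S(1))
  have "N <#> H \<subseteq> N <#> (A <#> H)" using S(2) by (rule mono_set_mult[OF subset_refl])
  then show "carrier G = N <#> (A <#> H)"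
    using G set_mult_closed[OF subgroup.subset[OF Ns] subgroup.subset[OF S(1)]] by blast
  show eq: "N \<inter> (A <#> H) = A <#> (N \<inter> H)"
  proof (intro equalityI subsetI)
    fix x assume x: "x \<in> N \<inter> (A <#> H)"
    then obtain a h where ah: "a \<in> A" "h \<in> H" "x = a \<otimes> h" unfolding set_mult_def by auto
    have c: "a \<in> carrier G" "h \<in> carrier G" "a \<in> N"
      using ah A subgroup.mem_carrier[OF Ns] subgroup.mem_carrier[OF H] by auto
    have "inv a \<otimes> x \<in> N" using x c(3) subgroup.m_closed[OF Ns] subgroup.m_inv_closed[OF Ns] by blast
    then have "h \<in> N" unfolding ah(3) using c by (simp add: inv_cancel_left)
    then show "x \<in> A <#> (N \<inter> H)" using ah unfolding set_mult_def by blast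
  next
    fix x assume "x \<in> A <#> (N \<inter> H)"
    then show "x \<in> N \<inter> (A <#> H)" using A(2) subgroup.m_closed[OF Ns] unfolding set_mult_def by blast
  qed
  have "A \<lhd> G\<lparr>carrier := N\<rparr>" using normal_restrict_supergroup[OF Ns A] .
  then show "N \<inter> (A <#> H) \<lhd> G\<lparr>carrier := N\<rparr>"
    unfolding eq by (rule normal_mult_normal_subgroup[OF Ns _ K])
qed

text \<open>The commutator of \<open>a\<close> and \<open>b\<close> lies in \<open>A\<close> and in \<open>B\<close>.\<close>

lemma normal_disjoint_commute:
  assumes A: "A \<lhd> G" and B: "B \<lhd> G" and AB: "A \<inter> B = {\<one>}" and a: "a \<in> A" and b: "b \<in> B"
  shows "a \<otimes> b = b \<otimes> a"
proof -
  have As: "subgroup A G" "subgroup B G" using A B normal_imp_subgroup by blast+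
  have c: "a \<in> carrier G" "b \<in> carrier G" using a b subgroup.mem_carrier As by metis+
  have "a \<otimes> (b \<otimes> inv a \<otimes> inv b) \<in> A"
    using normal_conj(1)[OF A c(2)] a subgroup.m_closed[OF As(1)] subgroup.m_inv_closed[OF As(1)] by blast
  moreover have "(a \<otimes> b \<otimes> inv a) \<otimes> inv b \<in> B"
    using normal_conj(1)[OF B c(1)] b subgroup.m_closed[OF As(2)] subgroup.m_inv_closed[OF As(2)] by blast
  moreover have "(a \<otimes> b \<otimes> inv a) \<otimes> inv b = a \<otimes> (b \<otimes> inv a \<otimes> inv b)" using c by (simp add: m_assoc)
  ultimately have "(a \<otimes> b \<otimes> inv a) \<otimes> inv b = \<one>" using AB by (metis IntI singletonD)
  then have "(a \<otimes> b \<otimes> inv a) \<otimes> inv b \<otimes> b \<otimes> a = b \<otimes> a" using c by simp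
  then show ?thesis using c by (simp add: m_assoc)
qed

text \<open>The elements \<open>g\<close> and \<open>g'\<close> matter only modulo \<open>A H\<close> and \<open>B H\<close>. So one can take \<open>g = b\<close> in \<open>B\<close>
  and \<open>g' = a'\<close> in \<open>A\<close>, and then replace both of them by \<open>b a' = a' b\<close>.\<close>

lemma combine_coset_stabilizers:
  assumes N: "N \<lhd> G" and H: "subgroup H G" and G: "carrier G = N <#> H"
    and A: "A \<lhd> G" and B: "B \<lhd> G" and AB: "N = A <#> B" "A \<inter> B = {\<one>}"
    and S: "S = A <#> H" and R: "R = B <#> H" and SR: "S \<inter> R = H"
    and g: "g \<in> carrier G" "J \<subseteq> coset_stabilizer G S g"
    and g': "g' \<in> carrier G" "J \<subseteq> coset_stabilizer G R g'"
  shows "\<exists>g\<in>carrier G. J \<subseteq> coset_stabilizer G H g"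
proof -
  have As: "subgroup A G" "subgroup B G" using A B normal_imp_subgroup by blast+
  note Ss = normal_product_properties[OF A H S] and Rs = normal_product_properties[OF B H R]
  have NBA: "N = B <#> A" using AB(1) commut_normal[OF As(1) B] by simp
  note commute = normal_disjoint_commute[OF A B AB(2)]
  obtain n h where n: "n \<in> N" "h \<in> H" "g = n \<otimes> h" using g(1) G unfolding set_mult_def by auto
  obtain b a where b: "b \<in> B" "a \<in> A" "n = b \<otimes> a" using n(1) NBA unfolding set_mult_def by auto
  obtain n' h' where n': "n' \<in> N" "h' \<in> H" "g' = n' \<otimes> h'" using g'(1) G unfolding set_mult_def by auto
  obtain a' b' where a': "a' \<in> A" "b' \<in> B" "n' = a' \<otimes> b'" using n'(1) AB(1) unfolding set_mult_def by auto
  have c: "b \<in> carrier G" "a \<in> carrier G" "h \<in> carrier G" "a' \<in> carrier G" "b' \<in> carrier G" "h' \<in> carrier G"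
    using b a' n n' subgroup.mem_carrier[OF As(1)] subgroup.mem_carrier[OF As(2)] subgroup.mem_carrier[OF H] by auto
  have "coset_stabilizer G S g = coset_stabilizer G S (b \<otimes> (a \<otimes> h))"
    unfolding n(3) b(3) using c by (simp add: m_assoc)
  also have "\<dots> = coset_stabilizer G S b"
    using coset_stabilizer_mult_right[OF Ss(1) c(1)] b(2) n(2) Ss(2,3) subgroup.m_closed[OF Ss(1)] by blast
  also have "\<dots> = coset_stabilizer G S (b \<otimes> a')"
    using coset_stabilizer_mult_right[OF Ss(1) c(1)] a'(1) Ss(3) by blast
  finally have 1: "J \<subseteq> coset_stabilizer G S (b \<otimes> a')" using g(2) by simp
  have "coset_stabilizer G R g' = coset_stabilizer G R (a' \<otimes> (b' \<otimes> h'))"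
    unfolding n'(3) a'(3) using c by (simp add: m_assoc)
  also have "\<dots> = coset_stabilizer G R a'"
    using coset_stabilizer_mult_right[OF Rs(1) c(4)] a'(2) n'(2) Rs(2,3) subgroup.m_closed[OF Rs(1)] by blast
  also have "\<dots> = coset_stabilizer G R (a' \<otimes> b)"
    using coset_stabilizer_mult_right[OF Rs(1) c(4)] b(1) Rs(3) by blast
  finally have 2: "J \<subseteq> coset_stabilizer G R (b \<otimes> a')" using g'(2) commute[OF a'(1) b(1)] by simp
  have "J \<subseteq> coset_stabilizer G H (b \<otimes> a')"
    using 1 2 SR unfolding coset_stabilizer_def by blast
  then show ?thesis using c by blast
qed

lemma subgroup_normalizer_grows:
  assumes J: "subgroup J G" and S: "subgroup S G" and ser: "centralizes_series (G\<lparr>carrier := J\<rparr>) J"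
    and n: "\<not> J \<subseteq> S"
  shows "\<exists>x \<in> J - S. \<forall>s \<in> J \<inter> S. x \<otimes> s \<otimes> inv x \<in> S"
proof -
  interpret JG: group "G\<lparr>carrier := J\<rparr>" using subgroup.subgroup_is_group[OF J is_group] .
  have "subgroup (J \<inter> S) (G\<lparr>carrier := J\<rparr>)" using subgroup_incl[OF subgroup_Int[OF J S] J] by simp
  then obtain x where "x \<in> J - J \<inter> S" "\<forall>s\<in>J \<inter> S. x \<otimes> s \<otimes> inv\<^bsub>G\<lparr>carrier := J\<rparr>\<^esub> x \<in> J \<inter> S"
    using JG.normalizers_grow[of "J \<inter> S"] ser n by auto
  then show ?thesis using m_inv_consistent[OF J] by auto
qed

text \<open>Induction on the index of \<open>H\<close>. If \<open>N\<close> is not contained in \<open>H\<close>, pick a prime \<open>p\<close> dividing the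
  index \<open>t\<close> of \<open>N \<inter> H\<close> in \<open>N\<close> and split \<open>N\<close> into its Sylow \<open>p\<close>-subgroup \<open>A\<close> and the normal
  \<open>p\<close>-complement \<open>B\<close>. The choice of \<open>p\<close> excludes \<open>A \<subseteq> H\<close>. If \<open>B \<subseteq> H\<close>, then \<open>t\<close> is a power of \<open>p\<close>;
  otherwise both \<open>A H\<close> and \<open>B H\<close> are larger than \<open>H\<close>.\<close>

theorem finite_fixed_coset:
  assumes fin: "finite (carrier G)" and N: "N \<lhd> G" and J: "subgroup J G"
    and nilN: "centralizes_series (G\<lparr>carrier := N\<rparr>) N"
    and ser: "centralizes_series G (derived_set G (carrier G)) \<or> centralizes_series (G\<lparr>carrier := J\<rparr>) J"
  shows "\<lbrakk>subgroup H G; carrier G = N <#> H; N \<inter> H \<lhd> G\<lparr>carrier := N\<rparr>;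
    \<And>p. prime p \<Longrightarrow> \<exists>P g. subgroup P G \<and> P \<subseteq> J \<and> \<not> p dvd card J div card P \<and>
      g \<in> carrier G \<and> P \<subseteq> coset_stabilizer G H g\<rbrakk>
    \<Longrightarrow> \<exists>g\<in>carrier G. J \<subseteq> coset_stabilizer G H g"
proof (induction "card (carrier G) - card H" arbitrary: H rule: less_induct)
  case less
  note H = less.prems(1) and G = less.prems(2) and K = less.prems(3) and syl = less.prems(4)
  have Ns: "subgroup N G" using N normal_imp_subgroup by blast
  have Ks: "subgroup (N \<inter> H) G" using subgroup_Int[OF Ns H] .
  interpret NG: group "G\<lparr>carrier := N\<rparr>" using subgroup.subgroup_is_group[OF Ns is_group] .
  note fins = finite_subgroup[OF fin] and pos = card_subgroup_pos[OF fin]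
  obtain t where t: "card N = card (N \<inter> H) * t"
    using card_subgroup_dvd[OF Ks Ns _ fins[OF Ns]] by auto
  show ?case
  proof (cases "t = 1")
    case True
    then have "N \<inter> H = N" using t fins[OF Ns] by (metis card_subset_eq inf_le1 mult.right_neutral)
    then have "N <#> H \<subseteq> H" using subgroup.m_closed[OF H] unfolding set_mult_def by blast
    then have "J \<subseteq> coset_stabilizer G H \<one>"
      using G subgroup.mem_carrier[OF J] by (auto simp: coset_stabilizer_def)
    then show ?thesis by blast
  next
    case False
    then obtain p where p: "prime p" "p dvd t" using prime_factor_nat by blast
    obtain A B where A: "A \<lhd> G\<lparr>carrier := N\<rparr>" and B: "B \<lhd> G\<lparr>carrier := N\<rparr>"
      and cA: "card A = p ^ multiplicity p (card N)" and cB: "\<not> p dvd card B" and cAB: "card A * card B = card N"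
      using NG.nilpotent_split[OF _ _ p(1)] nilN fins[OF Ns] by (auto simp: order_def)
    have N0: "card N > 0" using pos[OF Ns] .
    have co: "coprime (card A) (card B)" unfolding cA using p(1) cB by (simp add: prime_imp_coprime)
    have d: "card N div card A = card B" "card N div card B = card A" using cAB N0
      by (metis nonzero_mult_div_cancel_left mult_is_0 not_less_zero, metis nonzero_mult_div_cancel_right mult_is_0 not_less_zero)
    have AG: "A \<lhd> G" and A_eq: "A = {x \<in> N. x [^] card A = \<one>}"
      using hall_normal_in_group[OF fin N A] co d(1) by simp_all
    have BG: "B \<lhd> G" and B_eq: "B = {x \<in> N. x [^] card B = \<one>}"
      using hall_normal_in_group[OF fin N B] co d(2) by (simp_all add: coprime_commute)
    have As: "subgroup A G" and Bs: "subgroup B G" using AG BG normal_imp_subgroup by blast+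
    have AN: "A \<subseteq> N" and BN: "B \<subseteq> N" using A_eq B_eq by blast+
    have pw: "x [^] card A = \<one>" if "x \<in> A" for x using that A_eq by blast
    have pwB: "x [^] card B = \<one>" if "x \<in> B" for x using that B_eq by blast
    have AB1: "A \<inter> B = {\<one>}"
    proof -
      have "x \<in> {\<one>}" if x: "x \<in> A \<inter> B" for x
        by (rule pow_mem_coprime[OF normal_imp_subgroup[OF one_is_normal] _ _ _ co])
          (use x pw pwB subgroup.mem_carrier[OF As] in auto)
      then show ?thesis using subgroup.one_closed[OF As] subgroup.one_closed[OF Bs] by blast
    qed
    have ABN: "N = A <#> B"
    proof -
      have "card (A <#> B) = card N"
        using card_set_mult[OF As fins[OF As] Bs fins[OF Bs]] cAB AB1 by simp
      moreover have "A <#> B \<subseteq> N" using AN BN subgroup.m_closed[OF Ns] unfolding set_mult_def by blast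
      ultimately show ?thesis using card_subset_eq[OF fins[OF Ns]] by blast
    qed
    show ?thesis
    proof (cases "B \<subseteq> H")
      case True
      then have "card B dvd card (N \<inter> H)" using BN by (intro card_subgroup_dvd[OF Bs Ks _ fins[OF Ks]]) blast
      then obtain s where "card (N \<inter> H) = card B * s" by blast
      then have "card A = s * t" using t cAB pos[OF Bs] by (simp add: mult.commute mult.left_commute)
      then have "t dvd p ^ multiplicity p (card N)" using cA by simp
      then obtain e where e: "t = p ^ e" using p(1) by (metis divides_primepow_nat)
      have cN: "card N = p ^ e * card (N \<inter> H)" using t e by (simp add: mult.commute)
      obtain P g where P: "subgroup P G" "P \<subseteq> J" "\<not> p dvd card J div card P"
        and g: "g \<in> carrier G" "P \<subseteq> coset_stabilizer G H g" using syl[OF p(1)] by blast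
      show ?thesis
      proof (rule fixed_coset_prime_power_case[OF fin N H J G K p(1) cN P g])
        fix y assume y: "y \<in> carrier G" "P \<subseteq> coset_stabilizer G H y" and n: "\<not> J \<subseteq> coset_stabilizer G H y"
        from ser show "\<exists>x\<in>J - coset_stabilizer G H y. \<forall>s\<in>J \<inter> coset_stabilizer G H y.
            x \<otimes> s \<otimes> inv x \<in> coset_stabilizer G H y"
        proof
          assume "centralizes_series G (derived_set G (carrier G))"
          note gr = coset_stabilizer_normal_if_commutators_centralize[OF fin N H J G K p(1) cN this P y]
          obtain x where "x \<in> J - coset_stabilizer G H y" using n by blast
          then show ?thesis using gr by blast
        next
          assume "centralizes_series (G\<lparr>carrier := J\<rparr>) J"
          then show ?thesis using subgroup_normalizer_grows[OF J subgroup_coset_stabilizer[OF H y(1)]] n by blast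
        qed
      qed
    next
      case False
      have nA: "\<not> A \<subseteq> H"
      proof
        assume "A \<subseteq> H"
        then have "card A dvd card (N \<inter> H)" using AN by (intro card_subgroup_dvd[OF As Ks _ fins[OF Ks]]) blast
        then have "card A * p dvd card A * card B" unfolding cAB t using p(2) by (rule mult_dvd_mono)
        then show False using cB pos[OF As] by simp
      qed
      have IH: "\<exists>g\<in>carrier G. J \<subseteq> coset_stabilizer G (C <#> H) g"
        if C: "C \<lhd> G" "C \<subseteq> N" "\<not> C \<subseteq> H" for C
      proof (rule less.hyps)
        note E = enlarge_by_normal[OF N H G K C(1,2)] and S = normal_product_properties[OF C(1) H refl]
        show "subgroup (C <#> H) G" "carrier G = N <#> (C <#> H)" "N \<inter> (C <#> H) \<lhd> G\<lparr>carrier := N\<rparr>"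
          using E by blast+
        have "H \<subset> C <#> H" using S C(3) by blast
        then have "card H < card (C <#> H)" using fins[OF S(1)] by (rule psubset_card_mono[rotated])
        moreover have "card (C <#> H) \<le> card (carrier G)" using card_mono[OF fin subgroup.subset[OF S(1)]] .
        ultimately show "card (carrier G) - card (C <#> H) < card (carrier G) - card H" by linarith
        show "\<exists>P g. subgroup P G \<and> P \<subseteq> J \<and> \<not> p dvd card J div card P \<and>
            g \<in> carrier G \<and> P \<subseteq> coset_stabilizer G (C <#> H) g" if "prime p" for p
          using syl[OF that] coset_stabilizer_mono[OF S(2)] by blast
      qed
      obtain g where g: "g \<in> carrier G" "J \<subseteq> coset_stabilizer G (A <#> H) g" using IH[OF AG AN nA] by blast
      obtain g' where g': "g' \<in> carrier G" "J \<subseteq> coset_stabilizer G (B <#> H) g'" using IH[OF BG BN False] by blast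
      have "(A <#> H) \<inter> (B <#> H) \<subseteq> H"
      proof
        fix x assume x0: "x \<in> (A <#> H) \<inter> (B <#> H)"
        obtain a h where 1: "x = a \<otimes> h" "a \<in> A" "h \<in> H" using x0 unfolding set_mult_def by blast
        obtain b h' where 2: "x = b \<otimes> h'" "b \<in> B" "h' \<in> H" using x0 unfolding set_mult_def by blast
        note x = 1(1) 2(1) and ab = 1(2) 2(2) 1(3) 2(3)
        have c: "a \<in> carrier G" "b \<in> carrier G" "h \<in> carrier G" "h' \<in> carrier G"
          using ab subgroup.mem_carrier[OF As] subgroup.mem_carrier[OF Bs] subgroup.mem_carrier[OF H] by auto
        have eq: "a \<otimes> h = b \<otimes> h'" using x by simp
        have "inv b \<otimes> a = inv b \<otimes> (a \<otimes> h) \<otimes> inv h" using c by (simp add: m_assoc)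
        also have "\<dots> = h' \<otimes> inv h" unfolding eq using c by (simp add: m_assoc inv_cancel_left)
        finally have e1: "inv b \<otimes> a = h' \<otimes> inv h" .
        have kH: "inv b \<otimes> a \<in> H" unfolding e1 using ab subgroup.m_closed[OF H] subgroup.m_inv_closed[OF H] by blast
        have kN: "inv b \<otimes> a \<in> N" using ab AN BN subgroup.m_closed[OF Ns] subgroup.m_inv_closed[OF Ns] by blast
        have "a \<in> N \<inter> H"
        proof (rule pow_mem_coprime[OF Ks c(1) _ _ co])
          show "a [^] card A \<in> N \<inter> H" using pw ab(1) subgroup.one_closed[OF Ks] by simp
          \<comment> \<open>\<open>A\<close> and \<open>B\<close> commute, so the \<open>card B\<close>-th power of the element \<open>inv b \<otimes> a\<close> of \<open>H\<close> is that of \<open>a\<close>.\<close>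
          have com: "inv b \<otimes> a = a \<otimes> inv b"
            using normal_disjoint_commute[OF AG BG AB1 ab(1) subgroup.m_inv_closed[OF Bs ab(2)]] by simp
          have "(inv b \<otimes> a) [^] card B = inv b [^] card B \<otimes> a [^] card B"
            using pow_mult_distrib[OF com] c by simp
          moreover have "inv b [^] card B = \<one>" using pwB ab(2) subgroup.m_inv_closed[OF Bs] by blast
          ultimately have "a [^] card B = (inv b \<otimes> a) [^] card B" using c by simp
          moreover have "(inv b \<otimes> a) [^] card B \<in> N \<inter> H"
            using kH kN subgroup_int_pow_closed[OF Ks] by (metis IntI int_pow_int)
          ultimately show "a [^] card B \<in> N \<inter> H" by simp
        qed
        then show "x \<in> H" using x(1) ab(3) subgroup.m_closed[OF H] by blast
      qed
      then have "(A <#> H) \<inter> (B <#> H) = H"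
        using normal_product_properties(2)[OF AG H refl] normal_product_properties(2)[OF BG H refl] by blast
      from combine_coset_stabilizers[OF N H G AG BG ABN AB1 refl refl this g g'] show ?thesis .
    qed
  qed
qed

lemma coset_stabilizer_eq_image:
  assumes "subgroup H G" "g \<in> carrier G"
  shows "coset_stabilizer G H g = (\<lambda>x. g \<otimes> x \<otimes> inv g) ` H"
proof (intro equalityI subsetI)
  fix x assume x: "x \<in> coset_stabilizer G H g"
  then have "x = g \<otimes> (inv g \<otimes> x \<otimes> g) \<otimes> inv g"
    using assms(2) by (simp add: coset_stabilizer_def group_word)
  then show "x \<in> (\<lambda>x. g \<otimes> x \<otimes> inv g) ` H" using x by (auto simp: coset_stabilizer_def)
next
  fix x assume "x \<in> (\<lambda>x. g \<otimes> x \<otimes> inv g) ` H"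
  then obtain h where h: "h \<in> H" "x = g \<otimes> h \<otimes> inv g" by blast
  have hG: "h \<in> carrier G" using h subgroup.mem_carrier[OF assms(1)] by blast
  have "inv g \<otimes> x \<otimes> g = h" unfolding h(2) using hG assms(2) by (simp add: group_word)
  then show "x \<in> coset_stabilizer G H g" using h hG assms(2) by (simp add: coset_stabilizer_def)
qed

text \<open>Since \<open>G = J L\<close>, each of the given conjugates can be taken by an element of \<open>J\<close>. So for
  every \<open>p\<close> a conjugate of \<open>P\<close> lies in \<open>J \<inter> L\<close>, and the index of \<open>J \<inter> L\<close> in \<open>J\<close> is prime to every
  \<open>p\<close>.\<close>

lemma product_of_sylows_covers:
  assumes fin: "finite (carrier G)" and L: "subgroup L G" and J: "subgroup J G" and G: "carrier G = L <#> J"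
    and syl: "\<And>p. prime p \<Longrightarrow> \<exists>P g. subgroup P G \<and> P \<subseteq> J \<and> \<not> p dvd card J div card P \<and>
      g \<in> carrier G \<and> P \<subseteq> coset_stabilizer G L g"
  shows "L = carrier G"
proof -
  note fins = finite_subgroup[OF fin] and pos = card_subgroup_pos[OF fin]
  have JL: "subgroup (J \<inter> L) G" using subgroup_Int[OF J L] .
  obtain t where t: "card J = card (J \<inter> L) * t" using card_subgroup_dvd[OF JL J _ fins[OF J]] by auto
  have "\<not> p dvd t" if p: "prime p" for p
  proof -
    obtain P g where P: "subgroup P G" "P \<subseteq> J" "\<not> p dvd card J div card P"
      and g: "g \<in> carrier G" "P \<subseteq> coset_stabilizer G L g" using syl[OF p] by blast
    have "inv g \<in> L <#> J" using g(1) G by blast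
    then obtain l j where lj: "l \<in> L" "j \<in> J" "inv g = l \<otimes> j" unfolding set_mult_def by blast
    have c: "l \<in> carrier G" "j \<in> carrier G"
      using lj subgroup.mem_carrier[OF L] subgroup.mem_carrier[OF J] by auto
    have "g = inv (l \<otimes> j)" using lj(3) g(1) by (metis inv_inv)
    then have gj: "g = inv j \<otimes> inv l" using c by (simp add: inv_mult_group)
    have *: "P \<subseteq> coset_stabilizer G L (inv j)"
      using g(2) coset_stabilizer_mult_right[OF L inv_closed[OF c(2)] subgroup.m_inv_closed[OF L lj(1)]] gj by simp
    have PL: "j \<otimes> x \<otimes> inv j \<in> J \<inter> L" if "x \<in> P" for x
    proof
      show "j \<otimes> x \<otimes> inv j \<in> J"
        using that P(2) lj(2) subgroup.m_closed[OF J] subgroup.m_inv_closed[OF J] by blast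
      have "x \<in> coset_stabilizer G L (inv j)" using * that by blast
      then show "j \<otimes> x \<otimes> inv j \<in> L" using c(2) by (simp add: coset_stabilizer_def)
    qed
    let ?Q = "coset_stabilizer G P j"
    have Q: "subgroup ?Q G" using subgroup_coset_stabilizer[OF P(1) c(2)] .
    have Q_eq: "?Q = (\<lambda>x. j \<otimes> x \<otimes> inv j) ` P" using coset_stabilizer_eq_image[OF P(1) c(2)] .
    have "?Q \<subseteq> J \<inter> L" unfolding Q_eq by (rule image_subsetI) (rule PL)
    then have "card ?Q dvd card (J \<inter> L)" using card_subgroup_dvd[OF Q JL _ fins[OF JL]] by blast
    moreover have "card ?Q = card P"
      unfolding Q_eq using subgroup.mem_carrier[OF P(1)] c(2) by (intro card_image) (simp add: inj_on_def)
    ultimately obtain s where "card (J \<inter> L) = card P * s" by (metis dvdE)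
    then have "card J div card P = s * t" using t pos[OF P(1)] by simp
    then show ?thesis using P(3) by (metis dvd_mult)
  qed
  then have "t = 1" using prime_factor_nat by blast
  then have "J \<inter> L = J" using t fins[OF J] by (metis card_subset_eq inf_le1 mult.right_neutral)
  then have "L <#> J \<subseteq> L" using subgroup.m_closed[OF L] unfolding set_mult_def by blast
  then show ?thesis using G subgroup.subset[OF L] by blast
qed

end

section \<open>Finite quotients of inverse limits\<close>

text \<open>What the proof uses of an inverse limit presentation of \<open>G\<close>: the projections \<open>\<pi> i\<close>, without
  the transition maps. The axioms \<open>directed\<close> and \<open>basis\<close> say that the kernels form a directed
  system and a basis of neighbourhoods. The projections need not be surjective, so the finite
  quotients proper are the images \<open>\<pi> i ` carrier G\<close>.\<close>

locale finite_quotients = group G for G (structure) +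
  fixes T :: "'a topology" and I :: "'i set" and B :: "'i \<Rightarrow> 'c monoid" and \<pi> :: "'i \<Rightarrow> 'a \<Rightarrow> 'c"
  assumes topspace_eq: "topspace T = carrier G"
    and compact: "compact_space T"
    and nonempty: "I \<noteq> {}"
    and group_B: "i \<in> I \<Longrightarrow> group (B i)"
    and finite_B: "i \<in> I \<Longrightarrow> finite (carrier (B i))"
    and hom: "i \<in> I \<Longrightarrow> \<pi> i \<in> hom G (B i)"
    and directed: "\<lbrakk>i \<in> I; j \<in> I\<rbrakk> \<Longrightarrow> \<exists>k\<in>I. \<forall>x\<in>carrier G.
      \<pi> k x = \<one>\<^bsub>B k\<^esub> \<longrightarrow> \<pi> i x = \<one>\<^bsub>B i\<^esub> \<and> \<pi> j x = \<one>\<^bsub>B j\<^esub>"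
    and fibre_open: "i \<in> I \<Longrightarrow> openin T {x \<in> carrier G. \<pi> i x = a}"
    and basis: "\<lbrakk>openin T U; x \<in> U\<rbrakk> \<Longrightarrow> \<exists>i\<in>I. \<forall>y\<in>carrier G. \<pi> i y = \<pi> i x \<longrightarrow> y \<in> U"

lemma finite_directed_upper_bound:
  assumes dir: "\<And>i j. \<lbrakk>i \<in> I; j \<in> I\<rbrakk> \<Longrightarrow> \<exists>k\<in>I. (i, k) \<in> r \<and> (j, k) \<in> r" and "trans r" "I \<noteq> {}"
    and "finite F" "F \<subseteq> I"
  shows "\<exists>k\<in>I. \<forall>i\<in>F. (i, k) \<in> r"
  using assms(4,5)
proof (induction F)
  case empty
  then show ?case using assms(3) by blast
next
  case (insert i F)
  then obtain k where k: "k \<in> I" "\<forall>j\<in>F. (j, k) \<in> r" by blast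
  obtain l where "l \<in> I" "(i, l) \<in> r" "(k, l) \<in> r" using dir[of i k] k insert by blast
  then show ?case using k(2) transD[OF assms(2)] by blast
qed

text \<open>A point outside the limit violates one of the conditions \<open>f i j (x j) = x i\<close>, and so does
  every point with the same two coordinates.\<close>

lemma closedin_inverse_limit:
  assumes "r \<subseteq> I \<times> I"
  shows "closedin (product_topology (\<lambda>i. discrete_topology (carrier (H i))) I)
           (carrier (inverse_limit_group I r H f))"
proof -
  let ?P = "product_topology (\<lambda>i. discrete_topology (carrier (H i))) I"
  have top: "topspace ?P = (\<Pi>\<^sub>E i\<in>I. carrier (H i))" by simp
  have "openin ?P (topspace ?P - carrier (inverse_limit_group I r H f))"
  proof (subst openin_subopen, intro ballI)
    fix x assume "x \<in> topspace ?P - carrier (inverse_limit_group I r H f)"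
    then have x: "x \<in> topspace ?P" and "\<exists>i j. (i, j) \<in> r \<and> f i j (x j) \<noteq> x i"
      by (auto simp: inverse_limit_group_def)
    then obtain i j where ij: "(i, j) \<in> r" "f i j (x j) \<noteq> x i" by blast
    have I: "i \<in> I" "j \<in> I" using ij assms by auto
    have op: "openin ?P {y \<in> topspace ?P. y k \<in> {x k}}" if "k \<in> I" for k
      by (rule openin_continuous_map_preimage[OF continuous_map_product_projection[OF that]])
        (use x that in auto)
    let ?W = "{y \<in> topspace ?P. y i \<in> {x i}} \<inter> {y \<in> topspace ?P. y j \<in> {x j}}"
    have "openin ?P ?W" using op[OF I(1)] op[OF I(2)] by (rule openin_Int)
    moreover have "x \<in> ?W" using x by simp
    moreover have "?W \<subseteq> topspace ?P - carrier (inverse_limit_group I r H f)"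
      using ij by (auto simp: inverse_limit_group_def) (metis (no_types, lifting))
    ultimately show "\<exists>W. openin ?P W \<and> x \<in> W \<and> W \<subseteq> topspace ?P - carrier (inverse_limit_group I r H f)"
      by blast
  qed
  moreover have "carrier (inverse_limit_group I r H f) \<subseteq> topspace ?P"
    unfolding top by (auto simp: inverse_limit_group_def)
  ultimately show ?thesis by (simp add: closedin_def)
qed

lemma inverse_limit_mult:
  "x \<otimes>\<^bsub>inverse_limit_group I r H f\<^esub> y = (\<lambda>i\<in>I. x i \<otimes>\<^bsub>H i\<^esub> y i)"
  by (simp add: inverse_limit_group_def)

text \<open>Shrinking the finite groups of a system changes the topology of the limit only to the
  subspace topology; this is used to present closed subgroups.\<close>

lemma inverse_limit_topology_restrict:
  assumes "\<And>i. i \<in> I \<Longrightarrow> S i \<subseteq> carrier (H i)"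
  shows "inverse_limit_topology I r (\<lambda>i. (H i)\<lparr>carrier := S i\<rparr>) f =
    subtopology (inverse_limit_topology I r H f) (carrier (inverse_limit_group I r (\<lambda>i. (H i)\<lparr>carrier := S i\<rparr>) f))"
proof -
  let ?L = "carrier (inverse_limit_group I r H f)"
  let ?L' = "carrier (inverse_limit_group I r (\<lambda>i. (H i)\<lparr>carrier := S i\<rparr>) f)"
  let ?P = "product_topology (\<lambda>i. discrete_topology (carrier (H i))) I"
  have L': "?L' \<subseteq> Pi\<^sub>E I S" "?L' \<subseteq> ?L"
    using assms by (auto simp: inverse_limit_group_def PiE_iff extensional_def)
  have "product_topology (\<lambda>i. discrete_topology (S i)) I =
      product_topology (\<lambda>i. subtopology (discrete_topology (carrier (H i))) (S i)) I"
    by (rule topology_eq[THEN iffD2])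
      (use assms in \<open>simp add: openin_product_topology_alt inf_absorb2 cong: conj_cong\<close>)
  also have "\<dots> = subtopology ?P (Pi\<^sub>E I S)" by (simp add: subtopology_product_topology)
  finally show ?thesis
    using L' by (simp add: inverse_limit_topology_def subtopology_subtopology inf_absorb2)
qed

text \<open>The last conclusion is a criterion for closed subgroups \<open>Q\<close>: the images of \<open>Q\<close> under the
  projections form an inverse system with limit \<open>Q\<close>. That nothing but \<open>Q\<close> appears in the limit is
  where closedness is needed.\<close>

lemma pro_class_finite_quotients:
  fixes G :: "('a, 'm) monoid_scheme"
  assumes "pro_class C G T"
  obtains I :: "'a set set" and B :: "'a set \<Rightarrow> 'a set monoid" and \<pi> where
    "finite_quotients G T I B \<pi>" and "\<And>i. i \<in> I \<Longrightarrow> C (B i)"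
    and "\<forall>Q C'. subgroup Q G \<longrightarrow> closedin T Q \<longrightarrow> (\<forall>i\<in>I. C' ((B i)\<lparr>carrier := \<pi> i ` Q\<rparr>)) \<longrightarrow>
      pro_class C' (G\<lparr>carrier := Q\<rparr>) (subtopology T Q)"
proof -
  from assms have gG: "group G" and top: "topspace T = carrier G" unfolding pro_class_def by auto
  from assms obtain I :: "'a set set" and r and H :: "'a set \<Rightarrow> 'a set monoid" and f h where
    sys: "inverse_system I r H f" and C: "\<forall>i\<in>I. finite (carrier (H i)) \<and> C (H i)"
    and iso: "h \<in> iso G (inverse_limit_group I r H f)"
    and homeo: "homeomorphic_map T (inverse_limit_topology I r H f) h"
    unfolding pro_class_def by (elim exE conjE) (rule that)
  interpret group G by (rule gG)
  let ?L = "inverse_limit_group I r H f"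
  let ?LT = "inverse_limit_topology I r H f"
  let ?P = "product_topology (\<lambda>i. discrete_topology (carrier (H i))) I"
  have po: "partial_order_on I r" and ne: "I \<noteq> {}"
    and dir: "\<And>i j. \<lbrakk>i \<in> I; j \<in> I\<rbrakk> \<Longrightarrow> \<exists>k\<in>I. (i, k) \<in> r \<and> (j, k) \<in> r"
    and gH: "\<And>i. i \<in> I \<Longrightarrow> group (H i)"
    and fhom: "\<And>i j. (i, j) \<in> r \<Longrightarrow> f i j \<in> hom (H j) (H i)"
    and fid: "\<And>i x. \<lbrakk>i \<in> I; x \<in> carrier (H i)\<rbrakk> \<Longrightarrow> f i i x = x"
    and fcomp: "\<And>i j k x. \<lbrakk>(i, j) \<in> r; (j, k) \<in> r; x \<in> carrier (H k)\<rbrakk> \<Longrightarrow> f i j (f j k x) = f i k x"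
    using sys unfolding inverse_system_def by simp_all
  have rI: "r \<subseteq> I \<times> I" and tr: "trans r" using partial_order_onD[OF po] by auto
  define \<pi> where "\<pi> = (\<lambda>i x. h x i)"
  have bij: "bij_betw h (carrier G) (carrier ?L)" and hh: "h \<in> hom G ?L" using iso by (auto simp: iso_def)
  have hL: "h x \<in> carrier ?L" if "x \<in> carrier G" for x using bij that by (auto simp: bij_betw_def)
  have compat: "f i j (\<pi> j x) = \<pi> i x" if "(i, j) \<in> r" "x \<in> carrier G" for i j x
    using hL[OF that(2)] that(1) by (simp add: inverse_limit_group_def \<pi>_def)
  have \<pi>B: "\<pi> i x \<in> carrier (H i)" if "i \<in> I" "x \<in> carrier G" for i x
    using hL[OF that(2)] that(1) by (auto simp: inverse_limit_group_def \<pi>_def)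
  have \<pi>hom: "\<pi> i \<in> hom G (H i)" if "i \<in> I" for i
  proof (rule homI)
    show "\<pi> i (x \<otimes>\<^bsub>G\<^esub> y) = \<pi> i x \<otimes>\<^bsub>H i\<^esub> \<pi> i y" if "x \<in> carrier G" "y \<in> carrier G" for x y
      using hom_mult[OF hh that] \<open>i \<in> I\<close> by (simp add: inverse_limit_mult \<pi>_def)
  qed (use \<pi>B that in blast)
  have topP: "topspace ?P = (\<Pi>\<^sub>E i\<in>I. carrier (H i))" by simp
  have topLT: "topspace ?LT = carrier ?L"
    by (auto simp: inverse_limit_topology_def inverse_limit_group_def)
  have cLT: "continuous_map ?LT (discrete_topology (carrier (H i))) (\<lambda>x. x i)" if "i \<in> I" for i
    unfolding inverse_limit_topology_def
    by (rule continuous_map_from_subtopology[OF continuous_map_product_projection[OF that]])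
  have "compact_space ?P" using C by (simp add: compact_space_product_topology compact_space_discrete_topology)
  then have "compact_space ?LT" unfolding inverse_limit_topology_def
    by (intro compact_space_subtopology closedin_compact_space closedin_inverse_limit[OF rI])
  then have cT: "compact_space T"
    using homeomorphic_compact_space homeomorphic_map_imp_homeomorphic_space[OF homeo] by blast
  have basis: "\<exists>i\<in>I. \<forall>y\<in>carrier G. \<pi> i y = \<pi> i x \<longrightarrow> y \<in> U" if U: "openin T U" and x: "x \<in> U" for U x
  proof -
    have UG: "U \<subseteq> carrier G" using openin_subset[OF U] top by simp
    have "openin ?LT (h ` U)" using homeomorphic_imp_open_map[OF homeo] U by (simp add: open_map_def)
    then obtain W where W: "openin ?P W" "h ` U = W \<inter> carrier ?L"
      unfolding inverse_limit_topology_def by (auto simp: openin_subtopology)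
    have "h x \<in> W" using W(2) x by blast
    then obtain V where V: "finite {i \<in> I. V i \<noteq> topspace (discrete_topology (carrier (H i)))}"
      "h x \<in> Pi\<^sub>E I V" "Pi\<^sub>E I V \<subseteq> W"
      using bspec[OF W(1)[unfolded openin_product_topology_alt] \<open>h x \<in> W\<close>]
      by (elim exE conjE) (rule that)
    obtain k where k: "k \<in> I" "\<forall>i\<in>{i \<in> I. V i \<noteq> carrier (H i)}. (i, k) \<in> r"
      using finite_directed_upper_bound[OF dir tr ne, of "{i \<in> I. V i \<noteq> carrier (H i)}"] V(1) by auto
    have "y \<in> U" if y: "y \<in> carrier G" "\<pi> k y = \<pi> k x" for y
    proof -
      have "h y i \<in> V i" if i: "i \<in> I" for i
      proof (cases "V i = carrier (H i)")
        case True
        then show ?thesis using \<pi>B[OF i y(1)] by (simp add: \<pi>_def)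
      next
        case False
        then have "(i, k) \<in> r" using k(2) i by blast
        then have "\<pi> i y = \<pi> i x" using compat y x UG by (metis subsetD)
        then show ?thesis using V(2) i by (auto simp: \<pi>_def)
      qed
      moreover have "h y \<in> extensional I"
        using hL[OF y(1)] by (auto simp: inverse_limit_group_def PiE_iff)
      ultimately have "h y \<in> Pi\<^sub>E I V" by (simp add: PiE_iff)
      then have "h y \<in> h ` U" using V(3) W(2) hL[OF y(1)] by blast
      then show ?thesis using bij UG y(1) by (metis bij_betw_imp_inj_on inj_on_image_mem_iff)
    qed
    then show ?thesis using k(1) by blast
  qed
  have fq: "finite_quotients G T I H \<pi>"
  proof (intro finite_quotients.intro finite_quotients_axioms.intro)
    show "group G" by (rule gG)
    show "topspace T = carrier G" by (rule top)
    show "compact_space T" by (rule cT)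
    show "I \<noteq> {}" by (rule ne)
    show "group (H i)" if "i \<in> I" for i using gH that .
    show "finite (carrier (H i))" if "i \<in> I" for i using C that by blast
    show "\<pi> i \<in> hom G (H i)" if "i \<in> I" for i using \<pi>hom that .
    show "\<exists>k\<in>I. \<forall>x\<in>carrier G. \<pi> k x = \<one>\<^bsub>H k\<^esub> \<longrightarrow> \<pi> i x = \<one>\<^bsub>H i\<^esub> \<and> \<pi> j x = \<one>\<^bsub>H j\<^esub>"
      if ij: "i \<in> I" "j \<in> I" for i j
    proof -
      obtain k where k: "k \<in> I" "(i, k) \<in> r" "(j, k) \<in> r" using dir[OF ij] by blast
      have "f i k \<one>\<^bsub>H k\<^esub> = \<one>\<^bsub>H i\<^esub>" "f j k \<one>\<^bsub>H k\<^esub> = \<one>\<^bsub>H j\<^esub>"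
        using hom_one[OF fhom gH gH] k ij by blast+
      then show ?thesis using compat k by metis
    qed
    show "openin T {x \<in> carrier G. \<pi> i x = a}" if i: "i \<in> I" for i a
    proof -
      have "continuous_map T (discrete_topology (carrier (H i))) ((\<lambda>x. x i) \<circ> h)"
        using homeomorphic_imp_continuous_map[OF homeo] cLT[OF i] by (rule continuous_map_compose)
      then have "openin T {x \<in> topspace T. ((\<lambda>x. x i) \<circ> h) x \<in> {a} \<inter> carrier (H i)}"
        by (rule openin_continuous_map_preimage) simp
      moreover have "{x \<in> topspace T. ((\<lambda>x. x i) \<circ> h) x \<in> {a} \<inter> carrier (H i)} = {x \<in> carrier G. \<pi> i x = a}"
        using \<pi>B[OF i] top by (auto simp: \<pi>_def)
      ultimately show ?thesis by simp
    qed
    show "\<exists>i\<in>I. \<forall>y\<in>carrier G. \<pi> i y = \<pi> i x \<longrightarrow> y \<in> U" if "openin T U" "x \<in> U" for U x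
      using basis that .
  qed
  have sub: "pro_class C' (G\<lparr>carrier := Q\<rparr>) (subtopology T Q)"
    if Q: "subgroup Q G" and cl: "closedin T Q" and C': "\<forall>i\<in>I. C' ((H i)\<lparr>carrier := \<pi> i ` Q\<rparr>)" for Q C'
  proof -
    have QG: "Q \<subseteq> carrier G" using subgroup.subset[OF Q] .
    let ?H = "\<lambda>i. (H i)\<lparr>carrier := \<pi> i ` Q\<rparr>"
    let ?L' = "inverse_limit_group I r ?H f"
    have img: "\<pi> i ` Q \<subseteq> carrier (H i)" if "i \<in> I" for i using \<pi>B that QG by blast
    have gH': "group (?H i)" if i: "i \<in> I" for i
    proof -
      interpret h: group_hom G "H i" "\<pi> i"
        using gH[OF i] \<pi>hom[OF i] by (simp add: group_hom_def group_hom_axioms_def gG)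
      have "subgroup (\<pi> i ` Q) (H i)" using h.subgroup_img_is_subgroup[OF Q] .
      then show ?thesis using subgroup.subgroup_is_group gH[OF i] by blast
    qed
    have L': "carrier ?L' = h ` Q"
    proof (intro equalityI subsetI)
      fix z assume z: "z \<in> carrier ?L'"
      have "z i \<in> carrier (H i)" if "i \<in> I" for i
        by (rule subsetD[OF img[OF that]]) (use z that in \<open>simp add: inverse_limit_group_def PiE_iff\<close>)
      then have "z \<in> carrier ?L" using z by (simp add: inverse_limit_group_def PiE_iff)
      then obtain g where g: "g \<in> carrier G" "z = h g" using bij by (auto simp: bij_betw_def)
      have "g \<in> Q"
      proof (rule ccontr)
        assume "g \<notin> Q"
        moreover have "openin T (carrier G - Q)" using cl top by (metis openin_diff openin_topspace)
        ultimately obtain i where i: "i \<in> I" "\<forall>y\<in>carrier G. \<pi> i y = \<pi> i g \<longrightarrow> y \<in> carrier G - Q"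
          using basis[of "carrier G - Q" g] g(1) by blast
        have "\<pi> i g \<in> \<pi> i ` Q" using z g(2) i(1) by (auto simp: inverse_limit_group_def PiE_iff \<pi>_def)
        then show False using i(2) QG by (metis DiffD2 imageE subsetD)
      qed
      then show "z \<in> h ` Q" using g(2) by blast
    next
      fix z assume "z \<in> h ` Q"
      then obtain g where g: "g \<in> Q" "z = h g" by blast
      then have "z \<in> carrier ?L" using hL QG by blast
      moreover have "z i \<in> \<pi> i ` Q" for i using g by (auto simp: \<pi>_def)
      ultimately show "z \<in> carrier ?L'" by (auto simp: inverse_limit_group_def PiE_iff)
    qed
    have "inverse_system I r ?H f"
      unfolding inverse_system_def
    proof (intro conjI ballI allI impI)
      show "f i j \<in> hom (?H j) (?H i)" if ij: "(i, j) \<in> r" for i j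
      proof (rule homI)
        show "f i j x \<in> carrier (?H i)" if "x \<in> carrier (?H j)" for x
          using that compat[OF ij] QG by auto
        have "j \<in> I" using ij rI by blast
        then show "f i j (x \<otimes>\<^bsub>?H j\<^esub> y) = f i j x \<otimes>\<^bsub>?H i\<^esub> f i j y" if "x \<in> carrier (?H j)" "y \<in> carrier (?H j)" for x y
          using that hom_mult[OF fhom[OF ij], of x y] img by auto
      qed
      show "f i i x = x" if "i \<in> I" "x \<in> carrier (?H i)" for i x
        by (rule fid) (use that img in auto)
      show "f i j (f j k x) = f i k x" if "(i, j) \<in> r \<and> (j, k) \<in> r" "x \<in> carrier (?H k)" for i j k x
        by (rule fcomp) (use that img[of k] rI in auto)
    qed (use ne po dir gH' in auto)
    moreover have "\<forall>i\<in>I. finite (carrier (?H i)) \<and> C' (?H i)"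
      using C' C img finite_subset by (metis partial_object.select_convs(1) partial_object.surjective partial_object.update_convs(1))
    moreover have "h \<in> iso (G\<lparr>carrier := Q\<rparr>) ?L'"
    proof -
      have "h \<in> hom (G\<lparr>carrier := Q\<rparr>) ?L'"
      proof (rule homI)
        show "h x \<in> carrier ?L'" if "x \<in> carrier (G\<lparr>carrier := Q\<rparr>)" for x unfolding L' using that by simp
        show "h (x \<otimes>\<^bsub>G\<lparr>carrier := Q\<rparr>\<^esub> y) = h x \<otimes>\<^bsub>?L'\<^esub> h y"
          if "x \<in> carrier (G\<lparr>carrier := Q\<rparr>)" "y \<in> carrier (G\<lparr>carrier := Q\<rparr>)" for x y
          using that hom_mult[OF hh, of x y] QG by (auto simp: inverse_limit_mult)
      qed
      moreover have "bij_betw h Q (h ` Q)" using bij QG by (meson bij_betw_subset subset_refl)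
      ultimately show ?thesis using L' by (simp add: iso_def)
    qed
    moreover have "homeomorphic_map (subtopology T Q) (inverse_limit_topology I r ?H f) h"
    proof -
      have "carrier ?L' \<subseteq> carrier ?L" unfolding L' using hL QG by blast
      then have "homeomorphic_map (subtopology T Q) (subtopology ?LT (carrier ?L')) h"
        by (intro homeomorphic_map_subtopologies[OF homeo]) (use L' topLT top QG in auto)
      then show ?thesis using inverse_limit_topology_restrict[of I "\<lambda>i. \<pi> i ` Q" H r f] img by simp
    qed
    moreover have "group (G\<lparr>carrier := Q\<rparr>)" using subgroup.subgroup_is_group[OF Q gG] .
    moreover have "topspace (subtopology T Q) = carrier (G\<lparr>carrier := Q\<rparr>)" using top QG by auto
    ultimately show ?thesis unfolding pro_class_def by blast
  qed
  show thesis
    by (rule that[OF fq]) (use C sub in blast)+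
qed

section \<open>Sylow subgroups and series of finite quotients\<close>

context group
begin

text \<open>If \<open>P\<close> fixed no coset of a Sylow subgroup \<open>R\<close>, all double cosets \<open>P y R\<close> would have size
  divisible by \<open>p |R|\<close>, and \<open>p\<close> would divide the index of \<open>R\<close>. So \<open>P\<close> lies in a conjugate of \<open>R\<close>.\<close>

lemma p_subgroup_in_sylow:
  assumes fin: "finite (carrier G)" and p: "prime p" and P: "subgroup P G" "card P = p ^ k"
  shows "\<exists>S. subgroup S G \<and> P \<subseteq> S \<and> (\<exists>a. card S = p ^ a) \<and> \<not> p dvd order G div card S"
proof -
  note fins = finite_subgroup[OF fin] and pos = card_subgroup_pos[OF fin]
  have "order G \<noteq> 0" using fin order_gt_0_iff_finite by simp
  then obtain m where m: "order G = p ^ multiplicity p (order G) * m" "\<not> p dvd m"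
    using multiplicity_decompose'[of "order G" p] p by (auto simp: prime_nat_iff)
  then obtain R where R: "subgroup R G" "card R = p ^ multiplicity p (order G)"
    using sylow_thm[OF p is_group m(1) fin] by blast
  have dR: "order G div card R = m" using m(1) R(2) pos[OF R(1)]
    by (metis nonzero_mult_div_cancel_left not_less_zero)
  have "\<exists>x\<in>carrier G. P \<subseteq> coset_stabilizer G R x"
  proof (rule ccontr)
    assume none: "\<not> (\<exists>x\<in>carrier G. P \<subseteq> coset_stabilizer G R x)"
    have "p * card R dvd card (carrier G)"
    proof (rule double_coset_dvd[OF P(1) R(1) fin])
      show "a \<otimes> y \<otimes> h \<in> carrier G" if "a \<in> P" "y \<in> carrier G" "h \<in> R" for a y h
        using that subgroup.mem_carrier[OF P(1)] subgroup.mem_carrier[OF R(1)] by simp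
      show "p * card (P \<inter> coset_stabilizer G R y) dvd card P" if y: "y \<in> carrier G" for y
      proof -
        let ?D = "P \<inter> coset_stabilizer G R y"
        have D: "subgroup ?D G" using subgroup_Int[OF P(1) subgroup_coset_stabilizer[OF R(1) y]] .
        have "card ?D dvd p ^ k" using card_subgroup_dvd[OF D P(1) _ fins[OF P(1)]] P(2) by simp
        then obtain i where i: "i \<le> k" "card ?D = p ^ i" using p by (metis divides_primepow_nat)
        have "?D \<subset> P" using none y by blast
        then have "card ?D < card P" using fins[OF P(1)] by (rule psubset_card_mono[rotated])
        then have "i \<noteq> k" using i P(2) by auto
        then have "Suc i \<le> k" using i by simp
        then have "p ^ Suc i dvd p ^ k" by (rule le_imp_power_dvd)
        then show ?thesis using i P(2) by simp
      qed
    qed simp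
    then have "p dvd m" using dR dvd_mult_imp_div by (metis order_def)
    then show False using m(2) by blast
  qed
  then obtain x where x: "x \<in> carrier G" "P \<subseteq> coset_stabilizer G R x" by blast
  have "card (coset_stabilizer G R x) = card R"
    unfolding coset_stabilizer_eq_image[OF R(1) x(1)]
    using subgroup.mem_carrier[OF R(1)] x(1) by (intro card_image) (simp add: inj_on_def)
  then show ?thesis using x(2) subgroup_coset_stabilizer[OF R(1) x(1)] R(2) dR m(2) by metis
qed

lemma conj_int_pow:
  assumes "x \<in> carrier G" "t \<in> carrier G"
  shows "x \<otimes> t [^] (n::int) \<otimes> inv x = (x \<otimes> t \<otimes> inv x) [^] n"
proof -
  have "(\<lambda>t. x \<otimes> t \<otimes> inv x) \<in> hom G G"
    using assms(1) by (intro homI) (simp_all add: conj_mult)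
  then interpret group_hom G G "\<lambda>t. x \<otimes> t \<otimes> inv x"
    by (simp add: group_hom_def group_hom_axioms_def is_group)
  show ?thesis using hom_int_pow[of t n] assms by (simp add: int_pow_def2)
qed

text \<open>If \<open>x\<close> and \<open>y\<close> raise \<open>t\<close> to the powers \<open>a\<close> and \<open>b\<close>, then \<open>x y\<close> and \<open>y x\<close> both raise the
  elements of the group generated by \<open>t\<close> to the power \<open>a b\<close>. The hypothesis \<open>w\<close> moves \<open>z\<close> back by
  \<open>y x\<close>, which avoids speaking of inverses of \<open>a\<close> and \<open>b\<close>.\<close>

lemma commutator_centralizes_cyclic:
  assumes x: "x \<in> carrier G" and y: "y \<in> carrier G" and t: "t \<in> carrier G"
    and a: "x \<otimes> t \<otimes> inv x = t [^] (a::int)" and b: "y \<otimes> t \<otimes> inv y = t [^] (b::int)"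
    and w: "inv (y \<otimes> x) \<otimes> z \<otimes> (y \<otimes> x) = t [^] (m::int)" and z: "z \<in> carrier G"
  shows "(x \<otimes> y \<otimes> inv x \<otimes> inv y) \<otimes> z \<otimes> inv (x \<otimes> y \<otimes> inv x \<otimes> inv y) = z"
proof -
  have com: "x \<otimes> (y \<otimes> t [^] m \<otimes> inv y) \<otimes> inv x = y \<otimes> (x \<otimes> t [^] m \<otimes> inv x) \<otimes> inv y"
    using x y t by (simp add: conj_int_pow a b int_pow_pow mult.commute mult.left_commute)
  have e1: "x \<otimes> y \<otimes> inv x \<otimes> inv y = (x \<otimes> y) \<otimes> inv (y \<otimes> x)" using x y by (simp add: group_word)
  define v where "v = y \<otimes> x"
  have v: "v \<in> carrier G" unfolding v_def using x y by simp
  have zv: "v \<otimes> (inv v \<otimes> z \<otimes> v) \<otimes> inv v = z" using v z by (simp add: group_word)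
  have "(x \<otimes> y \<otimes> inv x \<otimes> inv y) \<otimes> z \<otimes> inv (x \<otimes> y \<otimes> inv x \<otimes> inv y) =
      x \<otimes> (y \<otimes> (inv v \<otimes> z \<otimes> v) \<otimes> inv y) \<otimes> inv x"
    unfolding e1 v_def[symmetric] using v x y z by (simp add: group_word)
  also have "\<dots> = y \<otimes> (x \<otimes> (inv v \<otimes> z \<otimes> v) \<otimes> inv x) \<otimes> inv y"
    using com w v_def by simp
  also have "\<dots> = v \<otimes> (inv v \<otimes> z \<otimes> v) \<otimes> inv v" 
  proof -
    define u where "u = inv v \<otimes> z \<otimes> v"
    have "u \<in> carrier G" unfolding u_def using v z by simp
    then show ?thesis unfolding u_def[symmetric] unfolding v_def using x y by (simp add: group_word)
  qed
  finally show ?thesis unfolding zv .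
qed

end

lemma nilpotent_centralizes_series:
  assumes "nilpotent_group H"
  shows "centralizes_series H (carrier H)"
proof -
  from assms interpret group H unfolding nilpotent_group_def by blast
  from assms obtain n K where K: "K 0 = {\<one>\<^bsub>H\<^esub>}" "K n = carrier H" "\<forall>i\<le>n. K i \<lhd> H"
    and c: "\<forall>i<n. K i \<subseteq> K (Suc i) \<and>
      (\<forall>x\<in>K (Suc i). \<forall>g\<in>carrier H. x \<otimes>\<^bsub>H\<^esub> g \<otimes>\<^bsub>H\<^esub> inv\<^bsub>H\<^esub> x \<otimes>\<^bsub>H\<^esub> inv\<^bsub>H\<^esub> g \<in> K i)"
    unfolding nilpotent_group_def by (elim exE conjE) (rule that)
  have "g \<otimes>\<^bsub>H\<^esub> u \<otimes>\<^bsub>H\<^esub> inv\<^bsub>H\<^esub> g \<otimes>\<^bsub>H\<^esub> inv\<^bsub>H\<^esub> u \<in> K i"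
    if i: "i < n" and u: "u \<in> K (Suc i)" and g: "g \<in> carrier H" for i u g
  proof -
    have sub: "subgroup (K i) H" "subgroup (K (Suc i)) H" using K(3) i by (simp_all add: normal_imp_subgroup)
    have uH: "u \<in> carrier H" using u subgroup.mem_carrier[OF sub(2)] by blast
    have "inv\<^bsub>H\<^esub> (u \<otimes>\<^bsub>H\<^esub> g \<otimes>\<^bsub>H\<^esub> inv\<^bsub>H\<^esub> u \<otimes>\<^bsub>H\<^esub> inv\<^bsub>H\<^esub> g) \<in> K i"
      using c i u g subgroup.m_inv_closed[OF sub(1)] by blast
    then show ?thesis using uH g by (simp add: group_word)
  qed
  then show ?thesis unfolding centralizes_series_def using K c by (intro exI[of _ n] exI[of _ K]) simp
qed

text \<open>Modulo \<open>L = K i\<close>, conjugation raises a generator \<open>t\<close> of the cyclic factor to powers, and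
  such operations commute.\<close>

lemma supersolvable_centralizes_series:
  assumes "supersolvable_group H"
  shows "centralizes_series H (derived_set H (carrier H))"
proof -
  from assms interpret group H unfolding supersolvable_group_def by blast
  from assms obtain n K where K: "K 0 = {\<one>\<^bsub>H\<^esub>}" "K n = carrier H" "\<forall>i\<le>n. K i \<lhd> H"
    and c: "\<forall>i<n. K i \<subseteq> K (Suc i) \<and> cyclic_group ((H\<lparr>carrier := K (Suc i)\<rparr>) Mod (K i))"
    unfolding supersolvable_group_def by (elim exE conjE) (rule that)
  have "g \<otimes>\<^bsub>H\<^esub> u \<otimes>\<^bsub>H\<^esub> inv\<^bsub>H\<^esub> g \<otimes>\<^bsub>H\<^esub> inv\<^bsub>H\<^esub> u \<in> K i"
    if i: "i < n" and u: "u \<in> K (Suc i)" and g: "g \<in> derived_set H (carrier H)" for i u g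
  proof -
    define L M where "L = K i" and "M = K (Suc i)"
    have L: "L \<lhd> H" and M: "M \<lhd> H" using K(3) i L_def M_def by auto
    have Ms: "subgroup M H" using M normal_imp_subgroup by blast
    have LM: "L \<subseteq> M" and cyc: "cyclic_group (H\<lparr>carrier := M\<rparr> Mod L)" using c i L_def M_def by auto
    interpret L: normal L H by (rule L)
    define Q where "Q = H Mod L"
    define q where "q = (\<lambda>x. L #>\<^bsub>H\<^esub> x)"
    interpret Q: group Q unfolding Q_def by (rule L.factorgroup_is_group)
    interpret q: group_hom H Q q
      unfolding q_def Q_def group_hom_def group_hom_axioms_def
      using L.r_coset_hom_Mod L.factorgroup_is_group is_group by blast
    have LN: "L \<lhd> H\<lparr>carrier := M\<rparr>" using normal_restrict_supergroup[OF Ms L LM] .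
    interpret F: group "H\<lparr>carrier := M\<rparr> Mod L" using normal.factorgroup_is_group[OF LN] .
    obtain X where X: "X \<in> carrier (H\<lparr>carrier := M\<rparr> Mod L)"
      "carrier (H\<lparr>carrier := M\<rparr> Mod L) = range (\<lambda>k::int. X [^]\<^bsub>H\<lparr>carrier := M\<rparr> Mod L\<^esub> k)"
      using cyc F.cyclic_group by blast
    obtain t where t: "t \<in> M" "X = L #>\<^bsub>H\<^esub> t" using X(1) by (auto simp: carrier_FactGroup)
    have tH: "t \<in> carrier H" using t subgroup.mem_carrier[OF Ms] by blast
    have gen: "\<exists>k::int. q v = q t [^]\<^bsub>Q\<^esub> k" if v: "v \<in> M" for v
    proof -
      have "L #>\<^bsub>H\<^esub> v \<in> carrier (H\<lparr>carrier := M\<rparr> Mod L)" using v by (auto simp: carrier_FactGroup)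
      then obtain k :: int where "L #>\<^bsub>H\<^esub> v = X [^]\<^bsub>H\<lparr>carrier := M\<rparr> Mod L\<^esub> k" unfolding X(2) by blast
      also have "\<dots> = L #>\<^bsub>H\<^esub> (t [^]\<^bsub>H\<lparr>carrier := M\<rparr>\<^esub> k)"
        unfolding t(2) using normal.FactGroup_int_pow[OF LN, of t k] t(1) by simp
      also have "t [^]\<^bsub>H\<lparr>carrier := M\<rparr>\<^esub> k = t [^]\<^bsub>H\<^esub> k" using int_pow_consistent[OF Ms t(1)] by simp
      finally show ?thesis using q.hom_int_pow[OF tH, of k] unfolding q_def Q_def by metis
    qed
    obtain x y where xy: "x \<in> carrier H" "y \<in> carrier H"
      and gxy: "g = x \<otimes>\<^bsub>H\<^esub> y \<otimes>\<^bsub>H\<^esub> inv\<^bsub>H\<^esub> x \<otimes>\<^bsub>H\<^esub> inv\<^bsub>H\<^esub> y" using g by blast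
    have uH: "u \<in> carrier H" and uM: "u \<in> M" using u subgroup.mem_carrier[OF Ms] M_def by auto
    obtain a b m :: int where "q (x \<otimes>\<^bsub>H\<^esub> t \<otimes>\<^bsub>H\<^esub> inv\<^bsub>H\<^esub> x) = q t [^]\<^bsub>Q\<^esub> a"
        "q (y \<otimes>\<^bsub>H\<^esub> t \<otimes>\<^bsub>H\<^esub> inv\<^bsub>H\<^esub> y) = q t [^]\<^bsub>Q\<^esub> b"
        "q (inv\<^bsub>H\<^esub> (y \<otimes>\<^bsub>H\<^esub> x) \<otimes>\<^bsub>H\<^esub> u \<otimes>\<^bsub>H\<^esub> (y \<otimes>\<^bsub>H\<^esub> x)) = q t [^]\<^bsub>Q\<^esub> m"
      using gen normal_conj[OF M] xy t(1) uM by (metis m_closed)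
    then have "q g \<otimes>\<^bsub>Q\<^esub> q u \<otimes>\<^bsub>Q\<^esub> inv\<^bsub>Q\<^esub> q g = q u"
      unfolding gxy using Q.commutator_centralizes_cyclic[of "q x" "q y" "q t" a b "q u" m] xy tH uH by simp
    moreover have gH: "g \<in> carrier H" unfolding gxy using xy by simp
    ultimately have "q (g \<otimes>\<^bsub>H\<^esub> u \<otimes>\<^bsub>H\<^esub> inv\<^bsub>H\<^esub> g \<otimes>\<^bsub>H\<^esub> inv\<^bsub>H\<^esub> u) = \<one>\<^bsub>Q\<^esub>"
      using uH by simp
    then have "L #>\<^bsub>H\<^esub> (g \<otimes>\<^bsub>H\<^esub> u \<otimes>\<^bsub>H\<^esub> inv\<^bsub>H\<^esub> g \<otimes>\<^bsub>H\<^esub> inv\<^bsub>H\<^esub> u) = L" unfolding q_def Q_def by simp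
    moreover have "g \<otimes>\<^bsub>H\<^esub> u \<otimes>\<^bsub>H\<^esub> inv\<^bsub>H\<^esub> g \<otimes>\<^bsub>H\<^esub> inv\<^bsub>H\<^esub> u \<in> carrier H" using gH uH by simp
    ultimately show ?thesis using coset_join1[OF _ _ L.subgroup_axioms] L_def by blast
  qed
  then show ?thesis unfolding centralizes_series_def using K c by (intro exI[of _ n] exI[of _ K]) simp
qed

text \<open>The series of \<open>Q\<close> is pulled back along \<open>f\<close> and pushed forward along \<open>g\<close>; the kernel
  condition makes its first term trivial. This compares two unrelated presentations of a profinite
  group as an inverse limit.\<close>

lemma centralizes_series_image:
  assumes A: "group A" and Q: "group Q" and R: "group R" and f: "f \<in> hom A Q" and g: "g \<in> hom A R"
    and ker: "\<And>x. \<lbrakk>x \<in> carrier A; f x = \<one>\<^bsub>Q\<^esub>\<rbrakk> \<Longrightarrow> g x = \<one>\<^bsub>R\<^esub>"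
    and D: "centralizes_series Q D" "f ` C \<subseteq> D" and C: "C \<subseteq> carrier A"
  shows "centralizes_series (R\<lparr>carrier := g ` carrier A\<rparr>) (g ` C)"
proof -
  interpret A: group A by fact
  interpret f: group_hom A Q f using A Q f by (simp add: group_hom_def group_hom_axioms_def)
  interpret g: group_hom A R g using A R g by (simp add: group_hom_def group_hom_axioms_def)
  let ?R = "R\<lparr>carrier := g ` carrier A\<rparr>"
  have Rs: "subgroup (g ` carrier A) R" using g.img_is_subgroup .
  have Rg: "group ?R" using subgroup.subgroup_is_group[OF Rs R] .
  interpret g': group_hom A ?R g
    using A Rg g by (auto simp: group_hom_def group_hom_axioms_def hom_def)
  have invR: "inv\<^bsub>?R\<^esub> (g x) = inv\<^bsub>R\<^esub> (g x)" if "x \<in> carrier A" for x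
    using group.m_inv_consistent[OF R Rs] that by simp
  from D(1) obtain n K where K: "K 0 = {\<one>\<^bsub>Q\<^esub>}" "K n = carrier Q" "\<And>i. i \<le> n \<Longrightarrow> K i \<lhd> Q"
    and mono: "\<And>i. i < n \<Longrightarrow> K i \<subseteq> K (Suc i)"
    and c: "\<And>i u c. \<lbrakk>i < n; u \<in> K (Suc i); c \<in> D\<rbrakk> \<Longrightarrow> c \<otimes>\<^bsub>Q\<^esub> u \<otimes>\<^bsub>Q\<^esub> inv\<^bsub>Q\<^esub> c \<otimes>\<^bsub>Q\<^esub> inv\<^bsub>Q\<^esub> u \<in> K i"
    by (rule centralizes_seriesE) blast
  define P where "P = (\<lambda>i. {x \<in> carrier A. f x \<in> K i})"
  have P: "P i \<lhd> A" if i: "i \<le> n" for i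
  proof -
    have Ks: "subgroup (K i) Q" using K(3)[OF i] normal_imp_subgroup by blast
    have "subgroup (P i) A"
    proof (rule A.subgroupI)
      have "\<one>\<^bsub>A\<^esub> \<in> P i" unfolding P_def using subgroup.one_closed[OF Ks] by simp
      then show "P i \<noteq> {}" by blast
    qed (use subgroup.m_closed[OF Ks] subgroup.m_inv_closed[OF Ks] in \<open>auto simp: P_def\<close>)
    moreover have "x \<otimes>\<^bsub>A\<^esub> h \<otimes>\<^bsub>A\<^esub> inv\<^bsub>A\<^esub> x \<in> P i" if "x \<in> carrier A" "h \<in> P i" for x h
      using that group.normal_conj(1)[OF Q K(3)[OF i], of "f x" "f h"] by (auto simp: P_def)
    ultimately show ?thesis using A.normal_inv_iff by blast
  qed
  show ?thesis unfolding centralizes_series_def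
  proof (intro exI[of _ n] exI[of _ "\<lambda>i. g ` P i"] conjI allI impI ballI)
    show "g ` P 0 = {\<one>\<^bsub>?R\<^esub>}"
    proof -
      have "\<one>\<^bsub>A\<^esub> \<in> P 0" unfolding P_def K(1) by simp
      then have "\<one>\<^bsub>R\<^esub> \<in> g ` P 0" by (metis g.hom_one imageI)
      moreover have "g ` P 0 \<subseteq> {\<one>\<^bsub>R\<^esub>}" unfolding P_def K(1) using ker by auto
      ultimately show ?thesis by auto
    qed
    show "g ` P n = carrier ?R" unfolding P_def K(2) by auto
    show "g ` P i \<lhd> ?R" if "i \<le> n" for i
      using normal.surj_hom_normal_subgroup[OF P[OF that] g'.group_hom_axioms] by simp
    show "g ` P i \<subseteq> g ` P (Suc i)" if "i < n" for i using mono[OF that] by (auto simp: P_def)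
    fix i u' c' assume i: "i < n" and u': "u' \<in> g ` P (Suc i)" and c': "c' \<in> g ` C"
    obtain u where u: "u \<in> carrier A" "f u \<in> K (Suc i)" "u' = g u" using u' by (auto simp: P_def)
    obtain d where d: "d \<in> C" "d \<in> carrier A" "c' = g d" using c' C by blast
    have "d \<otimes>\<^bsub>A\<^esub> u \<otimes>\<^bsub>A\<^esub> inv\<^bsub>A\<^esub> d \<otimes>\<^bsub>A\<^esub> inv\<^bsub>A\<^esub> u \<in> P i"
      using c[OF i u(2), of "f d"] D(2) d u(1) by (auto simp: P_def)
    then have "g (d \<otimes>\<^bsub>A\<^esub> u \<otimes>\<^bsub>A\<^esub> inv\<^bsub>A\<^esub> d \<otimes>\<^bsub>A\<^esub> inv\<^bsub>A\<^esub> u) \<in> g ` P i" by (rule imageI)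
    then show "c' \<otimes>\<^bsub>?R\<^esub> u' \<otimes>\<^bsub>?R\<^esub> inv\<^bsub>?R\<^esub> c' \<otimes>\<^bsub>?R\<^esub> inv\<^bsub>?R\<^esub> u' \<in> g ` P i"
      using u(1,3) d(2,3) invR by simp
  qed
qed

section \<open>Compactness arguments\<close>

lemma hom_factor:
  assumes A: "group A" and Q: "group Q" and R: "group R" and f: "f \<in> hom A Q" and g: "g \<in> hom A R"
    and ker: "\<And>x. \<lbrakk>x \<in> carrier A; f x = \<one>\<^bsub>Q\<^esub>\<rbrakk> \<Longrightarrow> g x = \<one>\<^bsub>R\<^esub>"
  shows "\<exists>h. h \<in> hom (Q\<lparr>carrier := f ` carrier A\<rparr>) R \<and> (\<forall>x\<in>carrier A. h (f x) = g x)"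
proof -
  interpret A: group A by fact
  interpret f: group_hom A Q f using A Q f by (simp add: group_hom_def group_hom_axioms_def)
  interpret g: group_hom A R g using A R g by (simp add: group_hom_def group_hom_axioms_def)
  define h where "h = (\<lambda>y. g (inv_into (carrier A) f y))"
  have hf: "h (f x) = g x" if x: "x \<in> carrier A" for x
  proof -
    define y where "y = inv_into (carrier A) f (f x)"
    have y: "y \<in> carrier A" "f y = f x"
      unfolding y_def using x by (auto intro: inv_into_into f_inv_into_f)
    have "f (y \<otimes>\<^bsub>A\<^esub> inv\<^bsub>A\<^esub> x) = \<one>\<^bsub>Q\<^esub>" using y x by simp
    then have "g (y \<otimes>\<^bsub>A\<^esub> inv\<^bsub>A\<^esub> x) = \<one>\<^bsub>R\<^esub>" using ker y x by simp
    then have "g y \<otimes>\<^bsub>R\<^esub> inv\<^bsub>R\<^esub> g x \<otimes>\<^bsub>R\<^esub> g x = g x" using y x by simp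
    then have "g y = g x" using y x by (simp add: g.H.m_assoc)
    then show ?thesis unfolding h_def y_def .
  qed
  have "h \<in> hom (Q\<lparr>carrier := f ` carrier A\<rparr>) R"
  proof (rule homI)
    show "h y \<in> carrier R" if "y \<in> carrier (Q\<lparr>carrier := f ` carrier A\<rparr>)" for y
      using that hf by auto
    show "h (y \<otimes>\<^bsub>Q\<lparr>carrier := f ` carrier A\<rparr>\<^esub> z) = h y \<otimes>\<^bsub>R\<^esub> h z"
      if yz: "y \<in> carrier (Q\<lparr>carrier := f ` carrier A\<rparr>)" "z \<in> carrier (Q\<lparr>carrier := f ` carrier A\<rparr>)" for y z
    proof -
      obtain a b where ab: "a \<in> carrier A" "b \<in> carrier A" "y = f a" "z = f b" using yz by auto
      then show ?thesis using hf[of "a \<otimes>\<^bsub>A\<^esub> b"] hf by simp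
    qed
  qed
  then show ?thesis using hf by blast
qed

lemma (in group_hom) card_eq_card_kernel_times_image:
  assumes S: "subgroup S G" and fin: "finite S"
  shows "card S = card {x \<in> S. h x = \<one>\<^bsub>H\<^esub>} * card (h ` S)"
proof (rule card_eq_fibre_times_image[OF fin])
  fix z assume "z \<in> h ` S"
  then obtain a where a: "a \<in> S" "z = h a" by blast
  note car = subgroup.mem_carrier[OF S] and cl = subgroup.m_closed[OF S] subgroup.m_inv_closed[OF S]
  have "{x \<in> S. h x = z} = (\<lambda>x. a \<otimes>\<^bsub>G\<^esub> x) ` {x \<in> S. h x = \<one>\<^bsub>H\<^esub>}"
  proof (intro equalityI subsetI)
    fix x assume x: "x \<in> {x \<in> S. h x = z}"
    then have "h (inv\<^bsub>G\<^esub> a \<otimes>\<^bsub>G\<^esub> x) = \<one>\<^bsub>H\<^esub>" using a car by simp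
    moreover have "x = a \<otimes>\<^bsub>G\<^esub> (inv\<^bsub>G\<^esub> a \<otimes>\<^bsub>G\<^esub> x)" using a x car by (simp add: G.inv_cancel_left)
    ultimately show "x \<in> (\<lambda>x. a \<otimes>\<^bsub>G\<^esub> x) ` {x \<in> S. h x = \<one>\<^bsub>H\<^esub>}" using a x cl by blast
  next
    fix x assume "x \<in> (\<lambda>x. a \<otimes>\<^bsub>G\<^esub> x) ` {x \<in> S. h x = \<one>\<^bsub>H\<^esub>}"
    then show "x \<in> {x \<in> S. h x = z}" using a car cl by auto
  qed
  moreover have "inj_on (\<lambda>x. a \<otimes>\<^bsub>G\<^esub> x) {x \<in> S. h x = \<one>\<^bsub>H\<^esub>}"
    using a car by (auto simp: inj_on_def)
  ultimately show "card {x \<in> S. h x = z} = card {x \<in> S. h x = \<one>\<^bsub>H\<^esub>}"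
    by (simp add: card_image)
qed

text \<open>In a homomorphism between finite groups the index of the image of a subgroup divides its
  index, with equality if the subgroup contains the kernel. The group \<open>A\<close> may be infinite; the
  homomorphism is the one that \<open>hom_factor\<close> provides between the images under \<open>f\<close> and \<open>g\<close>.\<close>

lemma index_of_image:
  assumes A: "group A" and Q: "group Q" and R: "group R" and f: "f \<in> hom A Q" and g: "g \<in> hom A R"
    and ker: "\<And>x. \<lbrakk>x \<in> carrier A; f x = \<one>\<^bsub>Q\<^esub>\<rbrakk> \<Longrightarrow> g x = \<one>\<^bsub>R\<^esub>"
    and fin: "finite (carrier Q)" and S: "subgroup S A"
  shows "card (g ` carrier A) div card (g ` S) dvd card (f ` carrier A) div card (f ` S)"
    and "(\<And>x. \<lbrakk>x \<in> carrier A; g x = \<one>\<^bsub>R\<^esub>\<rbrakk> \<Longrightarrow> x \<in> S) \<Longrightarrow>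
      card (g ` carrier A) div card (g ` S) = card (f ` carrier A) div card (f ` S)"
proof -
  interpret A: group A by fact
  interpret f: group_hom A Q f using A Q f by (simp add: group_hom_def group_hom_axioms_def)
  interpret g: group_hom A R g using A R g by (simp add: group_hom_def group_hom_axioms_def)
  let ?Q = "Q\<lparr>carrier := f ` carrier A\<rparr>"
  obtain h where h: "h \<in> hom ?Q R" "\<And>x. x \<in> carrier A \<Longrightarrow> h (f x) = g x"
    using hom_factor[OF A Q R f g ker] by blast
  have fA: "subgroup (f ` carrier A) Q" by (rule f.img_is_subgroup)
  have Qg: "group ?Q" using subgroup.subgroup_is_group[OF fA Q] .
  interpret h: group_hom ?Q R h using Qg R h by (simp add: group_hom_def group_hom_axioms_def)
  have finA: "finite (f ` carrier A)" using fin subgroup.subset[OF fA] finite_subset by blast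
  have SA: "S \<subseteq> carrier A" using subgroup.subset[OF S] .
  have fS: "subgroup (f ` S) Q" using f.subgroup_img_is_subgroup[OF S] .
  have fSQ: "subgroup (f ` S) ?Q" using group.subgroup_incl[OF Q fS fA] SA by blast
  have finS: "finite (f ` S)" using finA SA by (meson finite_subset image_mono)
  define a where "a = card {x \<in> f ` carrier A. h x = \<one>\<^bsub>R\<^esub>}"
  define s where "s = card {x \<in> f ` S. h x = \<one>\<^bsub>R\<^esub>}"
  have hA: "h ` (f ` carrier A) = g ` carrier A" "h ` (f ` S) = g ` S" unfolding image_image using h(2) SA by (auto intro!: image_cong)
  have 1: "card (f ` carrier A) = a * card (g ` carrier A)" "card (f ` S) = s * card (g ` S)"
    unfolding a_def s_def hA[symmetric]
    using h.card_eq_card_kernel_times_image[OF h.subgroup_self] h.card_eq_card_kernel_times_image[OF fSQ finS] finA by simp_all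
  have kA: "subgroup {x \<in> f ` carrier A. h x = \<one>\<^bsub>R\<^esub>} Q" and kS: "subgroup {x \<in> f ` S. h x = \<one>\<^bsub>R\<^esub>} Q"
  proof -
    have k: "subgroup {x \<in> f ` carrier A. h x = \<one>\<^bsub>R\<^esub>} ?Q"
      using h.subgroup_kernel by (simp add: kernel_def)
    show "subgroup {x \<in> f ` carrier A. h x = \<one>\<^bsub>R\<^esub>} Q" using group.incl_subgroup[OF Q fA k] .
    moreover have "f ` S \<inter> {x \<in> f ` carrier A. h x = \<one>\<^bsub>R\<^esub>} = {x \<in> f ` S. h x = \<one>\<^bsub>R\<^esub>}" using SA by auto
    ultimately show "subgroup {x \<in> f ` S. h x = \<one>\<^bsub>R\<^esub>} Q" using group.subgroup_Int[OF Q fS] by metis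
  qed
  have dvd: "s dvd a" unfolding s_def a_def
    using group.card_subgroup_dvd[OF Q kS kA] SA finA by (auto simp: image_mono)
  have gS: "card (g ` S) dvd card (g ` carrier A)"
    using group.card_subgroup_dvd[OF R g.subgroup_img_is_subgroup[OF S] g.img_is_subgroup] SA finA
    unfolding hA[symmetric] by (simp add: image_mono)
  have sp: "s > 0" and ap: "a > 0" and gp: "card (g ` S) > 0"
  proof -
    have p: "card (f ` S) > 0" "card (f ` carrier A) > 0"
      using finS finA subgroup.one_closed[OF S] by (auto simp: card_gt_0_iff)
    show "s > 0" "card (g ` S) > 0" using p(1) unfolding 1 by simp_all
    show "a > 0" using p(2) unfolding 1 by simp
  qed
  obtain t u where tu: "a = s * t" "card (g ` carrier A) = card (g ` S) * u" using dvd gS by (meson dvdE)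
  have "card (f ` carrier A) div card (f ` S) = t * u"
    unfolding 1 tu using sp gp by (simp add: mult.assoc mult.left_commute[of _ t] mult.commute)
  moreover have "card (g ` carrier A) div card (g ` S) = u" unfolding tu using gp by simp
  ultimately show "card (g ` carrier A) div card (g ` S) dvd card (f ` carrier A) div card (f ` S)" by simp
  assume sat: "\<And>x. \<lbrakk>x \<in> carrier A; g x = \<one>\<^bsub>R\<^esub>\<rbrakk> \<Longrightarrow> x \<in> S"
  have "{x \<in> f ` carrier A. h x = \<one>\<^bsub>R\<^esub>} = {x \<in> f ` S. h x = \<one>\<^bsub>R\<^esub>}"
    using sat h(2) SA by auto
  then have "t = 1" using tu(1) sp unfolding a_def s_def by simp
  then show "card (g ` carrier A) div card (g ` S) = card (f ` carrier A) div card (f ` S)"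
    using \<open>card (f ` carrier A) div card (f ` S) = t * u\<close> \<open>card (g ` carrier A) div card (g ` S) = u\<close> by simp
qed

context finite_quotients
begin

lemma group_hom_\<pi>: "i \<in> I \<Longrightarrow> group_hom G (B i) (\<pi> i)"
  using hom group_B by (simp add: group_hom_def group_hom_axioms_def is_group)

lemma \<pi>_eq_iff:
  assumes "i \<in> I" "x \<in> carrier G" "y \<in> carrier G"
  shows "\<pi> i x = \<pi> i y \<longleftrightarrow> \<pi> i (inv x \<otimes> y) = \<one>\<^bsub>B i\<^esub>"
proof -
  interpret h: group_hom G "B i" "\<pi> i" by (rule group_hom_\<pi>[OF assms(1)])
  have "\<pi> i x = \<pi> i y" if "inv\<^bsub>B i\<^esub> \<pi> i x \<otimes>\<^bsub>B i\<^esub> \<pi> i y = \<one>\<^bsub>B i\<^esub>"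
  proof -
    have "\<pi> i x \<otimes>\<^bsub>B i\<^esub> (inv\<^bsub>B i\<^esub> \<pi> i x \<otimes>\<^bsub>B i\<^esub> \<pi> i y) = \<pi> i x" unfolding that using assms by simp
    then show ?thesis using assms by (simp add: h.H.inv_cancel_left)
  qed
  then show ?thesis using assms by auto
qed

lemma common_refinement:
  assumes "i \<in> I" "j \<in> I"
  obtains k where "k \<in> I"
    and "\<And>x y. \<lbrakk>x \<in> carrier G; y \<in> carrier G; \<pi> k x = \<pi> k y\<rbrakk> \<Longrightarrow> \<pi> i x = \<pi> i y \<and> \<pi> j x = \<pi> j y"
proof -
  obtain k where k: "k \<in> I" "\<forall>x\<in>carrier G. \<pi> k x = \<one>\<^bsub>B k\<^esub> \<longrightarrow> \<pi> i x = \<one>\<^bsub>B i\<^esub> \<and> \<pi> j x = \<one>\<^bsub>B j\<^esub>"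
    using directed[OF assms] by blast
  show thesis
  proof (rule that[OF k(1)])
    fix x y assume xy: "x \<in> carrier G" "y \<in> carrier G" "\<pi> k x = \<pi> k y"
    then show "\<pi> i x = \<pi> i y \<and> \<pi> j x = \<pi> j y"
      using k \<pi>_eq_iff[OF k(1) xy(1,2)] \<pi>_eq_iff[OF assms(1) xy(1,2)] \<pi>_eq_iff[OF assms(2) xy(1,2)] by simp
  qed
qed

text \<open>Closed sets are determined by their finite images; together with its converse \<open>closedI\<close> this
  replaces continuity of the group operations in all later arguments.\<close>

lemma mem_closed:
  assumes C: "closedin T C" and x: "x \<in> carrier G" and "\<And>i. i \<in> I \<Longrightarrow> \<exists>y\<in>C. \<pi> i y = \<pi> i x"
  shows "x \<in> C"
proof (rule ccontr)
  assume "x \<notin> C"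
  moreover have "openin T (carrier G - C)" using C topspace_eq by (metis openin_diff openin_topspace)
  ultimately obtain i where i: "i \<in> I" "\<forall>y\<in>carrier G. \<pi> i y = \<pi> i x \<longrightarrow> y \<in> carrier G - C"
    using basis[of "carrier G - C" x] x by blast
  have "C \<subseteq> carrier G" using closedin_subset[OF C] topspace_eq by simp
  then show False using assms(3)[OF i(1)] i(2) by blast
qed

lemma closedI:
  assumes C: "C \<subseteq> carrier G"
    and x: "\<And>x. \<lbrakk>x \<in> carrier G; \<And>i. i \<in> I \<Longrightarrow> \<exists>y\<in>C. \<pi> i y = \<pi> i x\<rbrakk> \<Longrightarrow> x \<in> C"
  shows "closedin T C"
proof -
  have "openin T (carrier G - C)"
  proof (subst openin_subopen, intro ballI)
    fix z assume z: "z \<in> carrier G - C"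
    have "\<exists>i\<in>I. \<forall>y\<in>C. \<pi> i y \<noteq> \<pi> i z"
    proof (rule ccontr)
      assume none: "\<not> (\<exists>i\<in>I. \<forall>y\<in>C. \<pi> i y \<noteq> \<pi> i z)"
      have "z \<in> C" by (rule x) (use z none in auto)
      then show False using z by blast
    qed
    then obtain i where i: "i \<in> I" "\<forall>y\<in>C. \<pi> i y \<noteq> \<pi> i z" by (rule bexE)
    have "z \<in> {y \<in> carrier G. \<pi> i y = \<pi> i z}" using z by blast
    moreover have "{y \<in> carrier G. \<pi> i y = \<pi> i z} \<subseteq> carrier G - C" using i(2) by blast
    ultimately show "\<exists>W. openin T W \<and> z \<in> W \<and> W \<subseteq> carrier G - C" using fibre_open[OF i(1)] by blast
  qed
  then show ?thesis using C topspace_eq by (simp add: closedin_def)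
qed

lemma closed_saturated:
  assumes "i \<in> I" "E \<subseteq> carrier G"
    and "\<And>x y. \<lbrakk>x \<in> E; y \<in> carrier G; \<pi> i x = \<pi> i y\<rbrakk> \<Longrightarrow> y \<in> E"
  shows "closedin T E"
  by (rule closedI[OF assms(2)]) (use assms in blast)

text \<open>The form of compactness that turns solutions in all finite quotients into a solution in
  \<open>G\<close>.\<close>

lemma compact_Inter_nonempty:
  assumes ne: "\<F> \<noteq> {}" and cl: "\<And>A. A \<in> \<F> \<Longrightarrow> closedin T A \<and> A \<noteq> {}"
    and dir: "\<And>A B. \<lbrakk>A \<in> \<F>; B \<in> \<F>\<rbrakk> \<Longrightarrow> \<exists>C\<in>\<F>. C \<subseteq> A \<inter> B"
  shows "\<Inter>\<F> \<noteq> {}"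
proof -
  have "\<exists>C\<in>\<F>. C \<subseteq> \<Inter>\<G>" if "finite \<G>" "\<G> \<subseteq> \<F>" for \<G>
    using that
  proof (induction \<G>)
    case empty
    then show ?case using ne by blast
  next
    case (insert A \<G>)
    then obtain C where C: "C \<in> \<F>" "C \<subseteq> \<Inter>\<G>" by auto
    obtain D where D: "D \<in> \<F>" "D \<subseteq> A \<inter> C" using dir[of A C] C(1) insert.prems by auto
    have "D \<subseteq> \<Inter>(insert A \<G>)" using D(2) C(2) by auto
    then show ?case using D(1) by (rule bexI)
  qed
  then have "\<Inter>\<G> \<noteq> {}" if "finite \<G>" "\<G> \<subseteq> \<F>" for \<G>
    using that cl by (metis subset_empty)
  then show ?thesis using compact cl unfolding compact_space_fip by simp
qed

text \<open>Let \<open>x\<close> be approximated by products. The sets \<open>F i\<close> of left factors that work up to the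
  kernel of \<open>\<pi> i\<close> are closed and directed, so they have a common element \<open>a\<close>, and \<open>a\<^sup>-\<^sup>1 x\<close> lies
  in \<open>C\<close> because \<open>C\<close> is closed.\<close>

lemma closed_set_mult:
  assumes A: "closedin T A" and C: "closedin T C"
  shows "closedin T (A <#> C)"
proof (rule closedI)
  have AG: "A \<subseteq> carrier G" and CG: "C \<subseteq> carrier G"
    using closedin_subset[OF A] closedin_subset[OF C] topspace_eq by simp_all
  then show "A <#> C \<subseteq> carrier G" by (rule set_mult_closed)
  fix x assume x: "x \<in> carrier G" and near: "\<And>i. i \<in> I \<Longrightarrow> \<exists>y\<in>A <#> C. \<pi> i y = \<pi> i x"
  define F where "F = (\<lambda>i. {a \<in> A. \<exists>c\<in>C. \<pi> i (a \<otimes> c) = \<pi> i x})"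
  have mult: "\<pi> i (a \<otimes> c) = \<pi> i a \<otimes>\<^bsub>B i\<^esub> \<pi> i c" if "i \<in> I" "a \<in> A" "c \<in> C" for i a c
    using hom_mult[OF hom] that AG CG by blast
  have "\<Inter>(F ` I) \<noteq> {}"
  proof (rule compact_Inter_nonempty)
    show "F ` I \<noteq> {}" using nonempty by blast
    fix X assume "X \<in> F ` I"
    then obtain i where i: "i \<in> I" "X = F i" by blast
    have "closedin T {a \<in> carrier G. \<exists>c\<in>C. \<pi> i a \<otimes>\<^bsub>B i\<^esub> \<pi> i c = \<pi> i x}"
      by (rule closed_saturated[OF i(1)]) auto
    moreover have "X = A \<inter> {a \<in> carrier G. \<exists>c\<in>C. \<pi> i a \<otimes>\<^bsub>B i\<^esub> \<pi> i c = \<pi> i x}"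
      unfolding i(2) F_def using mult[OF i(1)] AG by auto
    ultimately have "closedin T X" using A by (simp add: closedin_Int)
    moreover obtain a c where "a \<in> A" "c \<in> C" "\<pi> i (a \<otimes> c) = \<pi> i x"
      using near[OF i(1)] unfolding set_mult_def by blast
    ultimately show "closedin T X \<and> X \<noteq> {}" unfolding i(2) F_def by blast
  next
    fix X Y assume "X \<in> F ` I" "Y \<in> F ` I"
    then obtain i j where ij: "i \<in> I" "j \<in> I" "X = F i" "Y = F j" by blast
    obtain k where k: "k \<in> I"
      "\<And>x y. \<lbrakk>x \<in> carrier G; y \<in> carrier G; \<pi> k x = \<pi> k y\<rbrakk> \<Longrightarrow> \<pi> i x = \<pi> i y \<and> \<pi> j x = \<pi> j y"
      by (rule common_refinement[OF ij(1,2)]) blast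
    have "a \<in> F i \<inter> F j" if a: "a \<in> F k" for a
    proof -
      obtain c where c: "a \<in> A" "c \<in> C" "\<pi> k (a \<otimes> c) = \<pi> k x" using a F_def by blast
      then have "a \<otimes> c \<in> carrier G" using AG CG by blast
      then have "\<pi> i (a \<otimes> c) = \<pi> i x \<and> \<pi> j (a \<otimes> c) = \<pi> j x" using k(2) c(3) x by blast
      then show ?thesis unfolding F_def using c by blast
    qed
    then show "\<exists>Z\<in>F ` I. Z \<subseteq> X \<inter> Y" using k(1) ij by blast
  qed
  then obtain a where a: "\<And>i. i \<in> I \<Longrightarrow> a \<in> F i" by blast
  have aA: "a \<in> A" using a nonempty F_def by blast
  then have aG: "a \<in> carrier G" using AG by blast
  have "inv a \<otimes> x \<in> C"
  proof (rule mem_closed[OF C])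
    show "inv a \<otimes> x \<in> carrier G" using aG x by simp
    fix i assume i: "i \<in> I"
    interpret h: group_hom G "B i" "\<pi> i" by (rule group_hom_\<pi>[OF i])
    obtain c where c: "c \<in> C" "\<pi> i (a \<otimes> c) = \<pi> i x" using a[OF i] F_def by blast
    have cG: "c \<in> carrier G" using c CG by blast
    have "\<pi> i (inv a \<otimes> x) = inv\<^bsub>B i\<^esub> \<pi> i a \<otimes>\<^bsub>B i\<^esub> \<pi> i (a \<otimes> c)" using c(2) aG x by simp
    also have "\<dots> = \<pi> i c" using aG cG by (simp add: h.H.inv_cancel_left)
    finally show "\<exists>y\<in>C. \<pi> i y = \<pi> i (inv a \<otimes> x)" using c(1) by auto
  qed
  moreover have "x = a \<otimes> (inv a \<otimes> x)" using aG x by (simp add: inv_cancel_left)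
  ultimately show "x \<in> A <#> C" unfolding set_mult_def using aA by blast
qed

lemma closed_l_coset:
  assumes "closedin T C" "g \<in> carrier G"
  shows "closedin T (g <# C)"
proof -
  note CG = closedin_subset[OF assms(1), unfolded topspace_eq]
  show ?thesis
  proof (rule closedI)
    show "g <# C \<subseteq> carrier G" using CG assms(2) by (rule l_coset_subset_G)
    fix x assume x: "x \<in> carrier G" "\<And>i. i \<in> I \<Longrightarrow> \<exists>y\<in>g <# C. \<pi> i y = \<pi> i x"
    have "inv g \<otimes> x \<in> C"
    proof (rule mem_closed[OF assms(1)])
      show "inv g \<otimes> x \<in> carrier G" using assms(2) x(1) by simp
      fix i assume i: "i \<in> I"
      interpret h: group_hom G "B i" "\<pi> i" by (rule group_hom_\<pi>[OF i])
      obtain c where c: "c \<in> C" "\<pi> i (g \<otimes> c) = \<pi> i x" using x(2)[OF i] unfolding l_coset_def by blast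
      have cG: "c \<in> carrier G" using c CG by blast
      have "\<pi> i (inv g \<otimes> x) = inv\<^bsub>B i\<^esub> \<pi> i g \<otimes>\<^bsub>B i\<^esub> \<pi> i (g \<otimes> c)" using c(2) assms(2) x(1) by simp
      also have "\<dots> = \<pi> i c" using assms(2) cG by (simp add: h.H.inv_cancel_left)
      finally show "\<exists>y\<in>C. \<pi> i y = \<pi> i (inv g \<otimes> x)" using c(1) by auto
    qed
    moreover have "x = g \<otimes> (inv g \<otimes> x)" using assms(2) x(1) by (simp add: inv_cancel_left)
    ultimately show "x \<in> g <# C" unfolding l_coset_def by blast
  qed
qed

text \<open>A closed subgroup of finite index is open, because its complement is a finite union of
  closed cosets. The index is finite here since a coset \<open>n S\<close> with \<open>n\<close> in \<open>N\<close> depends only on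
  \<open>\<pi> i n\<close>.\<close>

lemma open_subgroup:
  assumes S: "subgroup S G" "closedin T S" and N: "subgroup N G" and G: "carrier G = N <#> S"
    and i: "i \<in> I" and sub: "\<And>n. \<lbrakk>n \<in> N; \<pi> i n = \<one>\<^bsub>B i\<^esub>\<rbrakk> \<Longrightarrow> n \<in> S"
  shows "\<exists>k\<in>I. \<forall>x\<in>carrier G. \<pi> k x = \<one>\<^bsub>B k\<^esub> \<longrightarrow> x \<in> S"
proof -
  define \<F> where "\<F> = (\<lambda>n. n <# S) ` (N - S)"
  have NG: "N \<subseteq> carrier G" and SG: "S \<subseteq> carrier G" using subgroup.subset N S by blast+
  have "finite \<F>"
  proof (rule finite_subset)
    let ?c = "\<lambda>a. (SOME n. n \<in> N - S \<and> \<pi> i n = a) <# S"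
    show "\<F> \<subseteq> ?c ` carrier (B i)"
    proof
      fix X assume "X \<in> \<F>"
      then obtain n where n: "n \<in> N - S" "X = n <# S" unfolding \<F>_def by blast
      define m where "m = (SOME m. m \<in> N - S \<and> \<pi> i m = \<pi> i n)"
      have m: "m \<in> N - S \<and> \<pi> i m = \<pi> i n" unfolding m_def by (rule someI[of _ n]) (use n in blast)
      have mn: "m \<in> carrier G" "n \<in> carrier G" using m n NG by blast+
      have "inv m \<otimes> n \<in> N" using m n subgroup.m_closed[OF N] subgroup.m_inv_closed[OF N] by blast
      then have "inv m \<otimes> n \<in> S" using sub \<pi>_eq_iff[OF i mn] m by blast
      moreover have "n = m \<otimes> (inv m \<otimes> n)" using mn by (simp add: inv_cancel_left)
      ultimately have "n \<in> m <# S" unfolding l_coset_def by blast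
      then have "X = m <# S" using l_repr_independence[OF _ mn(1) S(1)] n(2) by blast
      moreover have "\<pi> i n \<in> carrier (B i)" using hom[OF i] mn(2) by (rule hom_in_carrier)
      ultimately show "X \<in> ?c ` carrier (B i)" unfolding m_def by blast
    qed
    show "finite (?c ` carrier (B i))" using finite_B[OF i] by simp
  qed
  then have cl: "closedin T (\<Union>\<F>)"
    by (rule closedin_Union) (use closed_l_coset[OF S(2)] NG in \<open>auto simp: \<F>_def\<close>)
  have "S = carrier G - \<Union>\<F>"
  proof (intro equalityI subsetI)
    fix x assume x: "x \<in> S"
    have "x \<notin> n <# S" if n: "n \<in> N - S" for n
    proof
      assume "x \<in> n <# S"
      then obtain s where s: "s \<in> S" "x = n \<otimes> s" unfolding l_coset_def by blast
      have "x \<otimes> inv s \<in> S" using x s(1) subgroup.m_closed[OF S(1)] subgroup.m_inv_closed[OF S(1)] by blast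
      moreover have "x \<otimes> inv s = n" unfolding s(2) using n s(1) NG SG by (simp add: m_assoc subset_iff)
      ultimately show False using n by blast
    qed
    then show "x \<in> carrier G - \<Union>\<F>" using x SG unfolding \<F>_def by blast
  next
    fix x assume x: "x \<in> carrier G - \<Union>\<F>"
    then obtain n s where ns: "n \<in> N" "s \<in> S" "x = n \<otimes> s" using G unfolding set_mult_def by blast
    then have "x \<in> n <# S" unfolding l_coset_def by blast
    then have "n \<in> S" using x ns(1) unfolding \<F>_def by blast
    then show "x \<in> S" using ns subgroup.m_closed[OF S(1)] by blast
  qed
  then have "openin T S" using cl topspace_eq by (metis openin_diff openin_topspace)
  then obtain k where k: "k \<in> I" "\<forall>y\<in>carrier G. \<pi> k y = \<pi> k \<one> \<longrightarrow> y \<in> S"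
    using basis[OF _ subgroup.one_closed[OF S(1)]] by blast
  interpret h: group_hom G "B k" "\<pi> k" by (rule group_hom_\<pi>[OF k(1)])
  show ?thesis using k by auto
qed

text \<open>The kernel of \<open>\<pi> i\<close> on \<open>S\<close> is open in \<open>S\<close>, so it contains the kernel of a projection from
  the inverse system that exhibits \<open>S\<close> as a pro-\<open>C\<close> group.\<close>

lemma finite_quotient_refining:
  assumes S: "subgroup S G" and C: "pro_class C (G\<lparr>carrier := S\<rparr>) (subtopology T S)" and i: "i \<in> I"
  shows "\<exists>(A :: 'a set monoid) \<rho>. group A \<and> finite (carrier A) \<and> C A \<and> \<rho> \<in> hom (G\<lparr>carrier := S\<rparr>) A \<and>
    (\<forall>x\<in>S. \<rho> x = \<one>\<^bsub>A\<^esub> \<longrightarrow> \<pi> i x = \<one>\<^bsub>B i\<^esub>)"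
proof -
  obtain J :: "'a set set" and A :: "'a set \<Rightarrow> 'a set monoid" and \<rho> where
    J: "finite_quotients (G\<lparr>carrier := S\<rparr>) (subtopology T S) J A \<rho>" and CA: "\<And>j. j \<in> J \<Longrightarrow> C (A j)"
    using pro_class_finite_quotients[OF C] by metis
  interpret S: finite_quotients "G\<lparr>carrier := S\<rparr>" "subtopology T S" J A \<rho> by (rule J)
  interpret h: group_hom G "B i" "\<pi> i" by (rule group_hom_\<pi>[OF i])
  have "openin (subtopology T S) (S \<inter> {x \<in> carrier G. \<pi> i x = \<one>\<^bsub>B i\<^esub>})"
    using fibre_open[OF i] by (metis openin_subtopology_Int2)
  moreover have "\<one> \<in> S \<inter> {x \<in> carrier G. \<pi> i x = \<one>\<^bsub>B i\<^esub>}" using subgroup.one_closed[OF S] by simp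
  ultimately obtain j where j: "j \<in> J"
    "\<forall>y\<in>S. \<rho> j y = \<rho> j \<one> \<longrightarrow> y \<in> S \<inter> {x \<in> carrier G. \<pi> i x = \<one>\<^bsub>B i\<^esub>}"
    using S.basis by fastforce
  have "\<rho> j \<one> = \<one>\<^bsub>A j\<^esub>" using hom_one[OF S.hom[OF j(1)] S.is_group S.group_B[OF j(1)]] by simp
  then have "\<forall>x\<in>S. \<rho> j x = \<one>\<^bsub>A j\<^esub> \<longrightarrow> \<pi> i x = \<one>\<^bsub>B i\<^esub>" using j(2) by simp
  then show ?thesis
    using S.group_B[OF j(1)] S.finite_B[OF j(1)] CA[OF j(1)] S.hom[OF j(1)]
    by (intro exI[of _ "A j"] exI[of _ "\<rho> j"] conjI)
qed

end

section \<open>Sylow subgroups of profinite groups\<close>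

context finite_quotients
begin

text \<open>The images of the members of a chain form a chain of subsets of a finite set, so there is a
  smallest one, \<open>\<pi> i ` A\<close>. By compactness the fibre over each of its points contains a point
  common to all members.\<close>

lemma chain_Inter_image:
  assumes ne: "\<C> \<noteq> {}" and chain: "\<And>A C. \<lbrakk>A \<in> \<C>; C \<in> \<C>\<rbrakk> \<Longrightarrow> A \<subseteq> C \<or> C \<subseteq> A"
    and cl: "\<And>A. A \<in> \<C> \<Longrightarrow> closedin T A" and i: "i \<in> I"
  shows "\<exists>A\<in>\<C>. \<pi> i ` \<Inter>\<C> = \<pi> i ` A"
proof -
  have CG: "A \<subseteq> carrier G" if "A \<in> \<C>" for A using closedin_subset[OF cl[OF that]] topspace_eq by simp
  have fin: "finite (\<pi> i ` A)" if "A \<in> \<C>" for A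
    using CG[OF that] hom_in_carrier[OF hom[OF i]] by (intro finite_subset[OF _ finite_B[OF i]]) blast
  obtain A where A: "A \<in> \<C>" "\<And>C. C \<in> \<C> \<Longrightarrow> card (\<pi> i ` A) \<le> card (\<pi> i ` C)"
    using ex_has_least_nat[of "\<lambda>A. A \<in> \<C>" _ "\<lambda>A. card (\<pi> i ` A)"] ne by auto
  have eq: "\<pi> i ` A \<subseteq> \<pi> i ` C" if C: "C \<in> \<C>" for C
  proof (cases "A \<subseteq> C")
    case False
    then have "\<pi> i ` C \<subseteq> \<pi> i ` A" using chain[OF A(1) C] by blast
    then show ?thesis using card_seteq[OF fin[OF A(1)]] A(2)[OF C] by blast
  qed blast
  have "\<pi> i ` A \<subseteq> \<pi> i ` \<Inter>\<C>"
  proof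
    fix a assume a: "a \<in> \<pi> i ` A"
    define F where "F = (\<lambda>C. C \<inter> {x \<in> carrier G. \<pi> i x = a})"
    have "\<Inter>(F ` \<C>) \<noteq> {}"
    proof (rule compact_Inter_nonempty)
      show "F ` \<C> \<noteq> {}" using ne by simp
      fix X assume "X \<in> F ` \<C>"
      then obtain C where C: "C \<in> \<C>" "X = F C" by (rule imageE) simp
      have "closedin T {x \<in> carrier G. \<pi> i x = a}" by (rule closed_saturated[OF i]) auto
      then have "closedin T X" unfolding C(2) F_def using cl[OF C(1)] by (rule closedin_Int[rotated])
      moreover have "a \<in> \<pi> i ` C" using eq[OF C(1)] a by (rule subsetD)
      then have "X \<noteq> {}" unfolding C(2) F_def using CG[OF C(1)] by auto
      ultimately show "closedin T X \<and> X \<noteq> {}" by simp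
    next
      fix X Y assume "X \<in> F ` \<C>" "Y \<in> F ` \<C>"
      then obtain C D where CD: "C \<in> \<C>" "D \<in> \<C>" "X = F C" "Y = F D" by (elim imageE) simp
      then show "\<exists>Z\<in>F ` \<C>. Z \<subseteq> X \<inter> Y" using chain[OF CD(1,2)] unfolding F_def by auto
    qed
    then obtain x where "x \<in> \<Inter>(F ` \<C>)" by auto
    then have "x \<in> \<Inter>\<C>" "\<pi> i x = a" using ne by (auto simp: F_def)
    then show "a \<in> \<pi> i ` \<Inter>\<C>" by auto
  qed
  moreover have "\<pi> i ` \<Inter>\<C> \<subseteq> \<pi> i ` A" using A(1) by auto
  ultimately show ?thesis using A(1) by (intro bexI[of _ A]) auto
qed

text \<open>For a quotient \<open>l\<close> that refines both \<open>i\<close> and \<open>k\<close>, the subgroup has in the quotient \<open>l\<close> the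
  same index as \<open>S\<close>, and its index in the quotient \<open>k\<close> divides that.\<close>

lemma index_prime_to_p_preimage:
  assumes Q: "subgroup Q G" and p: "prime p" and i: "i \<in> I" and S: "subgroup S (B i)" "S \<subseteq> \<pi> i ` Q"
    and ndvd: "\<not> p dvd card (\<pi> i ` Q) div card S" and k: "k \<in> I"
  shows "\<not> p dvd card (\<pi> k ` Q) div card (\<pi> k ` {x \<in> Q. \<pi> i x \<in> S})"
proof -
  let ?Q' = "{x \<in> Q. \<pi> i x \<in> S}"
  have QG: "Q \<subseteq> carrier G" using subgroup.subset[OF Q] .
  interpret Q: group "G\<lparr>carrier := Q\<rparr>" using subgroup.subgroup_is_group[OF Q is_group] .
  obtain l where l: "l \<in> I"
    "\<And>x y. \<lbrakk>x \<in> carrier G; y \<in> carrier G; \<pi> l x = \<pi> l y\<rbrakk> \<Longrightarrow> \<pi> i x = \<pi> i y \<and> \<pi> k x = \<pi> k y"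
    by (rule common_refinement[OF i k]) blast
  have homQ: "\<pi> j \<in> hom (G\<lparr>carrier := Q\<rparr>) (B j)" if "j \<in> I" for j
    using hom[OF that] QG by (auto simp: hom_def)
  have one: "\<pi> j \<one> = \<one>\<^bsub>B j\<^esub>" if "j \<in> I" for j using hom_one[OF hom[OF that] is_group group_B[OF that]] .
  have ker: "\<pi> j x = \<one>\<^bsub>B j\<^esub>" if "j = i \<or> j = k" "x \<in> carrier (G\<lparr>carrier := Q\<rparr>)" "\<pi> l x = \<one>\<^bsub>B l\<^esub>" for j x
    using l(2)[of x \<one>] that one[OF l(1)] one[OF i] one[OF k] QG by auto
  interpret hi: group_hom "G\<lparr>carrier := Q\<rparr>" "B i" "\<pi> i"
    using Q.is_group group_B[OF i] homQ[OF i] by (simp add: group_hom_def group_hom_axioms_def)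
  have Q': "subgroup ?Q' (G\<lparr>carrier := Q\<rparr>)"
  proof (rule Q.subgroupI)
    have "\<one> \<in> ?Q'" using subgroup.one_closed[OF Q] subgroup.one_closed[OF S(1)] one[OF i] by simp
    then show "?Q' \<noteq> {}" by auto
    show "inv\<^bsub>G\<lparr>carrier := Q\<rparr>\<^esub> a \<in> ?Q'" if "a \<in> ?Q'" for a
      using that Q.inv_closed[of a] hi.hom_inv[of a] subgroup.m_inv_closed[OF S(1)] by simp
    show "a \<otimes>\<^bsub>G\<lparr>carrier := Q\<rparr>\<^esub> b \<in> ?Q'" if "a \<in> ?Q'" "b \<in> ?Q'" for a b
      using that Q.m_closed[of a b] hi.hom_mult[of a b] subgroup.m_closed[OF S(1)] by simp
  qed auto
  have img: "\<pi> i ` ?Q' = S" using S(2) by auto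
  have "card (\<pi> i ` Q) div card S = card (\<pi> l ` Q) div card (\<pi> l ` ?Q')"
    using index_of_image(2)[OF Q.is_group group_B[OF l(1)] group_B[OF i] homQ[OF l(1)] homQ[OF i] _ finite_B[OF l(1)] Q']
      ker subgroup.one_closed[OF S(1)] img by simp
  moreover have "card (\<pi> k ` Q) div card (\<pi> k ` ?Q') dvd card (\<pi> l ` Q) div card (\<pi> l ` ?Q')"
    using index_of_image(1)[OF Q.is_group group_B[OF l(1)] group_B[OF k] homQ[OF l(1)] homQ[OF k] _ finite_B[OF l(1)] Q']
      ker by simp
  ultimately show ?thesis using ndvd by (metis dvd_trans)
qed

lemma pro_p_image:
  assumes P: "subgroup P G" and pro: "pro_p p (G\<lparr>carrier := P\<rparr>) (subtopology T P)" and p: "prime p" and i: "i \<in> I"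
  shows "\<exists>k. card (\<pi> i ` P) = p ^ k"
proof -
  obtain A :: "'a set monoid" and \<rho> where A: "group A" "finite (carrier A)" "finite_p_group p A"
    and \<rho>: "\<rho> \<in> hom (G\<lparr>carrier := P\<rparr>) A" "\<And>x. x \<in> P \<Longrightarrow> \<rho> x = \<one>\<^bsub>A\<^esub> \<Longrightarrow> \<pi> i x = \<one>\<^bsub>B i\<^esub>"
    using finite_quotient_refining[OF P pro[unfolded pro_p_def] i] by (elim exE conjE) simp
  have Pg: "group (G\<lparr>carrier := P\<rparr>)" using subgroup.subgroup_is_group[OF P is_group] .
  have PG: "P \<subseteq> carrier G" using subgroup.subset[OF P] .
  have homP: "\<pi> i \<in> hom (G\<lparr>carrier := P\<rparr>) (B i)" using hom[OF i] PG by (auto simp: hom_def)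
  have one: "subgroup {\<one>} (G\<lparr>carrier := P\<rparr>)" using group.triv_subgroup[OF Pg] by simp
  have "card (\<pi> i ` P) div card (\<pi> i ` {\<one>}) dvd card (\<rho> ` P) div card (\<rho> ` {\<one>})"
    using index_of_image(1)[OF Pg A(1) group_B[OF i] \<rho>(1) homP _ A(2) one] \<rho>(2) by simp
  then have "card (\<pi> i ` P) dvd card (\<rho> ` P)" by simp
  also have "card (\<rho> ` P) dvd order A"
  proof -
    interpret h: group_hom "G\<lparr>carrier := P\<rparr>" A \<rho>
      using Pg A(1) \<rho>(1) by (simp add: group_hom_def group_hom_axioms_def)
    have "subgroup (\<rho> ` P) A" using h.img_is_subgroup by simp
    then show ?thesis
      using group.card_subgroup_dvd[OF A(1) _ group.subgroup_self[OF A(1)] _ A(2)] subgroup.subset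
      by (metis order_def)
  qed
  finally show ?thesis using A(3) p unfolding finite_p_group_def by (metis divides_primepow_nat)
qed

text \<open>By compactness and Zorn's lemma there is a minimal closed subgroup \<open>Q\<close> between \<open>P\<close> and \<open>J\<close>
  whose index is prime to \<open>p\<close> in all finite quotients. If some image of \<open>Q\<close> were not a \<open>p\<close>-group,
  the preimage of a Sylow subgroup containing the image of \<open>P\<close> would be smaller than \<open>Q\<close>. So \<open>Q\<close>
  is pro-\<open>p\<close>, and \<open>Q = P\<close> by maximality of \<open>P\<close>.\<close>

lemma sylow_image_index:
  assumes J: "subgroup J G" "closedin T J" and p: "prime p"
    and crit: "\<And>Q. \<lbrakk>subgroup Q G; closedin T Q; \<forall>i\<in>I. finite_p_group p ((B i)\<lparr>carrier := \<pi> i ` Q\<rparr>)\<rbrakk>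
      \<Longrightarrow> pro_p p (G\<lparr>carrier := Q\<rparr>) (subtopology T Q)"
    and syl: "sylow_pro_p_subgroup p P (G\<lparr>carrier := J\<rparr>) (subtopology T J)"
  shows "subgroup P G" "P \<subseteq> J" "\<And>i. i \<in> I \<Longrightarrow> \<not> p dvd card (\<pi> i ` J) div card (\<pi> i ` P)"
proof -
  have sP: "pro_p_subgroup p P (G\<lparr>carrier := J\<rparr>) (subtopology T J)"
    and max: "\<And>Q. \<lbrakk>pro_p_subgroup p Q (G\<lparr>carrier := J\<rparr>) (subtopology T J); P \<subseteq> Q\<rbrakk> \<Longrightarrow> Q = P"
    using syl unfolding sylow_pro_p_subgroup_def by simp_all
  have PJ: "subgroup P (G\<lparr>carrier := J\<rparr>)" "closedin (subtopology T J) P"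
    and P_pro0: "pro_p p (G\<lparr>carrier := J\<rparr>\<lparr>carrier := P\<rparr>) (subtopology (subtopology T J) P)"
    using sP unfolding pro_p_subgroup_def by simp_all
  show PG: "subgroup P G" using incl_subgroup[OF J(1) PJ(1)] .
  show PJs: "P \<subseteq> J" using subgroup.subset[OF PJ(1)] by simp
  have P_pro: "pro_p p (G\<lparr>carrier := P\<rparr>) (subtopology T P)"
    using P_pro0 PJs by (simp add: subtopology_subtopology inf_absorb2)
  \<comment> \<open>A minimal member exists by Zorn's lemma for reverse inclusion: the intersection of a chain keeps
    indices prime to \<open>p\<close>, since its finite images are images of members of the chain.\<close>
  define good where "good = {Q. subgroup Q G \<and> closedin T Q \<and> P \<subseteq> Q \<and> Q \<subseteq> J \<and>
    (\<forall>i\<in>I. \<not> p dvd card (\<pi> i ` J) div card (\<pi> i ` Q))}"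
  have fin: "finite (\<pi> i ` Q)" if "i \<in> I" "subgroup Q G" for i Q
    using subgroup.subset[OF that(2)] hom_in_carrier[OF hom[OF that(1)]]
    by (intro finite_subset[OF _ finite_B[OF that(1)]]) blast
  have img: "subgroup (\<pi> i ` Q) (B i)" if "i \<in> I" "subgroup Q G" for i Q
    using group_hom.subgroup_img_is_subgroup[OF group_hom_\<pi>[OF that(1)] that(2)] .
  have cpos: "card (\<pi> i ` Q) > 0" if "i \<in> I" "subgroup Q G" for i Q
    using fin[OF that] subgroup.one_closed[OF that(2)] by (auto simp: card_gt_0_iff)
  have Jgood: "J \<in> good"
    unfolding good_def using J PJs cpos[OF _ J(1)] p by (auto simp: prime_nat_iff)
  have "\<exists>M\<in>good. \<forall>X\<in>good. X \<subseteq> M \<longrightarrow> X = M"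
  proof (rule predicate_Zorn[of good "\<lambda>X Y. Y \<subseteq> X"])
    show "partial_order_on good (relation_of (\<lambda>X Y. Y \<subseteq> X) good)"
      by (rule partial_order_on_relation_ofI) auto
    fix \<C> assume C: "\<C> \<in> Chains (relation_of (\<lambda>X Y. Y \<subseteq> X) good)"
    then have Cg: "A \<in> good" if "A \<in> \<C>" for A using that by (auto simp: Chains_def relation_of_def)
    show "\<exists>u\<in>good. \<forall>a\<in>\<C>. u \<subseteq> a"
    proof (cases "\<C> = {}")
      case True
      then show ?thesis using Jgood by auto
    next
      case False
      have ch: "A \<subseteq> D \<or> D \<subseteq> A" if "A \<in> \<C>" "D \<in> \<C>" for A D
        using C that by (auto simp: Chains_def relation_of_def)
      have sub: "subgroup A G" and clo: "closedin T A" and PA: "P \<subseteq> A" and AJ: "A \<subseteq> J"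
        and ind: "\<And>i. i \<in> I \<Longrightarrow> \<not> p dvd card (\<pi> i ` J) div card (\<pi> i ` A)" if "A \<in> \<C>" for A
        using Cg[OF that] unfolding good_def by auto
      have "\<Inter>\<C> \<in> good"
        unfolding good_def
      proof (intro CollectI conjI ballI)
        show "subgroup (\<Inter>\<C>) G" by (rule subgroups_Inter) (use sub False in auto)
        show "closedin T (\<Inter>\<C>)" by (rule closedin_Inter) (use clo False in auto)
        show "P \<subseteq> \<Inter>\<C>" using PA by auto
        show "\<Inter>\<C> \<subseteq> J" using AJ False by auto
        fix i assume i: "i \<in> I"
        obtain A where "A \<in> \<C>" "\<pi> i ` \<Inter>\<C> = \<pi> i ` A"
          using chain_Inter_image[OF False ch clo i] by auto
        then show "\<not> p dvd card (\<pi> i ` J) div card (\<pi> i ` \<Inter>\<C>)" using ind[OF _ i] by simp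
      qed
      then show ?thesis by (intro bexI[of _ "\<Inter>\<C>"]) auto
    qed
  qed
  then obtain Q where Q: "Q \<in> good" and min: "\<And>X. X \<in> good \<Longrightarrow> X \<subseteq> Q \<Longrightarrow> X = Q" by auto
  have Qs: "subgroup Q G" and Qc: "closedin T Q" and PQ: "P \<subseteq> Q" and QJ: "Q \<subseteq> J"
    and ind: "\<And>i. i \<in> I \<Longrightarrow> \<not> p dvd card (\<pi> i ` J) div card (\<pi> i ` Q)"
    using Q unfolding good_def by auto
  have "finite_p_group p ((B i)\<lparr>carrier := \<pi> i ` Q\<rparr>)" if i: "i \<in> I" for i
  proof -
    let ?R = "(B i)\<lparr>carrier := \<pi> i ` Q\<rparr>"
    have Rg: "group ?R" using subgroup.subgroup_is_group[OF img[OF i Qs] group_B[OF i]] .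
    obtain m where m: "card (\<pi> i ` P) = p ^ m" using pro_p_image[OF PG P_pro p i] by auto
    have PR: "subgroup (\<pi> i ` P) ?R"
      using group.subgroup_incl[OF group_B[OF i] img[OF i PG] img[OF i Qs]] PQ by (simp add: image_mono)
    have finR: "finite (carrier ?R)" using fin[OF i Qs] by simp
    obtain S a where S: "subgroup S ?R" "\<pi> i ` P \<subseteq> S" "card S = p ^ a" "\<not> p dvd order ?R div card S"
      using group.p_subgroup_in_sylow[OF Rg finR p PR m] by (elim exE conjE) simp
    have SB: "subgroup S (B i)" using group.incl_subgroup[OF group_B[OF i] img[OF i Qs] S(1)] .
    have SQ: "S \<subseteq> \<pi> i ` Q" using subgroup.subset[OF S(1)] by simp
    let ?Q' = "{x \<in> Q. \<pi> i x \<in> S}"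
    have "?Q' \<in> good"
      unfolding good_def
    proof (intro CollectI conjI ballI)
      interpret h: group_hom G "B i" "\<pi> i" by (rule group_hom_\<pi>[OF i])
      show Q's: "subgroup ?Q' G"
      proof (rule subgroupI)
        show "?Q' \<subseteq> carrier G" using subgroup.subset[OF Qs] by auto
        have "\<one> \<in> ?Q'" using subgroup.one_closed[OF Qs] subgroup.one_closed[OF SB] by simp
        then show "?Q' \<noteq> {}" by auto
        fix x assume x: "x \<in> ?Q'"
        then have xG: "x \<in> carrier G" using subgroup.mem_carrier[OF Qs] by simp
        show "inv x \<in> ?Q'" using x xG subgroup.m_inv_closed[OF Qs] subgroup.m_inv_closed[OF SB] by simp
        fix y assume y: "y \<in> ?Q'"
        then have yG: "y \<in> carrier G" using subgroup.mem_carrier[OF Qs] by simp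
        show "x \<otimes> y \<in> ?Q'" using x y xG yG subgroup.m_closed[OF Qs] subgroup.m_closed[OF SB] by simp
      qed
      have "closedin T {x \<in> carrier G. \<pi> i x \<in> S}" by (rule closed_saturated[OF i]) auto
      moreover have "?Q' = Q \<inter> {x \<in> carrier G. \<pi> i x \<in> S}" using subgroup.subset[OF Qs] by auto
      ultimately show "closedin T ?Q'" using Qc by (simp add: closedin_Int)
      show "P \<subseteq> ?Q'" using PQ S(2) by auto
      show "?Q' \<subseteq> J" using QJ by auto
      fix k assume k: "k \<in> I"
      have n: "\<not> p dvd card (\<pi> k ` Q) div card (\<pi> k ` ?Q')"
        using index_prime_to_p_preimage[OF Qs p i SB SQ _ k] S(4) by (simp add: order_def)
      have d: "card (\<pi> k ` ?Q') dvd card (\<pi> k ` Q)" "card (\<pi> k ` Q) dvd card (\<pi> k ` J)"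
        using group.card_subgroup_dvd[OF group_B[OF k] img[OF k Q's] img[OF k Qs] _ fin[OF k Qs]]
          group.card_subgroup_dvd[OF group_B[OF k] img[OF k Qs] img[OF k J(1)] _ fin[OF k J(1)]] QJ
        by (simp_all add: image_mono)
      obtain u where u: "card (\<pi> k ` Q) = card (\<pi> k ` ?Q') * u" using d(1) by (rule dvdE)
      obtain v where v: "card (\<pi> k ` J) = card (\<pi> k ` Q) * v" using d(2) by (rule dvdE)
      note uv = u v
      have "card (\<pi> k ` Q) div card (\<pi> k ` ?Q') = u" unfolding uv(1) using cpos[OF k Q's] by simp
      moreover have "card (\<pi> k ` J) div card (\<pi> k ` Q) = v" unfolding uv(2) using cpos[OF k Qs] by simp
      moreover have "card (\<pi> k ` J) div card (\<pi> k ` ?Q') = u * v"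
        unfolding uv(2) unfolding uv(1) using cpos[OF k Q's] by simp
      ultimately show "\<not> p dvd card (\<pi> k ` J) div card (\<pi> k ` ?Q')"
        using n ind[OF k] p by (simp add: prime_dvd_mult_iff)
    qed
    then have "?Q' = Q" using min by simp
    then have "S = \<pi> i ` Q" using SQ by auto
    then show ?thesis unfolding finite_p_group_def using Rg S(3) by (auto simp: order_def)
  qed
  then have "pro_p p (G\<lparr>carrier := Q\<rparr>) (subtopology T Q)" using crit[OF Qs Qc] by simp
  then have "pro_p_subgroup p Q (G\<lparr>carrier := J\<rparr>) (subtopology T J)"
    unfolding pro_p_subgroup_def
    using subgroup_incl[OF Qs J(1) QJ] Qc QJ
    by (simp add: subtopology_subtopology inf_absorb2 closedin_subset_topspace)
  then have "Q = P" using max PQ by simp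
  then show "\<not> p dvd card (\<pi> i ` J) div card (\<pi> i ` P)" if "i \<in> I" for i using ind[OF that] by simp
qed

end

section \<open>Fixed cosets in profinite groups\<close>

lemma centralizes_series_subset:
  assumes "centralizes_series G C" "D \<subseteq> C"
  shows "centralizes_series G D"
proof -
  from assms(1) obtain n K where "K 0 = {\<one>\<^bsub>G\<^esub>}" "K n = carrier G" "\<And>i. i \<le> n \<Longrightarrow> K i \<lhd> G"
    "\<And>i. i < n \<Longrightarrow> K i \<subseteq> K (Suc i)"
    "\<And>i u c. \<lbrakk>i < n; u \<in> K (Suc i); c \<in> C\<rbrakk>
       \<Longrightarrow> c \<otimes>\<^bsub>G\<^esub> u \<otimes>\<^bsub>G\<^esub> inv\<^bsub>G\<^esub> c \<otimes>\<^bsub>G\<^esub> inv\<^bsub>G\<^esub> u \<in> K i"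
    by (rule centralizes_seriesE) blast
  then show ?thesis using assms(2) unfolding centralizes_series_def
    by (intro exI[of _ n] exI[of _ K]) (simp add: subset_iff)
qed

lemma (in group_hom) image_coset_stabilizer:
  assumes "x \<in> coset_stabilizer G S g" "g \<in> carrier G"
  shows "h x \<in> coset_stabilizer H (h ` S) (h g)"
proof -
  have x: "x \<in> carrier G" "inv\<^bsub>G\<^esub> g \<otimes>\<^bsub>G\<^esub> x \<otimes>\<^bsub>G\<^esub> g \<in> S"
    using assms(1) by (simp_all add: coset_stabilizer_def)
  have "h (inv\<^bsub>G\<^esub> g \<otimes>\<^bsub>G\<^esub> x \<otimes>\<^bsub>G\<^esub> g) \<in> h ` S" using x(2) by (rule imageI)
  then show ?thesis using x(1) assms(2) by (simp add: coset_stabilizer_def)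
qed

lemma (in group_hom) image_set_mult:
  assumes "A \<subseteq> carrier G" "C \<subseteq> carrier G"
  shows "h ` (A <#>\<^bsub>G\<^esub> C) = h ` A <#>\<^bsub>H\<^esub> h ` C"
proof (intro equalityI subsetI)
  fix z assume "z \<in> h ` (A <#>\<^bsub>G\<^esub> C)"
  then obtain a c where ac: "a \<in> A" "c \<in> C" "z = h (a \<otimes>\<^bsub>G\<^esub> c)" unfolding set_mult_def by auto
  moreover have "a \<in> carrier G" "c \<in> carrier G" using ac assms by auto
  ultimately have "z = h a \<otimes>\<^bsub>H\<^esub> h c" by simp
  then show "z \<in> h ` A <#>\<^bsub>H\<^esub> h ` C" using ac unfolding set_mult_def by auto
next
  fix z assume "z \<in> h ` A <#>\<^bsub>H\<^esub> h ` C"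
  then obtain a c where ac: "a \<in> A" "c \<in> C" "z = h a \<otimes>\<^bsub>H\<^esub> h c" unfolding set_mult_def by auto
  moreover have "a \<in> carrier G" "c \<in> carrier G" using ac assms by auto
  ultimately have "z = h (a \<otimes>\<^bsub>G\<^esub> c)" by simp
  then show "z \<in> h ` (A <#>\<^bsub>G\<^esub> C)" using ac unfolding set_mult_def by blast
qed

context finite_quotients
begin

lemma image_group_hom:
  assumes "i \<in> I"
  shows "group_hom G ((B i)\<lparr>carrier := \<pi> i ` carrier G\<rparr>) (\<pi> i)"
proof -
  interpret h: group_hom G "B i" "\<pi> i" by (rule group_hom_\<pi>[OF assms])
  have "group ((B i)\<lparr>carrier := \<pi> i ` carrier G\<rparr>)"
    using subgroup.subgroup_is_group[OF h.img_is_subgroup group_B[OF assms]] .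
  then show ?thesis using hom[OF assms] is_group
    by (auto simp: group_hom_def group_hom_axioms_def hom_def)
qed

lemma finite_image_carrier: "i \<in> I \<Longrightarrow> finite (\<pi> i ` carrier G)"
  using hom_in_carrier[OF hom] finite_B by (metis finite_subset image_subsetI)

text \<open>The groups \<open>S i = V i H\<close> are the open subgroups to which the finite theorem is applied, in a
  quotient \<open>k\<close> whose kernel lies in \<open>S i\<close>; there \<open>sat\<close> says that membership in \<open>S i\<close> can be read
  off from the image. The set \<open>E i\<close> of elements conjugating \<open>S i\<close> over \<open>J\<close> is then a union of
  fibres of \<open>\<pi> k\<close>, hence closed.\<close>

theorem fixed_coset:
  assumes N: "N \<lhd> G" "closedin T N" and J: "subgroup J G" "closedin T J" and GNJ: "carrier G = N <#> J"
    and H: "subgroup H G" "closedin T H" and K: "N \<inter> H \<lhd> G\<lparr>carrier := N\<rparr>"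
    and nilN: "\<And>i. i \<in> I \<Longrightarrow> centralizes_series ((B i)\<lparr>carrier := \<pi> i ` N\<rparr>) (\<pi> i ` N)"
    and ser: "(\<forall>i\<in>I. centralizes_series ((B i)\<lparr>carrier := \<pi> i ` carrier G\<rparr>)
        (derived_set ((B i)\<lparr>carrier := \<pi> i ` carrier G\<rparr>) (\<pi> i ` carrier G))) \<or>
      (\<forall>i\<in>I. centralizes_series ((B i)\<lparr>carrier := \<pi> i ` J\<rparr>) (\<pi> i ` J))"
    and syl: "\<And>p. prime p \<Longrightarrow> \<exists>P g. subgroup P G \<and> P \<subseteq> J \<and> g \<in> carrier G \<and> P \<subseteq> coset_stabilizer G H g \<and>
      (\<forall>i\<in>I. \<not> p dvd card (\<pi> i ` J) div card (\<pi> i ` P))"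
  shows "\<exists>g\<in>carrier G. J \<subseteq> coset_stabilizer G H g"
proof -
  have Ns: "subgroup N G" using N(1) normal_imp_subgroup by auto
  have NG: "N \<subseteq> carrier G" and JG: "J \<subseteq> carrier G" and HG: "H \<subseteq> carrier G"
    using subgroup.subset[OF Ns] subgroup.subset[OF J(1)] subgroup.subset[OF H(1)] .
  have syl_image: "\<exists>P' g'. subgroup P' ((B i)\<lparr>carrier := \<pi> i ` carrier G\<rparr>) \<and> P' \<subseteq> \<pi> i ` J \<and>
      \<not> p dvd card (\<pi> i ` J) div card P' \<and> g' \<in> carrier ((B i)\<lparr>carrier := \<pi> i ` carrier G\<rparr>) \<and>
      P' \<subseteq> coset_stabilizer ((B i)\<lparr>carrier := \<pi> i ` carrier G\<rparr>) (\<pi> i ` S) g'"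
    if i: "i \<in> I" and p: "prime p" and HS: "H \<subseteq> S" for i p S
  proof -
    interpret h: group_hom G "(B i)\<lparr>carrier := \<pi> i ` carrier G\<rparr>" "\<pi> i" by (rule image_group_hom[OF i])
    obtain P g where P: "subgroup P G" "P \<subseteq> J" "g \<in> carrier G" "P \<subseteq> coset_stabilizer G H g"
      "\<forall>i\<in>I. \<not> p dvd card (\<pi> i ` J) div card (\<pi> i ` P)" using syl[OF p] by (elim exE conjE) (rule that)
    have PS: "P \<subseteq> coset_stabilizer G S g" using P(4) coset_stabilizer_mono[OF HS] by (rule subset_trans)
    have "\<pi> i ` P \<subseteq> coset_stabilizer ((B i)\<lparr>carrier := \<pi> i ` carrier G\<rparr>) (\<pi> i ` S) (\<pi> i g)"
      by (rule image_subsetI) (rule h.image_coset_stabilizer[OF subsetD[OF PS] P(3)])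
    moreover have "\<pi> i ` P \<subseteq> \<pi> i ` J" using P(2) by (rule image_mono)
    ultimately show ?thesis using h.subgroup_img_is_subgroup[OF P(1)] P(3,5) i
      by (intro exI[of _ "\<pi> i ` P"] exI[of _ "\<pi> i g"]) simp
  qed
  have GNH: "carrier G = N <#> H"
  proof -
    have L: "subgroup (N <#> H) G" using subgroup_normal_mult[OF N(1) H(1)] .
    note NH = normal_product_properties[OF N(1) H(1) refl]
    have "x \<in> N <#> H" if x: "x \<in> carrier G" for x
    proof (rule mem_closed[OF closed_set_mult[OF N(2) H(2)] x])
      fix i assume i: "i \<in> I"
      let ?R = "(B i)\<lparr>carrier := \<pi> i ` carrier G\<rparr>"
      interpret h: group_hom G ?R "\<pi> i" by (rule image_group_hom[OF i])
      have "\<pi> i ` (N <#> H) = carrier ?R"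
      proof (rule h.H.product_of_sylows_covers)
        show "finite (carrier ?R)" using finite_image_carrier[OF i] by simp
        show "subgroup (\<pi> i ` (N <#> H)) ?R" using h.subgroup_img_is_subgroup[OF L] .
        show "subgroup (\<pi> i ` J) ?R" using h.subgroup_img_is_subgroup[OF J(1)] .
        have "(N <#> H) <#> J \<subseteq> carrier G" using set_mult_closed[OF subgroup.subset[OF L] JG] .
        moreover have "N <#> J \<subseteq> (N <#> H) <#> J" using NH(3) by (rule mono_set_mult) simp
        ultimately have "carrier G = (N <#> H) <#> J" using GNJ by auto
        then show "carrier ?R = \<pi> i ` (N <#> H) <#>\<^bsub>?R\<^esub> \<pi> i ` J"
          using h.image_set_mult[OF subgroup.subset[OF L] JG] by simp
      qed (rule syl_image[OF i _ NH(2)])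
      then have "\<pi> i x \<in> \<pi> i ` (N <#> H)" using x by simp
      then show "\<exists>y\<in>N <#> H. \<pi> i y = \<pi> i x" by (elim imageE) (simp add: bexI)
    qed
    then show ?thesis using subgroup.subset[OF L] by auto
  qed
  define V where "V = (\<lambda>i. {x \<in> N. \<pi> i x = \<one>\<^bsub>B i\<^esub>})"
  define S where "S = (\<lambda>i. V i <#> H)"
  define E where "E = (\<lambda>i. {g \<in> carrier G. J \<subseteq> coset_stabilizer G (S i) g})"
  have V: "V i \<lhd> G" "V i \<subseteq> N" "closedin T (V i)" if i: "i \<in> I" for i
  proof -
    interpret h: group_hom G "B i" "\<pi> i" by (rule group_hom_\<pi>[OF i])
    have eq: "V i = N \<inter> kernel G (B i) (\<pi> i)" unfolding V_def kernel_def using NG by auto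
    show "V i \<lhd> G" unfolding eq using normal_subgroup_intersect[OF N(1) h.normal_kernel] .
    show "V i \<subseteq> N" unfolding V_def by auto
    have "closedin T {x \<in> carrier G. \<pi> i x = \<one>\<^bsub>B i\<^esub>}" by (rule closed_saturated[OF i]) auto
    then show "closedin T (V i)" unfolding eq kernel_def using N(2) by (rule closedin_Int[rotated])
  qed
  have S: "subgroup (S i) G" "H \<subseteq> S i" "V i \<subseteq> S i" "carrier G = N <#> S i" "N \<inter> S i \<lhd> G\<lparr>carrier := N\<rparr>"
    if i: "i \<in> I" for i
    unfolding S_def using normal_product_properties[OF V(1)[OF i] H(1) refl]
      enlarge_by_normal[OF N(1) H(1) GNH K V(1,2)[OF i]] by simp_all
  have E: "closedin T (E i) \<and> E i \<noteq> {}" if i: "i \<in> I" for i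
  proof -
    have "closedin T (S i)" unfolding S_def using closed_set_mult[OF V(3)[OF i] H(2)] .
    then obtain k where k: "k \<in> I" "\<forall>x\<in>carrier G. \<pi> k x = \<one>\<^bsub>B k\<^esub> \<longrightarrow> x \<in> S i"
      using open_subgroup[OF S(1)[OF i] _ Ns S(4)[OF i] i] S(3)[OF i] by (auto simp: V_def subset_iff)
    let ?R = "(B k)\<lparr>carrier := \<pi> k ` carrier G\<rparr>"
    interpret h: group_hom G ?R "\<pi> k" by (rule image_group_hom[OF k(1)])
    have sat: "x \<in> S i" if x: "x \<in> carrier G" "\<pi> k x \<in> \<pi> k ` S i" for x
    proof -
      obtain s where s: "s \<in> S i" "\<pi> k s = \<pi> k x" using x(2) by (elim imageE) simp
      have sG: "s \<in> carrier G" using s(1) subgroup.mem_carrier[OF S(1)[OF i]] by simp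
      have "inv s \<otimes> x \<in> S i" using k(2) \<pi>_eq_iff[OF k(1) sG x(1)] s(2) sG x(1) by simp
      then have "s \<otimes> (inv s \<otimes> x) \<in> S i" using s(1) subgroup.m_closed[OF S(1)[OF i]] by simp
      then show ?thesis using sG x(1) by (simp add: inv_cancel_left)
    qed
    have "closedin T (E i)"
    proof (rule closed_saturated[OF k(1)])
      show "E i \<subseteq> carrier G" unfolding E_def by auto
      fix x y assume x: "x \<in> E i" and y: "y \<in> carrier G" "\<pi> k x = \<pi> k y"
      have xG: "x \<in> carrier G" using x unfolding E_def by simp
      have "inv x \<otimes> y \<in> S i" using k(2) \<pi>_eq_iff[OF k(1) xG y(1)] y xG by simp
      then have "coset_stabilizer G (S i) (x \<otimes> (inv x \<otimes> y)) = coset_stabilizer G (S i) x"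
        by (rule coset_stabilizer_mult_right[OF S(1)[OF i] xG])
      then show "y \<in> E i" using x y(1) xG unfolding E_def by (simp add: inv_cancel_left)
    qed
    moreover have "\<exists>g'\<in>carrier ?R. \<pi> k ` J \<subseteq> coset_stabilizer ?R (\<pi> k ` S i) g'"
    proof (rule h.H.finite_fixed_coset)
      show "finite (carrier ?R)" using finite_image_carrier[OF k(1)] by simp
      show "\<pi> k ` N \<lhd> ?R" using normal.surj_hom_normal_subgroup[OF N(1) h.group_hom_axioms] by simp
      show "subgroup (\<pi> k ` J) ?R" using h.subgroup_img_is_subgroup[OF J(1)] .
      show "centralizes_series (?R\<lparr>carrier := \<pi> k ` N\<rparr>) (\<pi> k ` N)" using nilN[OF k(1)] by simp
      show "centralizes_series ?R (derived_set ?R (carrier ?R)) \<or> centralizes_series (?R\<lparr>carrier := \<pi> k ` J\<rparr>) (\<pi> k ` J)"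
        using ser k(1) by auto
      show "subgroup (\<pi> k ` S i) ?R" using h.subgroup_img_is_subgroup[OF S(1)[OF i]] .
      show "carrier ?R = \<pi> k ` N <#>\<^bsub>?R\<^esub> \<pi> k ` S i"
        using h.image_set_mult[OF NG subgroup.subset[OF S(1)[OF i]]] S(4)[OF i] by simp
      show "\<pi> k ` N \<inter> \<pi> k ` S i \<lhd> ?R\<lparr>carrier := \<pi> k ` N\<rparr>"
      proof -
        have "\<pi> k ` N \<inter> \<pi> k ` S i = \<pi> k ` (N \<inter> S i)"
          using sat NG by auto
        moreover have NR: "subgroup (\<pi> k ` N) ?R" using h.subgroup_img_is_subgroup[OF Ns] .
        have "\<pi> k \<in> hom (G\<lparr>carrier := N\<rparr>) (?R\<lparr>carrier := \<pi> k ` N\<rparr>)"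
          by (rule homI) (use hom_mult[OF hom[OF k(1)]] NG in \<open>auto simp: subset_iff\<close>)
        then have gh: "group_hom (G\<lparr>carrier := N\<rparr>) (?R\<lparr>carrier := \<pi> k ` N\<rparr>) (\<pi> k)"
          using subgroup.subgroup_is_group[OF Ns is_group] subgroup.subgroup_is_group[OF NR h.H.is_group]
          by (simp add: group_hom_def group_hom_axioms_def)
        have "\<pi> k ` (N \<inter> S i) \<lhd> ?R\<lparr>carrier := \<pi> k ` N\<rparr>"
          by (rule normal.surj_hom_normal_subgroup[OF S(5)[OF i] gh]) simp
        ultimately show ?thesis by simp
      qed
      show "\<exists>P g. subgroup P ?R \<and> P \<subseteq> \<pi> k ` J \<and> \<not> p dvd card (\<pi> k ` J) div card P \<and> g \<in> carrier ?R \<and>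
          P \<subseteq> coset_stabilizer ?R (\<pi> k ` S i) g" if "prime p" for p
        by (rule syl_image[OF k(1) that S(2)[OF i]])
    qed
    then obtain g where g: "g \<in> carrier G" "\<pi> k ` J \<subseteq> coset_stabilizer ?R (\<pi> k ` S i) (\<pi> k g)" by auto
    have "g \<in> E i"
      unfolding E_def
    proof (intro CollectI conjI subsetI g(1))
      fix x assume x: "x \<in> J"
      then have xG: "x \<in> carrier G" using JG by auto
      have "\<pi> k x \<in> coset_stabilizer ?R (\<pi> k ` S i) (\<pi> k g)" using g(2) x by auto
      then have "\<pi> k (inv g \<otimes> x \<otimes> g) \<in> \<pi> k ` S i" using xG g(1) by (simp add: coset_stabilizer_def)
      then have "inv g \<otimes> x \<otimes> g \<in> S i" using sat xG g(1) by simp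
      then show "x \<in> coset_stabilizer G (S i) g" using xG by (simp add: coset_stabilizer_def)
    qed
    ultimately show ?thesis by auto
  qed
  have "\<Inter>(E ` I) \<noteq> {}"
  proof (rule compact_Inter_nonempty)
    show "E ` I \<noteq> {}" using nonempty by simp
    show "closedin T A \<and> A \<noteq> {}" if "A \<in> E ` I" for A using that E by (elim imageE) simp
    fix A C assume "A \<in> E ` I" "C \<in> E ` I"
    then obtain i j where ij: "i \<in> I" "j \<in> I" "A = E i" "C = E j" by (elim imageE) simp
    obtain k where k: "k \<in> I" "\<forall>x\<in>carrier G. \<pi> k x = \<one>\<^bsub>B k\<^esub> \<longrightarrow> \<pi> i x = \<one>\<^bsub>B i\<^esub> \<and> \<pi> j x = \<one>\<^bsub>B j\<^esub>"
      using directed[OF ij(1,2)] by auto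
    have "V k \<subseteq> V i" "V k \<subseteq> V j" unfolding V_def using k(2) NG by auto
    then have "S k \<subseteq> S i" "S k \<subseteq> S j" unfolding S_def by (auto intro: mono_set_mult[THEN subsetD])
    moreover have "E k \<subseteq> E l" if "S k \<subseteq> S l" for l
    proof
      fix g assume "g \<in> E k"
      then have g: "g \<in> carrier G" "J \<subseteq> coset_stabilizer G (S k) g" unfolding E_def by simp_all
      then have "J \<subseteq> coset_stabilizer G (S l) g" using coset_stabilizer_mono[OF that] by (intro subset_trans[OF g(2)])
      then show "g \<in> E l" unfolding E_def using g(1) by simp
    qed
    ultimately have "E k \<subseteq> E i \<inter> E j" by simp
    then show "\<exists>D\<in>E ` I. D \<subseteq> A \<inter> C" using k(1) ij by auto
  qed
  then obtain g where g: "\<And>i. i \<in> I \<Longrightarrow> g \<in> E i" by auto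
  have gG: "g \<in> carrier G" using g nonempty unfolding E_def by auto
  have "x \<in> coset_stabilizer G H g" if x: "x \<in> J" for x
  proof -
    have xG: "x \<in> carrier G" using x JG by auto
    have "inv g \<otimes> x \<otimes> g \<in> H"
    proof (rule mem_closed[OF H(2)])
      show "inv g \<otimes> x \<otimes> g \<in> carrier G" using xG gG by simp
      fix i assume i: "i \<in> I"
      interpret h: group_hom G "B i" "\<pi> i" by (rule group_hom_\<pi>[OF i])
      have "inv g \<otimes> x \<otimes> g \<in> S i" using g[OF i] x unfolding E_def by (auto simp: coset_stabilizer_def subset_iff)
      then obtain v y where v: "v \<in> V i" "y \<in> H" "inv g \<otimes> x \<otimes> g = v \<otimes> y" unfolding S_def set_mult_def by auto
      have "v \<in> carrier G" "y \<in> carrier G" "\<pi> i v = \<one>\<^bsub>B i\<^esub>" using v(1,2) NG HG unfolding V_def by auto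
      then have "\<pi> i (v \<otimes> y) = \<pi> i y" by simp
      then show "\<exists>y\<in>H. \<pi> i y = \<pi> i (inv g \<otimes> x \<otimes> g)" unfolding v(3) using v(2) by (intro bexI[of _ y]) simp_all
    qed
    then show ?thesis using xG by (simp add: coset_stabilizer_def)
  qed
  then show ?thesis using gG by auto
qed

lemma nilpotent_image:
  assumes S: "subgroup S G" and nil: "pronilpotent (G\<lparr>carrier := S\<rparr>) (subtopology T S)" and i: "i \<in> I"
  shows "centralizes_series ((B i)\<lparr>carrier := \<pi> i ` S\<rparr>) (\<pi> i ` S)"
proof -
  obtain A :: "'a set monoid" and \<rho> where A: "group A" "nilpotent_group A"
    and \<rho>: "\<rho> \<in> hom (G\<lparr>carrier := S\<rparr>) A" "\<And>x. x \<in> S \<Longrightarrow> \<rho> x = \<one>\<^bsub>A\<^esub> \<Longrightarrow> \<pi> i x = \<one>\<^bsub>B i\<^esub>"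
    using finite_quotient_refining[OF S nil[unfolded pronilpotent_def] i] by (elim exE conjE) simp
  have \<pi>S: "\<pi> i \<in> hom (G\<lparr>carrier := S\<rparr>) (B i)" using hom[OF i] subgroup.subset[OF S] by (auto simp: hom_def)
  have "centralizes_series ((B i)\<lparr>carrier := \<pi> i ` carrier (G\<lparr>carrier := S\<rparr>)\<rparr>) (\<pi> i ` S)"
    by (rule centralizes_series_image[OF subgroup.subgroup_is_group[OF S is_group] A(1) group_B[OF i] \<rho>(1) \<pi>S _
        nilpotent_centralizes_series[OF A(2)]]) (use \<rho> in \<open>auto simp: hom_def\<close>)
  then show ?thesis by simp
qed

lemma supersolvable_image:
  assumes sup: "prosupersolvable G T" and i: "i \<in> I"
  shows "centralizes_series ((B i)\<lparr>carrier := \<pi> i ` carrier G\<rparr>)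
    (derived_set ((B i)\<lparr>carrier := \<pi> i ` carrier G\<rparr>) (\<pi> i ` carrier G))"
proof -
  let ?R = "(B i)\<lparr>carrier := \<pi> i ` carrier G\<rparr>"
  have "subtopology T (carrier G) = T" unfolding topspace_eq[symmetric] by (rule subtopology_topspace)
  then have pro: "pro_class supersolvable_group (G\<lparr>carrier := carrier G\<rparr>) (subtopology T (carrier G))"
    using sup by (simp add: prosupersolvable_def)
  obtain A :: "'a set monoid" and \<rho> where A: "group A" "supersolvable_group A"
    and \<rho>: "\<rho> \<in> hom G A" "\<And>x. x \<in> carrier G \<Longrightarrow> \<rho> x = \<one>\<^bsub>A\<^esub> \<Longrightarrow> \<pi> i x = \<one>\<^bsub>B i\<^esub>"
    using finite_quotient_refining[OF subgroup_self pro i] by (elim exE conjE) simp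
  interpret r: group_hom G A \<rho> using A(1) \<rho>(1) is_group by (simp add: group_hom_def group_hom_axioms_def)
  interpret h: group_hom G ?R "\<pi> i" by (rule image_group_hom[OF i])
  have "centralizes_series ?R (\<pi> i ` derived_set G (carrier G))"
  proof (rule centralizes_series_image[OF is_group A(1) group_B[OF i] \<rho>(1) hom[OF i] \<rho>(2)
        supersolvable_centralizes_series[OF A(2)]])
    show "\<rho> ` derived_set G (carrier G) \<subseteq> derived_set A (carrier A)"
    proof (rule image_subsetI)
      fix c assume "c \<in> derived_set G (carrier G)"
      then obtain x y where xy: "x \<in> carrier G" "y \<in> carrier G" "c = x \<otimes> y \<otimes> inv x \<otimes> inv y" by auto
      then have "\<rho> c = \<rho> x \<otimes>\<^bsub>A\<^esub> \<rho> y \<otimes>\<^bsub>A\<^esub> inv\<^bsub>A\<^esub> \<rho> x \<otimes>\<^bsub>A\<^esub> inv\<^bsub>A\<^esub> \<rho> y" by simp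
      then show "\<rho> c \<in> derived_set A (carrier A)"
        by (intro UN_I[OF r.hom_closed[OF xy(1)] UN_I[OF r.hom_closed[OF xy(2)]]]) simp
    qed
  qed auto
  moreover have "derived_set ?R (\<pi> i ` carrier G) \<subseteq> \<pi> i ` derived_set G (carrier G)"
  proof
    fix c assume "c \<in> derived_set ?R (\<pi> i ` carrier G)"
    then obtain x y where xy: "x \<in> carrier G" "y \<in> carrier G"
      "c = \<pi> i x \<otimes>\<^bsub>?R\<^esub> \<pi> i y \<otimes>\<^bsub>?R\<^esub> inv\<^bsub>?R\<^esub> \<pi> i x \<otimes>\<^bsub>?R\<^esub> inv\<^bsub>?R\<^esub> \<pi> i y" by auto
    have "c = \<pi> i (x \<otimes> y \<otimes> inv x \<otimes> inv y)" unfolding xy(3) using xy(1,2) by simp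
    moreover have "x \<otimes> y \<otimes> inv x \<otimes> inv y \<in> derived_set G (carrier G)"
      by (rule UN_I[OF xy(1) UN_I[OF xy(2)]]) simp
    ultimately show "c \<in> \<pi> i ` derived_set G (carrier G)" by (rule image_eqI)
  qed
  ultimately show ?thesis by (rule centralizes_series_subset)
qed

end

theorem corollary1p4:
  fixes G :: "'a monoid" and T :: "'a topology" and N J :: "'a set"
    and \<Omega> :: "'b set" and \<phi> :: "'a \<Rightarrow> 'b \<Rightarrow> 'b"
  assumes "profinite_semidirect_product G T N J"
    and "pronilpotent (G\<lparr>carrier := N\<rparr>) (subtopology T N)"
    and "prosupersolvable G T \<or> pronilpotent (G\<lparr>carrier := J\<rparr>) (subtopology T J)"
    and "\<Omega> \<noteq> {}"
    and "transitive_action G \<Omega> \<phi>"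
    and "\<forall>\<alpha>\<in>\<Omega>. closedin T (stabilizer G \<phi> \<alpha>)"
    and "\<exists>\<alpha>\<in>\<Omega>. (N \<inter> stabilizer G \<phi> \<alpha>) \<lhd> (G\<lparr>carrier := N\<rparr>)"
    and "\<forall>p::nat. prime p \<longrightarrow>
           (\<exists>P. sylow_pro_p_subgroup p P (G\<lparr>carrier := J\<rparr>) (subtopology T J) \<and>
                (\<exists>\<omega>\<in>\<Omega>. fixes_point \<phi> P \<omega>))"
  shows "\<exists>\<omega>\<in>\<Omega>. fixes_point \<phi> J \<omega>"
proof -
  have prof: "pro_class (\<lambda>_. True) G T" and N: "N \<lhd> G" "closedin T N" and J: "subgroup J G" "closedin T J"
    and GNJ: "carrier G = N <#>\<^bsub>G\<^esub> J"
    using assms(1) unfolding profinite_semidirect_product_def profinite_def by simp_all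
  obtain I :: "'a set set" and B :: "'a set \<Rightarrow> 'a set monoid" and \<pi> where fq: "finite_quotients G T I B \<pi>"
    and crit: "\<forall>Q C'. subgroup Q G \<longrightarrow> closedin T Q \<longrightarrow> (\<forall>i\<in>I. C' ((B i)\<lparr>carrier := \<pi> i ` Q\<rparr>)) \<longrightarrow>
      pro_class C' (G\<lparr>carrier := Q\<rparr>) (subtopology T Q)"
    using pro_class_finite_quotients[OF prof] by metis
  interpret finite_quotients G T I B \<pi> by (rule fq)
  interpret act: transitive_action G \<Omega> \<phi> by (rule assms(5))
  obtain \<alpha> where \<alpha>: "\<alpha> \<in> \<Omega>" "(N \<inter> stabilizer G \<phi> \<alpha>) \<lhd> (G\<lparr>carrier := N\<rparr>)" using assms(7) by auto
  define H where "H = stabilizer G \<phi> \<alpha>"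
  have H: "subgroup H G" "closedin T H" "N \<inter> H \<lhd> G\<lparr>carrier := N\<rparr>"
    unfolding H_def using act.stabilizer_subgroup[OF \<alpha>(1)] assms(6) \<alpha> by simp_all
  have Ns: "subgroup N G" using N(1) normal_imp_subgroup by auto
  have JG: "J \<subseteq> carrier G" using subgroup.subset[OF J(1)] .
  have stab: "x \<in> coset_stabilizer G H g \<longleftrightarrow> \<phi> x (\<phi> g \<alpha>) = \<phi> g \<alpha>"
    if x: "x \<in> carrier G" and g: "g \<in> carrier G" for x g
  proof -
    have ga: "\<phi> g \<alpha> \<in> \<Omega>" using act.element_image[OF g \<alpha>(1) refl] .
    have xga: "\<phi> x (\<phi> g \<alpha>) \<in> \<Omega>" using act.element_image[OF x ga refl] .
    have "\<phi> (inv\<^bsub>G\<^esub> g \<otimes>\<^bsub>G\<^esub> x \<otimes>\<^bsub>G\<^esub> g) \<alpha> = \<phi> (inv\<^bsub>G\<^esub> g) (\<phi> x (\<phi> g \<alpha>))"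
      using act.composition_rule[OF \<alpha>(1), of "inv\<^bsub>G\<^esub> g \<otimes>\<^bsub>G\<^esub> x" g] act.composition_rule[OF ga, of "inv\<^bsub>G\<^esub> g" x] x g by simp
    moreover have "\<phi> (inv\<^bsub>G\<^esub> g) (\<phi> g \<alpha>) = \<alpha>" using act.orbit_sym_aux[OF g \<alpha>(1) refl] .
    moreover have "\<phi> (inv\<^bsub>G\<^esub> g) u = \<phi> (inv\<^bsub>G\<^esub> g) w \<longleftrightarrow> u = w" if "u \<in> \<Omega>" "w \<in> \<Omega>" for u w
      using act.inj_prop[OF inv_closed[OF g]] that by (simp add: inj_on_eq_iff)
    ultimately have "\<phi> (inv\<^bsub>G\<^esub> g \<otimes>\<^bsub>G\<^esub> x \<otimes>\<^bsub>G\<^esub> g) \<alpha> = \<alpha> \<longleftrightarrow> \<phi> x (\<phi> g \<alpha>) = \<phi> g \<alpha>" using ga xga by metis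
    then show ?thesis using x g by (simp add: coset_stabilizer_def H_def stabilizer_def)
  qed
  have "\<exists>g\<in>carrier G. J \<subseteq> coset_stabilizer G H g"
  proof (rule fixed_coset[OF N J GNJ H])
    show "centralizes_series ((B i)\<lparr>carrier := \<pi> i ` N\<rparr>) (\<pi> i ` N)" if "i \<in> I" for i
      using nilpotent_image[OF Ns assms(2) that] .
    show "(\<forall>i\<in>I. centralizes_series ((B i)\<lparr>carrier := \<pi> i ` carrier G\<rparr>)
        (derived_set ((B i)\<lparr>carrier := \<pi> i ` carrier G\<rparr>) (\<pi> i ` carrier G))) \<or>
      (\<forall>i\<in>I. centralizes_series ((B i)\<lparr>carrier := \<pi> i ` J\<rparr>) (\<pi> i ` J))"
      using assms(3)
    proof
      assume "prosupersolvable G T"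
      then show ?thesis by (intro disjI1 ballI supersolvable_image)
    next
      assume "pronilpotent (G\<lparr>carrier := J\<rparr>) (subtopology T J)"
      then show ?thesis by (intro disjI2 ballI nilpotent_image J(1))
    qed
    fix p :: nat assume p: "prime p"
    obtain P \<omega> where P: "sylow_pro_p_subgroup p P (G\<lparr>carrier := J\<rparr>) (subtopology T J)"
      and \<omega>: "\<omega> \<in> \<Omega>" "fixes_point \<phi> P \<omega>" using assms(8) p by auto
    have cr: "pro_p p (G\<lparr>carrier := Q\<rparr>) (subtopology T Q)"
      if "subgroup Q G" "closedin T Q" "\<forall>i\<in>I. finite_p_group p ((B i)\<lparr>carrier := \<pi> i ` Q\<rparr>)" for Q
      using crit that unfolding pro_p_def by simp
    have Pp: "subgroup P G" "P \<subseteq> J"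
      by (rule sylow_image_index(1)[OF J p cr P] sylow_image_index(2)[OF J p cr P]; assumption)+
    have ind: "\<not> p dvd card (\<pi> i ` J) div card (\<pi> i ` P)" if "i \<in> I" for i
      by (rule sylow_image_index(3)[OF J p cr P that]; assumption)
    obtain g where g: "g \<in> carrier G" "\<phi> g \<alpha> = \<omega>" using act.unique_orbit[OF \<alpha>(1) \<omega>(1)] by auto
    have "P \<subseteq> coset_stabilizer G H g"
    proof
      fix x assume x: "x \<in> P"
      have "\<phi> x \<omega> = \<omega>" using bspec[OF \<omega>(2)[unfolded fixes_point_def] x] .
      then have "\<phi> x (\<phi> g \<alpha>) = \<phi> g \<alpha>" unfolding g(2) .
      then show "x \<in> coset_stabilizer G H g"
        by (rule iffD2[OF stab[OF subgroup.mem_carrier[OF Pp(1) x] g(1)]])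
    qed
    then show "\<exists>P g. subgroup P G \<and> P \<subseteq> J \<and> g \<in> carrier G \<and> P \<subseteq> coset_stabilizer G H g \<and>
        (\<forall>i\<in>I. \<not> p dvd card (\<pi> i ` J) div card (\<pi> i ` P))"
      using Pp g(1) ind by (intro exI[of _ P] exI[of _ g] conjI ballI)
  qed
  then obtain g where g: "g \<in> carrier G" "J \<subseteq> coset_stabilizer G H g" by auto
  have "\<phi> x (\<phi> g \<alpha>) = \<phi> g \<alpha>" if "x \<in> J" for x
    using stab[OF subsetD[OF JG that] g(1)] g(2) that by auto
  then show ?thesis
    using act.element_image[OF g(1) \<alpha>(1) refl] by (intro bexI[of _ "\<phi> g \<alpha>"]) (simp_all add: fixes_point_def)
qed

end
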